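(* Let $K$ be an ordered field, $R$ a real closed extension of $K$ and $C=R[i]$. Let $P\in K[Y_1,\dots,Y_m,X]$ be monic with respect to $X$, of degree $p$ in $X$, and let $\mathcal P=P_1,\dots,P_s$ be a list of polynomials in $K[Y_1,\dots,Y_m,X]$. For $y\in R^m$, let $Z(y)\subset C$ be the zero set of $P(y_1,\dots,y_m,X)$ and let $\mathcal P(y,X)$ be the list in $R[X]$ obtained from $\mathcal P$ after specialization of $Y_1,\dots,Y_m$ at $y_1,\dots,y_m$. Let $\tau$ be a sign condition on $\mathrm{HElim}(P,\mathcal P)$. Then the lists $\mathrm{Feas}_{\rm sign}(\mathcal P(y,X),Z(y)_R)$ and $\mathrm{Feas}(\mathcal P(y,X),Z(y)_{C\setminus R})$ and their corresponding lists $c_{\rm sign}(\mathcal P(y,X),Z(y)_R)$ and $c(\mathcal P(y,X),Z(y)_{C\setminus R})$ of cardinals are fixed as $y$ varies in $\mathrm{Reali}_{\rm sign}(\tau,R^m)$.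
   Context: Definition of $\mathrm{HElim}$. $\mathrm{bit}(p)$ is the number of bits in the binary representation of $p$. $\mathrm{Prod}_{\mathrm{bit}(p)}(\mathcal P)$ is the family of polynomials $\mathcal P^\alpha=\prod_{1\le i\le s}P_i^{\alpha_i}$ with $\alpha=(\alpha_1,\dots,\alpha_s)\in\{0,1,2\}^{\{1,\dots,s\}}$ such that $\mathrm{card}\{i\mid\alpha_i\ne0\}\le\mathrm{bit}(p)$. For $Q\in K[Y_1,\dots,Y_m,X]$, the Hermite matrix $\mathrm{Her}(P,Q)$ is the $p\times p$ symmetric matrix with entries in $K[Y_1,\dots,Y_m]$ whose $(i,j)$ entry ($1\le i,j\le p$) is the trace of multiplication by $Q X^{i+j-2}$ on the free $K[Y_1,\dots,Y_m]$-module $K[Y_1,\dots,Y_m][X]/(P)$ (equivalently, the sum of $Q(x)x^{i+j-2}$ over the roots $x$ of $P$ in $X$, counted with multiplicity). $\mathrm{HMin}(P,Q)\subset K[Y_1,\dots,Y_m]$ is the set of principal minors of $\mathrm{Her}(P,Q)$. Finally $\mathrm{HElim}(P,\mathcal P)=\bigcup_{Q\in\mathrm{Prod}_{\mathrm{bit}(p)}(\mathcal P)}\mathrm{HMin}(P,Q)$. A sign condition on a finite family $\mathcal F$ of polynomials in $K[Y_1,\dots,Y_m]$ is an element $\tau\in\{0,1,-1\}^{\mathcal F}$, and $\mathrm{Reali}_{\rm sign}(\tau,R^m)=\{y\in R^m\mid \mathrm{sign}(F(y))=\tau(F)\text{ for all }F\in\mathcal F\}$, where $\mathrm{sign}(a)\in\{0,1,-1\}$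 is the sign of $a\in R$. For a finite $Z\subset C$: $Z_R=Z\cap R$, $Z_{C\setminus R}=Z\cap(C\setminus R)$. For a list $\mathcal Q=Q_1,\dots,Q_s$ in $R[X]$ and a finite $W\subset R$, $\mathrm{Feas}_{\rm sign}(\mathcal Q,W)$ is the list of $\rho\in\{0,1,-1\}^{\{1,\dots,s\}}$ such that $c_{\rm sign}(\rho,W)=\mathrm{card}\{x\in W\mid \mathrm{sign}(Q_j(x))=\rho(j)\ \forall j\}$ is nonzero, and $c_{\rm sign}(\mathcal Q,W)$ is the corresponding list of cardinals. For a finite $Y\subset C$, $\mathrm{Feas}(\mathcal Q,Y)$ is the list of $\sigma\in\{0,1\}^{\{1,\dots,s\}}$ such that $c(\sigma,Y)=\mathrm{card}\{x\in Y\mid \mathrm{inv}(Q_j(x))=\sigma(j)\ \forall j\}$ is nonzero, where $\mathrm{inv}(a)=0$ if $a=0$ and $1$ otherwise, and $c(\mathcal Q,Y)$ is the corresponding list of cardinals. All lists are ordered by a fixed total order on conditions and have no repetitions. *)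

theory Defs
  imports
    "HOL-Library.Poly_Mapping"
    "HOL-Library.FuncSet"
    "HOL-Library.Log_Nat"
    "HOL-Computational_Algebra.Polynomial"
    "Jordan_Normal_Form.Determinant"
    "Jordan_Normal_Form.DL_Submatrix"
begin

section \<open>Real closed fields and their quadratic extension by \<open>i\<close>\<close>

text \<open>
  The nonnegative elements are the squares and every univariate polynomial of odd degree has a
  root. The polynomial is given by its coefficients \<open>c 0, \<dots>, c n\<close>.
\<close>

class real_closed_field = linordered_field +
  assumes nonneg_is_square: "0 \<le> a \<Longrightarrow> \<exists>b. a = b ^ 2"
    and odd_degree_has_root: "odd n \<Longrightarrow> c n \<noteq> 0 \<Longrightarrow> \<exists>x. (\<Sum>k\<le>n. c k * x ^ k) = 0"

text \<open>The field \<open>R[i]\<close>, for any ordered field \<open>R\<close>: pairs \<open>a + b i\<close> with \<open>i\<^sup>2 = -1\<close>.\<close>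

codatatype 'r adjoin_i = Adjoin_i (real_part: 'r) (imag_part: 'r)

lemma adjoin_i_eq_iff: "x = y \<longleftrightarrow> real_part x = real_part y \<and> imag_part x = imag_part y"
  by (auto intro: adjoin_i.expand)

instantiation adjoin_i :: (linordered_field) field
begin

primcorec zero_adjoin_i where
  "real_part 0 = 0"
| "imag_part 0 = 0"

primcorec plus_adjoin_i where
  "real_part (x + y) = real_part x + real_part y"
| "imag_part (x + y) = imag_part x + imag_part y"

primcorec uminus_adjoin_i where
  "real_part (- x) = - real_part x"
| "imag_part (- x) = - imag_part x"

primcorec minus_adjoin_i where
  "real_part (x - y) = real_part x - real_part y"
| "imag_part (x - y) = imag_part x - imag_part y"

primcorec one_adjoin_i where
  "real_part 1 = 1"
| "imag_part 1 = 0"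

primcorec times_adjoin_i where
  "real_part (x * y) = real_part x * real_part y - imag_part x * imag_part y"
| "imag_part (x * y) = real_part x * imag_part y + imag_part x * real_part y"

primcorec inverse_adjoin_i where
  "real_part (inverse x) = real_part x / ((real_part x)\<^sup>2 + (imag_part x)\<^sup>2)"
| "imag_part (inverse x) = - imag_part x / ((real_part x)\<^sup>2 + (imag_part x)\<^sup>2)"

definition divide_adjoin_i :: "'a adjoin_i \<Rightarrow> 'a adjoin_i \<Rightarrow> 'a adjoin_i" where
  "divide_adjoin_i x y = x * inverse y"

instance
proof
  fix x :: "'a adjoin_i"
  assume "x \<noteq> 0"
  then have "(real_part x)\<^sup>2 + (imag_part x)\<^sup>2 \<noteq> 0"
    by (simp add: adjoin_i_eq_iff sum_power2_eq_zero_iff)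
  then show "inverse x * x = 1"
    by (simp add: adjoin_i_eq_iff power2_eq_square add_divide_distrib [symmetric])
qed (simp_all add: adjoin_i_eq_iff divide_adjoin_i_def algebra_simps)

end

definition of_base :: "'r::linordered_field \<Rightarrow> 'r adjoin_i" where
  "of_base a = Adjoin_i a 0"


section \<open>The ring \<open>K[Y\<^sub>1, \<dots>, Y\<^sub>m]\<close> and specialization\<close>

text \<open>
  Polynomials over \<open>'k\<close> in variables indexed by \<open>nat\<close> are finitely supported maps from exponent
  vectors to coefficients, with the convolution product. \<open>Y\<^sub>1, \<dots>, Y\<^sub>m\<close> are the variables
  \<open>0, \<dots>, m - 1\<close>.
\<close>

type_synonym 'k mpoly = "(nat \<Rightarrow>\<^sub>0 nat) \<Rightarrow>\<^sub>0 'k"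

definition mpoly_ring :: "nat \<Rightarrow> 'k::zero mpoly set" where
  "mpoly_ring m = {F. \<forall>e \<in> Poly_Mapping.keys F. Poly_Mapping.keys e \<subseteq> {..<m}}"

definition poly_over :: "'a::zero set \<Rightarrow> 'a poly set" where
  "poly_over A = {Q. \<forall>n. coeff Q n \<in> A}"

definition mpoly_eval :: "('k::zero \<Rightarrow> 'r::comm_ring_1) \<Rightarrow> (nat \<Rightarrow> 'r) \<Rightarrow> 'k mpoly \<Rightarrow> 'r" where
  "mpoly_eval \<phi> y F =
     (\<Sum>e \<in> Poly_Mapping.keys F.
        \<phi> (Poly_Mapping.lookup F e) *
        (\<Prod>v \<in> Poly_Mapping.keys e. y v ^ Poly_Mapping.lookup e v))"

definition specialize ::
  "('k::zero \<Rightarrow> 'r::comm_ring_1) \<Rightarrow> (nat \<Rightarrow> 'r) \<Rightarrow> 'k mpoly poly \<Rightarrow> 'r poly" where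
  "specialize \<phi> y Q = map_poly (mpoly_eval \<phi> y) Q"

definition affine_space :: "nat \<Rightarrow> (nat \<Rightarrow> 'r) set" where
  "affine_space m = {..<m} \<rightarrow>\<^sub>E UNIV"


section \<open>Hermite matrices and the family \<open>HElim\<close>\<close>

text \<open>
  Matrix of multiplication by \<open>F\<close> on \<open>A[X]/(P)\<close> in the basis \<open>1, X, \<dots>, X\<^bsup>p-1\<^esup>\<close>, for \<open>P\<close> monic of
  degree \<open>p\<close>. For monic \<open>P\<close>, pseudo-division is Euclidean division.
\<close>

lemma pseudo_mod_monic:
  fixes P F :: "'a::idom poly"
  assumes "lead_coeff P = 1"
  shows "P dvd F - pseudo_mod F P"
    and "pseudo_mod F P = 0 \<or> degree (pseudo_mod F P) < degree P"
proof -
  have P: "P \<noteq> 0" using assms by auto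
  obtain q r where qr: "pseudo_divmod F P = (q, r)" by force
  then show "P dvd F - pseudo_mod F P"
    using pseudo_divmod(1)[OF P qr] assms by (simp add: pseudo_mod_def)
  show "pseudo_mod F P = 0 \<or> degree (pseudo_mod F P) < degree P"
    using pseudo_mod(2)[OF P] .
qed

definition mult_matrix :: "'a::idom poly \<Rightarrow> 'a poly \<Rightarrow> 'a mat" where
  "mult_matrix P F =
     mat (degree P) (degree P) (\<lambda>(k, l). coeff (pseudo_mod (F * monom 1 l) P) k)"

definition mult_trace :: "'a::idom poly \<Rightarrow> 'a poly \<Rightarrow> 'a" where
  "mult_trace P F = (\<Sum>k < degree P. mult_matrix P F $$ (k, k))"

text \<open>Row and column indices start at \<open>0\<close>, hence the exponent \<open>i + j\<close>.\<close>

definition Her :: "'a::idom poly \<Rightarrow> 'a poly \<Rightarrow> 'a mat" where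
  "Her P Q = mat (degree P) (degree P) (\<lambda>(i, j). mult_trace P (Q * monom 1 (i + j)))"

text \<open>All principal minors, not only the leading ones.\<close>

definition HMin :: "'a::idom poly \<Rightarrow> 'a poly \<Rightarrow> 'a set" where
  "HMin P Q = {det (submatrix (Her P Q) I I) | I. I \<noteq> {} \<and> I \<subseteq> {..<degree P}}"

text \<open>\<open>floorlog 2 p\<close> is the number of binary digits of \<open>p\<close>.\<close>

definition Prod_family :: "nat \<Rightarrow> 'a::comm_ring_1 poly list \<Rightarrow> 'a poly set" where
  "Prod_family b Ps =
     {\<Prod>i<length Ps. (Ps ! i) ^ \<alpha> i | \<alpha>.
        \<alpha> \<in> {..<length Ps} \<rightarrow>\<^sub>E {0, 1, 2} \<and> card {i. i < length Ps \<and> \<alpha> i \<noteq> 0} \<le> b}"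

definition HElim :: "'a::idom poly \<Rightarrow> 'a poly list \<Rightarrow> 'a set" where
  "HElim P Ps = (\<Union>Q \<in> Prod_family (floorlog 2 (degree P)) Ps. HMin P Q)"

definition Reali_sign ::
  "('k::zero \<Rightarrow> 'r::linordered_field) \<Rightarrow> nat \<Rightarrow> 'k mpoly set \<Rightarrow> ('k mpoly \<Rightarrow> 'r) \<Rightarrow> (nat \<Rightarrow> 'r) set"
  where
  "Reali_sign \<phi> m \<F> \<tau> = {y \<in> affine_space m. \<forall>F \<in> \<F>. sgn (mpoly_eval \<phi> y F) = \<tau> F}"


section \<open>Feasible conditions and their cardinals\<close>

text \<open>The enumeration of a finite set of conditions, without repetition, along a total order.\<close>

definition ordered_list :: "('c \<times> 'c) set \<Rightarrow> 'c set \<Rightarrow> 'c list" where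
  "ordered_list ord A = (THE xs. set xs = A \<and> distinct xs \<and> sorted_wrt (\<lambda>a b. (a, b) \<in> ord) xs)"

lemma ordered_list_ex1:
  assumes "linear_order_on B ord" "finite A" "A \<subseteq> B"
  shows "\<exists>!xs. set xs = A \<and> distinct xs \<and> sorted_wrt (\<lambda>a b. (a, b) \<in> ord) xs"
proof -
  have total: "total_on B ord" and antisym: "antisym ord" and trans: "trans ord"
    using assms(1) by (auto simp: linear_order_on_def partial_order_on_def preorder_on_def)
  let ?sorted = "sorted_wrt (\<lambda>a b. (a, b) \<in> ord)"
  from assms(2,3) have "\<exists>xs. set xs = A \<and> distinct xs \<and> ?sorted xs"
  proof (induction A rule: finite_induct)
    case (insert x A)
    then obtain xs where xs: "set xs = A" "distinct xs" "?sorted xs" by auto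
    let ?below = "filter (\<lambda>a. (a, x) \<in> ord) xs" and ?above = "filter (\<lambda>a. (a, x) \<notin> ord) xs"
    have above: "(x, a) \<in> ord" if "a \<in> set ?above" for a
      using that total insert.prems insert.hyps xs(1) unfolding total_on_def by auto
    have "?sorted (?below @ x # ?above)"
      using xs(3) above transD[OF trans] by (auto simp: sorted_wrt_append intro: sorted_wrt_filter)
    moreover have "distinct (?below @ x # ?above)" "set (?below @ x # ?above) = insert x A"
      using xs(1,2) insert.hyps by auto
    ultimately show ?case by blast
  qed simp
  moreover have "xs = ys"
    if "set xs = set ys" "distinct xs" "distinct ys" "?sorted xs" "?sorted ys" for xs ys
    using that
  proof (induction xs arbitrary: ys)
    case (Cons x xs)
    then obtain y ys' where ys: "ys = y # ys'" by (cases ys) auto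
    have "x = y"
    proof (rule ccontr)
      assume "x \<noteq> y"
      then have "x \<in> set ys'" "y \<in> set xs" using Cons.prems(1) ys by auto
      then have "(y, x) \<in> ord" "(x, y) \<in> ord" using Cons.prems(4,5) ys by auto
      then show False using antisym \<open>x \<noteq> y\<close> by (auto dest: antisymD)
    qed
    moreover have "set xs = set ys'"
      using Cons.prems(1-3) ys \<open>x = y\<close> by auto
    then have "xs = ys'" using Cons.IH[of ys'] Cons.prems(2-5) ys by auto
    ultimately show ?case using ys by simp
  qed simp
  ultimately show ?thesis by metis
qed

definition sign_conditions :: "nat \<Rightarrow> (nat \<Rightarrow> 'r::linordered_field) set" where
  "sign_conditions s = {..<s} \<rightarrow>\<^sub>E {0, 1, -1}"

definition count_sign :: "'r::linordered_field poly list \<Rightarrow> 'r set \<Rightarrow> (nat \<Rightarrow> 'r) \<Rightarrow> nat" where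
  "count_sign Qs W \<rho> = card {x \<in> W. \<forall>j < length Qs. sgn (poly (Qs ! j) x) = \<rho> j}"

definition Feas_sign ::
  "((nat \<Rightarrow> 'r) \<times> (nat \<Rightarrow> 'r)) set \<Rightarrow> 'r::linordered_field poly list \<Rightarrow> 'r set \<Rightarrow> (nat \<Rightarrow> 'r) list"
  where
  "Feas_sign ord Qs W =
     ordered_list ord {\<rho> \<in> sign_conditions (length Qs). count_sign Qs W \<rho> \<noteq> 0}"

definition c_sign ::
  "((nat \<Rightarrow> 'r) \<times> (nat \<Rightarrow> 'r)) set \<Rightarrow> 'r::linordered_field poly list \<Rightarrow> 'r set \<Rightarrow> nat list" where
  "c_sign ord Qs W = map (count_sign Qs W) (Feas_sign ord Qs W)"

definition invertibility :: "'a::zero \<Rightarrow> nat" where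
  "invertibility a = (if a = 0 then 0 else 1)"

definition inv_conditions :: "nat \<Rightarrow> (nat \<Rightarrow> nat) set" where
  "inv_conditions s = {..<s} \<rightarrow>\<^sub>E {0, 1}"

definition poly_adjoin_i :: "'r::linordered_field poly \<Rightarrow> 'r adjoin_i \<Rightarrow> 'r adjoin_i" where
  "poly_adjoin_i Q z = poly (map_poly of_base Q) z"

definition count_inv ::
  "'r::linordered_field poly list \<Rightarrow> 'r adjoin_i set \<Rightarrow> (nat \<Rightarrow> nat) \<Rightarrow> nat" where
  "count_inv Qs W \<sigma> =
     card {z \<in> W. \<forall>j < length Qs. invertibility (poly_adjoin_i (Qs ! j) z) = \<sigma> j}"

definition Feas_inv ::
  "((nat \<Rightarrow> nat) \<times> (nat \<Rightarrow> nat)) set \<Rightarrow> 'r::linordered_field poly list \<Rightarrow> 'r adjoin_i set \<Rightarrow>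
    (nat \<Rightarrow> nat) list" where
  "Feas_inv ord Qs W =
     ordered_list ord {\<sigma> \<in> inv_conditions (length Qs). count_inv Qs W \<sigma> \<noteq> 0}"

definition c_inv ::
  "((nat \<Rightarrow> nat) \<times> (nat \<Rightarrow> nat)) set \<Rightarrow> 'r::linordered_field poly list \<Rightarrow> 'r adjoin_i set \<Rightarrow>
    nat list" where
  "c_inv ord Qs W = map (count_inv Qs W) (Feas_inv ord Qs W)"

definition zero_set :: "'r::linordered_field poly \<Rightarrow> 'r adjoin_i set" where
  "zero_set Q = {z. poly_adjoin_i Q z = 0}"

text \<open>\<open>Z \<inter> R\<close> as a subset of \<open>R\<close>, and \<open>Z \<inter> (C - R)\<close> as a subset of \<open>C\<close>.\<close>

definition base_part :: "'r::linordered_field adjoin_i set \<Rightarrow> 'r set" where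
  "base_part Z = {x. of_base x \<in> Z}"

definition nonbase_part :: "'r::linordered_field adjoin_i set \<Rightarrow> 'r adjoin_i set" where
  "nonbase_part Z = Z - range of_base"

end

theory Submission
  imports Defs "Jordan_Normal_Form.Char_Poly" "HOL-Algebra.Algebraic_Closure_Type"
begin

text \<open>
  Fix a point \<open>y\<close>. By the trace formula (\<open>mult_trace_root_product\<close>) the Hermite matrix of \<open>P(y)\<close> and \<open>Q(y)\<close>
  is the matrix of the quadratic form \<open>v \<mapsto> \<Sum> Q(x) v(x)\<^sup>2\<close>, where \<open>x\<close> runs over the roots of \<open>P(y)\<close> in
  \<open>C\<close> with multiplicity and \<open>v\<close> over the real polynomials of degree less than \<open>p\<close>. Evaluations at
  distinct points are independent, so the form can be read off as a sum of squares
  (\<open>hermite_form_diagonalises\<close>): a real root contributes one square with the sign of \<open>Q(x)\<close>, and a pair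
  of conjugate roots at which \<open>Q\<close> does not vanish contributes one positive and one negative square.
  By the law of inertia (\<open>inertia_unique\<close>) the numbers of positive and negative squares depend on the
  matrix only, and symmetric elimination shows that they are determined by the signs of the principal
  minors (\<open>minor_signs_determine_inertia\<close>).

  Hence two points that realize the same sign condition on \<open>HElim\<close> have the same numbers of squares for
  every product \<open>P\<^sup>\<alpha>\<close> with at most \<open>bit(p)\<close> nonzero exponents. The difference of the two
  numbers is the sum of \<open>sign(P\<^sup>\<alpha>(x))\<close> over the real roots. When all exponents are even, no real root
  contributes a negative square, and the number of negative squares counts the conjugate pairs at which
  \<open>P\<^sup>\<alpha>\<close> is nonzero. Up to a factor 2, both are sums of a monomial in
  sign vectors or in vectors of 0 and 1, over a set of at most \<open>p\<close> roots.

  Monomials in so few variables suffice to recover how often each sign vector occurs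
  (\<open>sparse_monomials_determine_sign_counts\<close>): a nonzero function on \<open>{0, 1, -1}\<^sup>s\<close> that is orthogonal to all
  monomials in at most \<open>b\<close> variables has at least \<open>2\<^bsup>b + 1\<^esup>\<close> points in its support, whereas the difference of
  the two counting functions has at most \<open>2 p\<close>, which is less than \<open>2\<^bsup>b + 1\<^esup>\<close> for \<open>b = bit(p)\<close>.

  The argument takes place over \<open>C = R[i]\<close> and needs \<open>P(y)\<close> to split there. That \<open>C\<close> is algebraically closed
  follows from the two axioms of a real closed field by Laplace's proof of the fundamental theorem
  of algebra (\<open>real_closed_poly_has_root\<close>).
\<close>

(* The list-based polynomials of the algebraic closure construction share names with type poly. *)
hide_const (open) Polynomials.degree Polynomials.lead_coeff up_ring.coeff up_ring.monom


section \<open>Sign vectors are counted by sparse monomials\<close>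

text \<open>
  Sign vectors are lists, so that the first coordinate can be split off in an induction on their length.
\<close>

definition sign_lists :: "nat \<Rightarrow> 'r::linordered_field list set" where
  "sign_lists s = {\<sigma>. set \<sigma> \<subseteq> {0, 1, -1} \<and> length \<sigma> = s}"

lemma sign_lists_0 [simp]: "sign_lists 0 = {[]}"
  by (auto simp: sign_lists_def)

lemma finite_sign_lists [simp]: "finite (sign_lists s)"
  unfolding sign_lists_def by (rule finite_lists_length_eq) simp

lemma sum_sign_lists_Suc:
  fixes h :: "'r::linordered_field list \<Rightarrow> 'b::comm_monoid_add"
  shows "(\<Sum>\<sigma>\<in>sign_lists (Suc s). h \<sigma>) =
    (\<Sum>\<sigma>\<in>sign_lists s. h (0 # \<sigma>) + h (1 # \<sigma>) + h (- 1 # \<sigma>))"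
proof -
  have inj: "inj_on (Cons v) A" for v :: 'r and A by auto
  have *: "sign_lists (Suc s) =
      Cons 0 ` sign_lists s \<union> Cons 1 ` sign_lists s \<union> Cons (- 1 :: 'r) ` sign_lists s"
    by (auto simp: sign_lists_def length_Suc_conv)
  show ?thesis
    unfolding * by (subst sum.union_disjoint; (subst sum.union_disjoint)?)
      (auto simp: sum.reindex inj sum.distrib)
qed

text \<open>
  Values that sum to zero are not zero at exactly one place. This is what doubles the support with every
  variable in the next induction.
\<close>

lemma at_least_two_nonzero_of_sum_zero:
  fixes h :: "'r::linordered_field \<Rightarrow> 'b::ab_group_add"
  assumes "h 0 + h 1 + h (- 1) = 0" and "v \<in> {0, 1, -1}" and "h v \<noteq> 0"
  shows "2 \<le> card {v\<in>{0, 1, -1}. h v \<noteq> 0}"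
proof -
  have "{v\<in>{0, 1, -1}. h v \<noteq> 0} = (if h 0 = 0 then {} else {0}) \<union>
      (if h 1 = 0 then {} else {1}) \<union> (if h (- 1) = 0 then {} else {- 1})"
    by auto
  moreover have "h 0 \<noteq> 0 \<or> h 1 \<noteq> 0 \<or> h (- 1) \<noteq> 0"
    using assms(2,3) by blast
  ultimately show ?thesis
    using assms(1) by (cases "h 0 = 0"; cases "h 1 = 0"; cases "h (- 1) = 0") simp_all
qed

definition sign_monomial :: "(nat \<Rightarrow> nat) \<Rightarrow> 'r::linordered_field list \<Rightarrow> 'r" where
  "sign_monomial \<alpha> \<sigma> = (\<Prod>j<length \<sigma>. (\<sigma> ! j) ^ \<alpha> j)"

lemma sign_monomial_Cons:
  "sign_monomial \<alpha> (v # \<sigma>) = v ^ \<alpha> 0 * sign_monomial (\<lambda>j. \<alpha> (Suc j)) \<sigma>"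
  by (simp add: sign_monomial_def prod.lessThan_Suc_shift del: prod.lessThan_Suc)

text \<open>
  Induction on \<open>s\<close>. If the marginal of \<open>f\<close> in the first coordinate is nonzero, the first variable is left out
  of the monomial. Otherwise each fibre over the remaining coordinates that meets the support of \<open>f\<close> contains
  at least two points of it, so the projection of the support is at most half as large. One of the moments of
  order 1 and 2 of the fibres is nonzero, because moments of order 0, 1 and 2 determine a function on
  \<open>{0, 1, -1}\<close>. Hence the first variable is paid for by a factor 2.
\<close>

lemma sparse_monomial_detects_nonzero:
  fixes f :: "'r::linordered_field list \<Rightarrow> 'r"
  assumes "\<exists>\<sigma>\<in>sign_lists s. f \<sigma> \<noteq> 0"
  shows "\<exists>\<alpha>. (\<forall>j. \<alpha> j \<in> {0, 1, 2}) \<and> 2 ^ card {j. j < s \<and> \<alpha> j \<noteq> 0} \<le> card {\<sigma>\<in>sign_lists s. f \<sigma> \<noteq> 0}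
    \<and> (\<Sum>\<sigma>\<in>sign_lists s. f \<sigma> * sign_monomial \<alpha> \<sigma>) \<noteq> 0"
  using assms
proof (induction s arbitrary: f)
  case 0
  then have "{\<sigma> \<in> {[]}. f \<sigma> \<noteq> 0} = {[]}" by auto
  then show ?case using 0
    by (intro exI[of _ "\<lambda>_. 0"]) (simp add: sign_monomial_def)
next
  case (Suc s)
  let ?supp = "\<lambda>s f. {\<sigma>\<in>sign_lists s. f \<sigma> \<noteq> 0}"
  \<comment> \<open>The moment of order \<open>a\<close> of \<open>f\<close> in the first coordinate; \<open>0 ^ 0 = 1\<close>.\<close>
  define g where "g a \<sigma> = 0 ^ a * f (0 # \<sigma>) + f (1 # \<sigma>) + (- 1) ^ a * f (- 1 # \<sigma>)" for a :: nat and \<sigma>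
  have extend: ?case if g: "\<exists>\<sigma>\<in>sign_lists s. g a \<sigma> \<noteq> 0" and a: "a \<in> {0, 1, 2}"
    and card: "2 ^ (if a = 0 then 0 else 1) * card (?supp s (g a)) \<le> card (?supp (Suc s) f)" for a
  proof -
    obtain \<alpha> where \<alpha>: "\<forall>j. \<alpha> j \<in> {0, 1, 2}"
      "2 ^ card {j. j < s \<and> \<alpha> j \<noteq> 0} \<le> card (?supp s (g a))"
      "(\<Sum>\<sigma>\<in>sign_lists s. g a \<sigma> * sign_monomial \<alpha> \<sigma>) \<noteq> 0"
      using Suc.IH[OF g] by blast
    define \<beta> where "\<beta> = case_nat a \<alpha>"
    have "{j. j < Suc s \<and> \<beta> j \<noteq> 0} = (if a = 0 then {} else {0}) \<union> Suc ` {j. j < s \<and> \<alpha> j \<noteq> 0}"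
    proof (rule Set.set_eqI)
      fix j
      show "j \<in> {j. j < Suc s \<and> \<beta> j \<noteq> 0} \<longleftrightarrow>
        j \<in> (if a = 0 then {} else {0}) \<union> Suc ` {j. j < s \<and> \<alpha> j \<noteq> 0}"
        by (cases j) (auto simp: \<beta>_def)
    qed
    then have "card {j. j < Suc s \<and> \<beta> j \<noteq> 0} = (if a = 0 then 0 else 1) + card {j. j < s \<and> \<alpha> j \<noteq> 0}"
      by (simp add: card_image card_Un_disjoint)
    then have "2 ^ card {j. j < Suc s \<and> \<beta> j \<noteq> 0} =
        2 ^ (if a = 0 then 0 else 1) * (2::nat) ^ card {j. j < s \<and> \<alpha> j \<noteq> 0}"
      by (simp add: power_add)
    also have "\<dots> \<le> card (?supp (Suc s) f)"
      using \<alpha>(2) card by (meson le_trans mult_le_mono2)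
    finally have "2 ^ card {j. j < Suc s \<and> \<beta> j \<noteq> 0} \<le> card (?supp (Suc s) f)" .
    moreover have "(\<Sum>\<sigma>\<in>sign_lists (Suc s). f \<sigma> * sign_monomial \<beta> \<sigma>) =
        (\<Sum>\<sigma>\<in>sign_lists s. g a \<sigma> * sign_monomial \<alpha> \<sigma>)"
      unfolding sum_sign_lists_Suc
      by (intro sum.cong) (auto simp: sign_monomial_Cons \<beta>_def g_def algebra_simps)
    moreover have "\<forall>j. \<beta> j \<in> {0, 1, 2}"
      using \<alpha>(1) a by (auto simp: \<beta>_def split: nat.splits)
    ultimately show ?thesis using \<alpha>(3) by (intro exI[of _ \<beta>]) simp
  qed
  show ?case
  proof (cases "\<exists>\<sigma>\<in>sign_lists s. g 0 \<sigma> \<noteq> 0")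
    case True
    have "?supp s (g 0) \<subseteq> tl ` ?supp (Suc s) f"
    proof
      fix \<sigma> assume \<sigma>: "\<sigma> \<in> ?supp s (g 0)"
      then have "f (0 # \<sigma>) \<noteq> 0 \<or> f (1 # \<sigma>) \<noteq> 0 \<or> f (- 1 # \<sigma>) \<noteq> 0"
        by (auto simp: g_def)
      then obtain v where "v \<in> {0, 1, - 1}" "f (v # \<sigma>) \<noteq> 0"
        by blast
      then show "\<sigma> \<in> tl ` ?supp (Suc s) f"
        using \<sigma> by (intro image_eqI[of _ _ "v # \<sigma>"]) (auto simp: sign_lists_def)
    qed
    then have "card (?supp s (g 0)) \<le> card (?supp (Suc s) f)"
      by (intro surj_card_le) auto
    then show ?thesis using True by (intro extend[of 0]) auto
  next
    case False
    then have sum0: "f (0 # \<sigma>) + f (1 # \<sigma>) + f (- 1 # \<sigma>) = 0" if "\<sigma> \<in> sign_lists s" for \<sigma>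
      using that by (auto simp: g_def)
    obtain \<sigma> where \<sigma>: "\<sigma> \<in> sign_lists (Suc s)" "f \<sigma> \<noteq> 0"
      using Suc.prems by blast
    then obtain v \<sigma>0 where "\<sigma> = v # \<sigma>0" by (cases \<sigma>) (auto simp: sign_lists_def)
    with \<sigma> have \<sigma>0: "\<sigma>0 \<in> sign_lists s" "v \<in> {0, 1, -1}" "f (v # \<sigma>0) \<noteq> 0"
      by (auto simp: sign_lists_def)
    have "\<exists>a\<in>{1, 2}. g a \<sigma>0 \<noteq> 0"
    proof (rule ccontr)
      assume "\<not> ?thesis"
      then have "f (1 # \<sigma>0) - f (- 1 # \<sigma>0) = 0" "f (1 # \<sigma>0) + f (- 1 # \<sigma>0) = 0"
        by (auto simp: g_def)
      then have "f (1 # \<sigma>0) = 0" "f (- 1 # \<sigma>0) = 0" by auto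
      then show False using sum0[OF \<sigma>0(1)] \<sigma>0 by auto
    qed
    then obtain a where a: "a \<in> {1, 2}" "g a \<sigma>0 \<noteq> 0" by blast
    \<comment> \<open>The projection of the support of \<open>f\<close>. It contains the supports of \<open>g 1\<close> and \<open>g 2\<close>.\<close>
    define D where "D = {\<sigma>\<in>sign_lists s. \<exists>v\<in>{0, 1, -1}. f (v # \<sigma>) \<noteq> 0}"
    have finD: "finite D" by (simp add: D_def)
    have "2 * card D = (\<Sum>\<sigma>\<in>D. 2)" by simp
    also have "\<dots> \<le> (\<Sum>\<sigma>\<in>D. card {v\<in>{0, 1, -1}. f (v # \<sigma>) \<noteq> 0})"
    proof (rule sum_mono)
      fix \<sigma> assume \<sigma>: "\<sigma> \<in> D"
      show "2 \<le> card {v\<in>{0, 1, -1}. f (v # \<sigma>) \<noteq> 0}"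
      proof -
        obtain v where v: "v \<in> {0, 1, -1}" "f (v # \<sigma>) \<noteq> 0" using \<sigma> unfolding D_def by blast
        have "\<sigma> \<in> sign_lists s" using \<sigma> unfolding D_def by blast
        from at_least_two_nonzero_of_sum_zero[OF sum0[OF this] v] show ?thesis .
      qed
    qed
    also have "\<dots> = card (SIGMA \<sigma>:D. {v\<in>{0, 1, -1}. f (v # \<sigma>) \<noteq> 0})"
      using finD by (subst card_SigmaI) auto
    also have "\<dots> \<le> card (?supp (Suc s) f)"
      by (rule card_inj_on_le[of "\<lambda>(\<sigma>, v). v # \<sigma>"])
         (auto simp: inj_on_def D_def sign_lists_def intro: finite_subset[OF _ finite_sign_lists[of "Suc s"]])
    finally have "2 * card D \<le> card (?supp (Suc s) f)" .
    moreover have "card (?supp s (g a)) \<le> card D"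
      using a(1) by (intro card_mono finD) (auto simp: D_def g_def)
    ultimately show ?thesis
      using a \<sigma>0(1) by (intro extend[of a]) auto
  qed
qed

text \<open>
  The difference of the two counting functions lives on at most \<open>card A + card B \<le> 2 p\<close> sign vectors.
  Were it nonzero, a monomial in \<open>k\<close> variables with \<open>2\<^sup>k \<le> 2 p\<close> would detect it; then \<open>k\<close> is at most the number of
  binary digits of \<open>p\<close>, and such monomials have the same sums over \<open>A\<close> and \<open>B\<close>.
\<close>

lemma sparse_monomials_determine_sign_counts:
  fixes v :: "'a \<Rightarrow> nat \<Rightarrow> 'r::linordered_field" and w :: "'b \<Rightarrow> nat \<Rightarrow> 'r"
  assumes fin: "finite A" "finite B" and card: "card A \<le> p" "card B \<le> p"
    and v: "\<And>x j. x \<in> A \<Longrightarrow> j < s \<Longrightarrow> v x j \<in> {0, 1, -1}"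
    and w: "\<And>x j. x \<in> B \<Longrightarrow> j < s \<Longrightarrow> w x j \<in> {0, 1, -1}"
    and eq: "\<And>\<alpha>. \<forall>j. \<alpha> j \<in> {0, 1, 2} \<Longrightarrow> card {j. j < s \<and> \<alpha> j \<noteq> 0} \<le> floorlog 2 p \<Longrightarrow>
      (\<Sum>x\<in>A. \<Prod>j<s. v x j ^ \<alpha> j) = (\<Sum>x\<in>B. \<Prod>j<s. w x j ^ \<alpha> j)"
  shows "card {x\<in>A. \<forall>j<s. v x j = \<rho> j} = card {x\<in>B. \<forall>j<s. w x j = \<rho> j}"
proof -
  define V where "V x = map (v x) [0..<s]" for x
  define W where "W x = map (w x) [0..<s]" for x
  define f where "f \<sigma> = (of_nat (card {x\<in>A. V x = \<sigma>}) - of_nat (card {x\<in>B. W x = \<sigma>}) :: 'r)" for \<sigma>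
  have V: "V x \<in> sign_lists s" if "x \<in> A" for x using v[OF that] by (simp add: V_def sign_lists_def image_subset_iff)
  have W: "W x \<in> sign_lists s" if "x \<in> B" for x using w[OF that] by (simp add: W_def sign_lists_def image_subset_iff)
  have pairA: "(\<Sum>\<sigma>\<in>sign_lists s. of_nat (card {x\<in>A. V x = \<sigma>}) * sign_monomial \<alpha> \<sigma>) =
      (\<Sum>x\<in>A. \<Prod>j<s. v x j ^ \<alpha> j)" for \<alpha>
  proof -
    have "(\<Sum>x\<in>A. \<Prod>j<s. v x j ^ \<alpha> j) = (\<Sum>x\<in>A. sign_monomial \<alpha> (V x))"
      by (auto simp: sign_monomial_def V_def)
    also have "\<dots> = (\<Sum>\<sigma>\<in>sign_lists s. \<Sum>x\<in>{x\<in>A. V x = \<sigma>}. sign_monomial \<alpha> (V x))"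
      using V by (intro sum.group[symmetric] fin) auto
    also have "\<dots> = (\<Sum>\<sigma>\<in>sign_lists s. of_nat (card {x\<in>A. V x = \<sigma>}) * sign_monomial \<alpha> \<sigma>)"
      by (intro sum.cong) auto
    finally show ?thesis by simp
  qed
  have pairB: "(\<Sum>\<sigma>\<in>sign_lists s. of_nat (card {x\<in>B. W x = \<sigma>}) * sign_monomial \<alpha> \<sigma>) =
      (\<Sum>x\<in>B. \<Prod>j<s. w x j ^ \<alpha> j)" for \<alpha>
  proof -
    have "(\<Sum>x\<in>B. \<Prod>j<s. w x j ^ \<alpha> j) = (\<Sum>x\<in>B. sign_monomial \<alpha> (W x))"
      by (auto simp: sign_monomial_def W_def)
    also have "\<dots> = (\<Sum>\<sigma>\<in>sign_lists s. \<Sum>x\<in>{x\<in>B. W x = \<sigma>}. sign_monomial \<alpha> (W x))"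
      using W by (intro sum.group[symmetric] fin) auto
    also have "\<dots> = (\<Sum>\<sigma>\<in>sign_lists s. of_nat (card {x\<in>B. W x = \<sigma>}) * sign_monomial \<alpha> \<sigma>)"
      by (intro sum.cong) auto
    finally show ?thesis by simp
  qed
  have f0: "f \<sigma> = 0" if "\<sigma> \<in> sign_lists s" for \<sigma>
  proof (rule ccontr)
    assume "f \<sigma> \<noteq> 0"
    then have "\<exists>\<sigma>\<in>sign_lists s. f \<sigma> \<noteq> 0" using that by blast
    from sparse_monomial_detects_nonzero[OF this] obtain \<alpha> where \<alpha>: "\<forall>j. \<alpha> j \<in> {0, 1, 2}"
      "2 ^ card {j. j < s \<and> \<alpha> j \<noteq> 0} \<le> card {\<sigma>\<in>sign_lists s. f \<sigma> \<noteq> 0}"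
      "(\<Sum>\<sigma>\<in>sign_lists s. f \<sigma> * sign_monomial \<alpha> \<sigma>) \<noteq> 0"
      by (elim exE conjE)
    have "{\<sigma>\<in>sign_lists s. f \<sigma> \<noteq> 0} \<subseteq> V ` A \<union> W ` B"
    proof
      fix \<sigma> assume "\<sigma> \<in> {\<sigma>\<in>sign_lists s. f \<sigma> \<noteq> 0}"
      then have "\<not> (card {x\<in>A. V x = \<sigma>} = 0 \<and> card {x\<in>B. W x = \<sigma>} = 0)"
        unfolding f_def by (metis (mono_tags, lifting) diff_self mem_Collect_eq)
      then have "{x\<in>A. V x = \<sigma>} \<noteq> {} \<or> {x\<in>B. W x = \<sigma>} \<noteq> {}"
        by (metis card.empty)
      then show "\<sigma> \<in> V ` A \<union> W ` B" by auto
    qed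
    then have "card {\<sigma>\<in>sign_lists s. f \<sigma> \<noteq> 0} \<le> card (V ` A \<union> W ` B)"
      by (intro card_mono) (auto simp: fin)
    also have "\<dots> \<le> card A + card B"
      using card_Un_le card_image_le[OF fin(1)] card_image_le[OF fin(2)] by (meson add_mono le_trans)
    finally have le: "2 ^ card {j. j < s \<and> \<alpha> j \<noteq> 0} \<le> 2 * p" using \<alpha>(2) card by linarith
    then have "p \<noteq> 0" by (metis mult_0_right not_less zero_less_numeral zero_less_power)
    then have "p < 2 ^ floorlog 2 p"
      using floorlog_bounds[of p 2] by auto
    then have "2 ^ card {j. j < s \<and> \<alpha> j \<noteq> 0} < (2::nat) ^ Suc (floorlog 2 p)"
      using le by simp
    then have "card {j. j < s \<and> \<alpha> j \<noteq> 0} \<le> floorlog 2 p"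
      by (meson less_Suc_eq_le nat_power_less_imp_less pos2)
    from eq[OF \<alpha>(1) this] pairA[of \<alpha>] pairB[of \<alpha>]
    have "(\<Sum>\<sigma>\<in>sign_lists s. f \<sigma> * sign_monomial \<alpha> \<sigma>) = 0"
      by (simp add: f_def algebra_simps sum_subtractf)
    then show False using \<alpha>(3) by blast
  qed
  define \<sigma> where "\<sigma> = map \<rho> [0..<s]"
  have "card {x\<in>A. V x = \<sigma>} = card {x\<in>B. W x = \<sigma>}"
  proof (cases "\<sigma> \<in> sign_lists s")
    case True
    then show ?thesis using f0[of \<sigma>] by (simp add: f_def)
  next
    case False
    then have "{x\<in>A. V x = \<sigma>} = {}" "{x\<in>B. W x = \<sigma>} = {}" using V W by auto
    then show ?thesis by (simp only: card.empty)
  qed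
  moreover have "V x = \<sigma> \<longleftrightarrow> (\<forall>j<s. v x j = \<rho> j)" for x by (auto simp: V_def \<sigma>_def)
  moreover have "W x = \<sigma> \<longleftrightarrow> (\<forall>j<s. w x j = \<rho> j)" for x by (auto simp: W_def \<sigma>_def)
  ultimately show ?thesis by simp
qed


section \<open>Diagonal forms and the law of inertia\<close>

definition linear_form :: "nat set \<Rightarrow> (nat \<Rightarrow> 'r::field) \<Rightarrow> (nat \<Rightarrow> 'r) \<Rightarrow> 'r" where
  "linear_form S l v = (\<Sum>i\<in>S. l i * v i)"

definition quadratic_form :: "nat set \<Rightarrow> (nat \<Rightarrow> nat \<Rightarrow> 'r::field) \<Rightarrow> (nat \<Rightarrow> 'r) \<Rightarrow> 'r" where
  "quadratic_form S a v = (\<Sum>i\<in>S. \<Sum>j\<in>S. a i j * v i * v j)"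

text \<open>
  The form is a combination \<open>\<Sum> c\<^sub>j l\<^sub>j(v)\<^sup>2\<close> of squares. Linear independence of the linear forms \<open>l\<^sub>j\<close> is expressed
  by a dual family of vectors \<open>e\<^sub>k\<close>; the \<open>l\<^sub>j\<close> need not span, so degenerate forms are included.
\<close>

definition diagonalises :: "nat set \<Rightarrow> (nat \<Rightarrow> nat \<Rightarrow> 'r::field) \<Rightarrow> 'i set \<Rightarrow> ('i \<Rightarrow> 'r) \<Rightarrow>
    ('i \<Rightarrow> nat \<Rightarrow> 'r) \<Rightarrow> ('i \<Rightarrow> nat \<Rightarrow> 'r) \<Rightarrow> bool" where
  "diagonalises S a J c l e \<longleftrightarrow> finite J \<and>
     (\<forall>v. quadratic_form S a v = (\<Sum>j\<in>J. c j * (linear_form S (l j) v)\<^sup>2)) \<and>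
     (\<forall>j\<in>J. \<forall>k\<in>J. linear_form S (l j) (e k) = (if j = k then 1 else 0))"

text \<open>
  Gaussian elimination of one unknown per equation.
\<close>

lemma underdetermined_system_solvable:
  fixes m :: "'i \<Rightarrow> 'j \<Rightarrow> 'r::field"
  assumes "finite I" "finite J" "card I < card J"
  shows "\<exists>x. (\<exists>j\<in>J. x j \<noteq> 0) \<and> (\<forall>i\<in>I. (\<Sum>j\<in>J. m i j * x j) = 0)"
  using assms
proof (induction I arbitrary: J m rule: finite_induct)
  case empty
  then have "J \<noteq> {}" by auto
  then show ?case by (intro exI[of _ "\<lambda>_. 1"]) auto
next
  case (insert i I)
  show ?case
  proof (cases "\<forall>j\<in>J. m i j = 0")
    case True
    moreover obtain x where "\<exists>j\<in>J. x j \<noteq> 0" "\<forall>i\<in>I. (\<Sum>j\<in>J. m i j * x j) = 0"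
      using insert.IH[of J m] insert.prems insert.hyps by auto
    ultimately show ?thesis by (intro exI[of _ x]) auto
  next
    case False
    then obtain j0 where j0: "j0 \<in> J" "m i j0 \<noteq> 0" by blast
    let ?J = "J - {j0}"
    have "card I < card ?J" using insert.prems insert.hyps j0 by simp
    with insert.IH[of ?J "\<lambda>k j. m k j - m k j0 * m i j / m i j0"] insert.prems
    obtain x where x: "\<exists>j\<in>?J. x j \<noteq> 0"
      "\<And>k. k \<in> I \<Longrightarrow> (\<Sum>j\<in>?J. (m k j - m k j0 * m i j / m i j0) * x j) = 0"
      by auto
    define s where "s = (\<Sum>j\<in>?J. m i j * x j)"
    define x' where "x' = x(j0 := - s / m i j0)"
    have sum: "(\<Sum>j\<in>J. m k j * x' j) = (\<Sum>j\<in>?J. m k j * x j) - m k j0 * s / m i j0" for k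
    proof -
      have "(\<Sum>j\<in>J. m k j * x' j) = m k j0 * x' j0 + (\<Sum>j\<in>?J. m k j * x' j)"
        using insert.prems j0 by (intro sum.remove) auto
      also have "(\<Sum>j\<in>?J. m k j * x' j) = (\<Sum>j\<in>?J. m k j * x j)"
        by (intro sum.cong) (auto simp: x'_def)
      finally show ?thesis by (simp add: x'_def)
    qed
    have "(\<Sum>j\<in>J. m k j * x' j) = 0" if "k \<in> insert i I" for k
    proof (cases "k = i")
      case True
      then show ?thesis using sum[of i] j0 by (simp add: s_def)
    next
      case False
      have "(\<Sum>j\<in>?J. (m k j - m k j0 * m i j / m i j0) * x j) =
          (\<Sum>j\<in>?J. m k j * x j - m k j0 / m i j0 * (m i j * x j))"
        by (intro sum.cong) (auto simp: algebra_simps)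
      also have "\<dots> = (\<Sum>j\<in>?J. m k j * x j) - m k j0 / m i j0 * s"
        by (simp add: s_def sum_subtractf sum_distrib_left)
      finally have "(\<Sum>j\<in>?J. m k j * x j) - m k j0 * s / m i j0 = 0"
        using x(2)[of k] that False by simp
      then show ?thesis using sum[of k] by simp
    qed
    moreover have "\<exists>j\<in>J. x' j \<noteq> 0" using x(1) by (auto simp: x'_def)
    ultimately show ?thesis by blast
  qed
qed

lemma linear_form_sum:
  "linear_form S l (\<lambda>i. \<Sum>k\<in>K. x k * e k i) = (\<Sum>k\<in>K. x k * linear_form S l (e k))"
  unfolding linear_form_def sum_distrib_left
  by (subst sum.swap) (simp add: mult_ac)

text \<open>
  If the first form had more positive squares, some nonzero combination \<open>v\<close> of the dual vectors of these squares
  would be annihilated by all positive squares of the second form, as that is a system with fewer equations than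
  unknowns. The first representation makes the form positive at \<open>v\<close> and the second one makes it nonpositive.
\<close>

lemma inertia_positive_le:
  fixes a :: "nat \<Rightarrow> nat \<Rightarrow> 'r::linordered_field"
  assumes "diagonalises S a J c l e" and "diagonalises S a J' c' l' e'"
  shows "card {j\<in>J. c j > 0} \<le> card {j\<in>J'. c' j > 0}"
proof (rule ccontr)
  let ?P = "{j\<in>J. c j > 0}" and ?P' = "{j\<in>J'. c' j > 0}"
  assume "\<not> card ?P \<le> card ?P'"
  moreover have fin: "finite J" "finite J'" using assms by (auto simp: diagonalises_def)
  ultimately obtain x where x: "\<exists>k\<in>?P. x k \<noteq> 0"
    "\<And>j. j \<in> ?P' \<Longrightarrow> (\<Sum>k\<in>?P. linear_form S (l' j) (e k) * x k) = 0"
    using underdetermined_system_solvable[of ?P' ?P "\<lambda>j k. linear_form S (l' j) (e k)"] by auto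
  define v where "v = (\<lambda>i. \<Sum>k\<in>?P. x k * e k i)"
  have l: "linear_form S (l j) v = (if j \<in> ?P then x j else 0)" if "j \<in> J" for j
  proof -
    have "linear_form S (l j) v = (\<Sum>k\<in>?P. x k * linear_form S (l j) (e k))"
      by (simp add: v_def linear_form_sum)
    also have "\<dots> = (\<Sum>k\<in>?P. if j = k then x k else 0)"
      using assms(1) that by (intro sum.cong) (auto simp: diagonalises_def)
    also have "\<dots> = (if j \<in> ?P then x j else 0)" using fin by simp
    finally show ?thesis .
  qed
  have "quadratic_form S a v = (\<Sum>j\<in>J. c j * (linear_form S (l j) v)\<^sup>2)"
    using assms(1) by (simp add: diagonalises_def)
  also have "\<dots> = (\<Sum>j\<in>?P. c j * (x j)\<^sup>2)"
    using fin l by (intro sum.mono_neutral_cong_right) auto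
  also have "\<dots> > 0"
  proof -
    obtain k where k: "k \<in> ?P" "x k \<noteq> 0" using x(1) by blast
    have "0 < c k * (x k)\<^sup>2" using k by simp
    also have "\<dots> \<le> (\<Sum>j\<in>?P. c j * (x j)\<^sup>2)"
      using fin k by (intro member_le_sum) auto
    finally show ?thesis .
  qed
  finally have "quadratic_form S a v > 0" .
  moreover have "quadratic_form S a v = (\<Sum>j\<in>J'. c' j * (linear_form S (l' j) v)\<^sup>2)"
    using assms(2) by (simp add: diagonalises_def)
  moreover have "\<dots> \<le> 0"
  proof (intro sum_nonpos)
    fix j assume j: "j \<in> J'"
    show "c' j * (linear_form S (l' j) v)\<^sup>2 \<le> 0"
    proof (cases "c' j > 0")
      case True
      then have "linear_form S (l' j) v = 0"
        using x(2)[of j] j by (simp add: v_def linear_form_sum mult_ac)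
      then show ?thesis by simp
    next
      case False
      then show ?thesis by (simp add: mult_nonpos_nonneg)
    qed
  qed
  ultimately show False by simp
qed

lemma diagonalises_uminus:
  assumes "diagonalises S a J c l e"
  shows "diagonalises S (\<lambda>i j. - a i j) J (\<lambda>j. - c j) l e"
  using assms by (simp add: diagonalises_def quadratic_form_def sum_negf)

text \<open>
  Sylvester's law of inertia. The index sets of the two diagonalisations may have different types: one is
  a set of natural numbers that comes from elimination, the other one is made of the roots of a polynomial.
\<close>

theorem inertia_unique:
  fixes a :: "nat \<Rightarrow> nat \<Rightarrow> 'r::linordered_field"
  assumes "diagonalises S a J c l e" and "diagonalises S a J' c' l' e'"
  shows "card {j\<in>J. c j > 0} = card {j\<in>J'. c' j > 0}"
    and "card {j\<in>J. c j < 0} = card {j\<in>J'. c' j < 0}"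
  using inertia_positive_le[OF assms] inertia_positive_le[OF assms(2,1)]
    inertia_positive_le[OF assms[THEN diagonalises_uminus]]
    inertia_positive_le[OF assms(2,1)[THEN diagonalises_uminus]]
  by auto

text \<open>
  One step of symmetric elimination: new squares are split off and the rest is a form in the variables
  \<open>S'\<close>. Old dual vectors must be adjusted at the eliminated variables so that the new linear forms vanish
  there; \<open>lift\<close> provides that.
\<close>

lemma diagonalises_extend:
  fixes a :: "nat \<Rightarrow> nat \<Rightarrow> 'r::field"
  assumes diag: "diagonalises S' a' J c l e"
    and S: "S' \<subseteq> S" "finite S" and J0: "finite J0" "J \<inter> J0 = {}"
    and split: "\<And>v. quadratic_form S a v =
      quadratic_form S' a' v + (\<Sum>j\<in>J0. c0 j * (linear_form S (l0 j) v)\<^sup>2)"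
    and dual: "\<And>j k. j \<in> J0 \<Longrightarrow> k \<in> J0 \<Longrightarrow> linear_form S (l0 j) (e0 k) = (if j = k then 1 else 0)"
    and supp: "\<And>k i. k \<in> J0 \<Longrightarrow> i \<in> S' \<Longrightarrow> e0 k i = 0"
    and lift: "\<And>u. \<exists>w. (\<forall>i\<in>S'. w i = u i) \<and> (\<forall>j\<in>J0. linear_form S (l0 j) w = 0)"
  shows "\<exists>l1 e1. diagonalises S a (J \<union> J0) (\<lambda>j. if j \<in> J0 then c0 j else c j) l1 e1"
proof -
  obtain w where w: "\<And>u i. i \<in> S' \<Longrightarrow> w u i = u i"
    "\<And>u j. j \<in> J0 \<Longrightarrow> linear_form S (l0 j) (w u) = 0"
    using lift by metis
  define l1 where "l1 j = (if j \<in> J0 then l0 j else (\<lambda>i. if i \<in> S' then l j i else 0))" for j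
  define e1 where "e1 j = (if j \<in> J0 then e0 j else w (e j))" for j
  have l1: "linear_form S (l1 j) v = linear_form S' (l j) v" if "j \<notin> J0" for j v
  proof -
    have "linear_form S (l1 j) v = (\<Sum>i\<in>S. if i \<in> S' then l j i * v i else 0)"
      unfolding linear_form_def using that by (intro sum.cong) (auto simp: l1_def)
    also have "\<dots> = (\<Sum>i\<in>S'. l j i * v i)"
      using S by (intro sum.mono_neutral_cong_right) auto
    finally show ?thesis by (simp add: linear_form_def)
  qed
  have l1': "linear_form S (l1 j) v = linear_form S (l0 j) v" if "j \<in> J0" for j v
    using that by (simp add: l1_def)
  have cong: "linear_form S' l v = linear_form S' l v'" if "\<And>i. i \<in> S' \<Longrightarrow> v i = v' i" for l v v'
    unfolding linear_form_def using that by (intro sum.cong) auto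
  have fin: "finite J" using diag by (simp add: diagonalises_def)
  have "quadratic_form S a v =
      (\<Sum>j\<in>J \<union> J0. (if j \<in> J0 then c0 j else c j) * (linear_form S (l1 j) v)\<^sup>2)" for v
  proof -
    have "(\<Sum>j\<in>J \<union> J0. (if j \<in> J0 then c0 j else c j) * (linear_form S (l1 j) v)\<^sup>2) =
        (\<Sum>j\<in>J. (if j \<in> J0 then c0 j else c j) * (linear_form S (l1 j) v)\<^sup>2) +
        (\<Sum>j\<in>J0. (if j \<in> J0 then c0 j else c j) * (linear_form S (l1 j) v)\<^sup>2)"
      using fin J0 by (intro sum.union_disjoint)
    also have "(\<Sum>j\<in>J. (if j \<in> J0 then c0 j else c j) * (linear_form S (l1 j) v)\<^sup>2) =
        (\<Sum>j\<in>J. c j * (linear_form S' (l j) v)\<^sup>2)"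
      using J0 l1 by (intro sum.cong) auto
    also have "\<dots> = quadratic_form S' a' v"
      using diag by (simp add: diagonalises_def)
    also have "(\<Sum>j\<in>J0. (if j \<in> J0 then c0 j else c j) * (linear_form S (l1 j) v)\<^sup>2) =
        (\<Sum>j\<in>J0. c0 j * (linear_form S (l0 j) v)\<^sup>2)"
      using l1' by (intro sum.cong) auto
    finally show ?thesis using split by simp
  qed
  moreover have "linear_form S (l1 j) (e1 k) = (if j = k then 1 else 0)"
    if jk: "j \<in> J \<union> J0" "k \<in> J \<union> J0" for j k
  proof (cases "j \<in> J0"; cases "k \<in> J0")
    assume "j \<in> J0" "k \<in> J0"
    then show ?thesis using dual[of j k] by (simp add: l1' e1_def)
  next
    assume "j \<in> J0" "k \<notin> J0"
    then show ?thesis using w(2)[of j "e k"] by (auto simp: l1' e1_def)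
  next
    assume *: "j \<notin> J0" "k \<in> J0"
    then have "linear_form S (l1 j) (e1 k) = linear_form S' (l j) (\<lambda>_. 0)"
      unfolding l1[OF *(1)] using supp by (intro cong) (simp add: e1_def)
    then show ?thesis using * by (auto simp: linear_form_def)
  next
    assume *: "j \<notin> J0" "k \<notin> J0"
    then have "linear_form S (l1 j) (e1 k) = linear_form S' (l j) (e k)"
      unfolding l1[OF *(1)] using w(1) by (intro cong) (simp add: e1_def)
    then show ?thesis using * jk diag by (simp add: diagonalises_def)
  qed
  ultimately have "diagonalises S a (J \<union> J0) (\<lambda>j. if j \<in> J0 then c0 j else c j) l1 e1"
    unfolding diagonalises_def using fin J0 by blast
  then show ?thesis by blast
qed


section \<open>Inertia from the signs of principal minors\<close>

text \<open>
  Principal minors with rows and columns in the order of a list, so that a pivot can be put in front.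
\<close>

definition list_minor :: "(nat \<Rightarrow> nat \<Rightarrow> 'r::comm_ring_1) \<Rightarrow> nat list \<Rightarrow> 'r" where
  "list_minor a xs = det (mat (length xs) (length xs) (\<lambda>(i, j). a (xs ! i) (xs ! j)))"

text \<open>
  Rows and columns undergo the same permutation, hence its sign appears squared.
\<close>

lemma list_minor_permute:
  assumes "mset xs = mset ys"
  shows "list_minor a xs = (list_minor a ys :: 'r::comm_ring_1)"
proof -
  let ?n = "length ys"
  obtain p where p: "p permutes {..<?n}" "permute_list p ys = xs"
    using mset_eq_permutation[OF assms] by blast
  have len: "length xs = ?n" using assms by (metis size_mset)
  have p': "p permutes {0..<?n}" using p(1) by (simp add: atLeast0LessThan)
  have nth: "xs ! i = ys ! p i" if "i < ?n" for i
    using p that permute_list_nth by blast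
  have lt: "p i < ?n" if "i < ?n" for i
    using permutes_in_image[OF p(1)] that by auto
  let ?A = "mat ?n ?n (\<lambda>(i, j). a (ys ! i) (ys ! j))"
  let ?B = "mat ?n ?n (\<lambda>(i, j). ?A $$ (p i, j))"
  let ?C = "mat ?n ?n (\<lambda>(i, j). transpose_mat ?B $$ (p i, j))"
  have "mat ?n ?n (\<lambda>(i, j). a (xs ! i) (xs ! j)) = transpose_mat ?C"
    by (rule eq_matI) (auto simp: nth lt)
  then have "list_minor a xs = det (transpose_mat ?C)"
    by (simp add: list_minor_def len)
  also have "\<dots> = det ?C" by (rule det_transpose[of _ ?n]) simp
  also have "\<dots> = signof p * det (transpose_mat ?B)"
    using p' by (intro det_permute_rows) simp_all
  also have "det (transpose_mat ?B) = det ?B" by (rule det_transpose[of _ ?n]) simp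
  also have "det ?B = signof p * det ?A"
    using p' by (intro det_permute_rows) simp_all
  also have "signof p * (signof p * det ?A) = list_minor a ys"
    by (simp add: list_minor_def sign_def)
  finally show ?thesis .
qed

text \<open>
  The function \<open>b\<close> expresses the columns outside the pivot block through those of the block. Subtracting these
  combinations makes the matrix block triangular; the block that remains is the Schur complement.
\<close>

lemma list_minor_schur_complement:
  fixes a b :: "nat \<Rightarrow> nat \<Rightarrow> 'r::idom"
  assumes b: "\<And>k x. k \<in> set ks \<Longrightarrow> x \<in> set xs \<Longrightarrow> a k x = (\<Sum>t<length ks. a k (ks ! t) * b t x)"
  shows "list_minor a (ks @ xs) =
    list_minor a ks * list_minor (\<lambda>i j. a i j - (\<Sum>t<length ks. a i (ks ! t) * b t j)) xs"
proof -
  let ?m = "length ks" and ?n = "length xs"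
  define A1 where "A1 = mat ?m ?m (\<lambda>(i, j). a (ks ! i) (ks ! j))"
  define A2 where "A2 = mat ?m ?n (\<lambda>(i, j). a (ks ! i) (xs ! j))"
  define A3 where "A3 = mat ?n ?m (\<lambda>(i, j). a (xs ! i) (ks ! j))"
  define A4 where "A4 = mat ?n ?n (\<lambda>(i, j). a (xs ! i) (xs ! j))"
  define S where "S = mat ?n ?n (\<lambda>(i, j). a (xs ! i) (xs ! j) - (\<Sum>t<?m. a (xs ! i) (ks ! t) * b t (xs ! j)))"
  define B where "B = mat ?m ?n (\<lambda>(i, j). b i (xs ! j))"
  have carr: "A1 \<in> carrier_mat ?m ?m" "A2 \<in> carrier_mat ?m ?n" "A3 \<in> carrier_mat ?n ?m"
    "A4 \<in> carrier_mat ?n ?n" "S \<in> carrier_mat ?n ?n" "B \<in> carrier_mat ?m ?n"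
    by (simp_all add: A1_def A2_def A3_def A4_def S_def B_def)
  have "mat (length (ks @ xs)) (length (ks @ xs)) (\<lambda>(i, j). a ((ks @ xs) ! i) ((ks @ xs) ! j)) =
      four_block_mat A1 A2 A3 A4"
    by (rule eq_matI) (auto simp: A1_def A2_def A3_def A4_def nth_append)
  moreover have "four_block_mat A1 A2 A3 A4 =
      four_block_mat A1 (0\<^sub>m ?m ?n) A3 S * four_block_mat (1\<^sub>m ?m) B (0\<^sub>m ?n ?m) (1\<^sub>m ?n)"
  proof -
    have "A1 * B = A2"
      by (rule eq_matI) (auto simp: A1_def A2_def B_def scalar_prod_def b atLeast0LessThan)
    moreover have "A3 * B + S = A4"
      by (rule eq_matI) (auto simp: A3_def A4_def S_def B_def scalar_prod_def atLeast0LessThan)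
    ultimately show ?thesis
      using carr by (subst mult_four_block_mat[of _ ?m ?m _ ?n _ ?n _ _ ?m _ ?n]) auto
  qed
  moreover have "det (four_block_mat A1 (0\<^sub>m ?m ?n) A3 S) = det A1 * det S"
    using carr by (intro det_four_block_mat_upper_right_zero) auto
  moreover have "det (four_block_mat (1\<^sub>m ?m) B (0\<^sub>m ?n ?m) (1\<^sub>m ?n)) = 1"
    using carr by (subst det_four_block_mat_lower_left_zero) auto
  moreover have "det (four_block_mat A1 (0\<^sub>m ?m ?n) A3 S * four_block_mat (1\<^sub>m ?m) B (0\<^sub>m ?n ?m) (1\<^sub>m ?n)) =
      det (four_block_mat A1 (0\<^sub>m ?m ?n) A3 S) * det (four_block_mat (1\<^sub>m ?m) B (0\<^sub>m ?n ?m) (1\<^sub>m ?n))"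
    using carr by (intro det_mult[of _ "?m + ?n"]) auto
  ultimately show ?thesis
    by (simp add: list_minor_def A1_def S_def)
qed

lemma list_minor_single [simp]: "list_minor a [k] = a k k"
  unfolding list_minor_def by (subst det_single) auto

lemma list_minor_pair: "list_minor a [k, l] = a k k * a l l - a k l * a l k"
proof -
  define A where "A = mat 2 2 (\<lambda>(i, j). a ([k, l] ! i) ([k, l] ! j))"
  have A: "A \<in> carrier_mat 2 2" by (simp add: A_def)
  have "det A = (\<Sum>j<2. A $$ (0, j) * cofactor A 0 j)"
    using laplace_expansion_row[OF A, of 0] by simp
  also have "\<dots> = A $$ (0, 0) * cofactor A 0 0 + A $$ (0, 1) * cofactor A 0 1"
    by (simp add: numeral_2_eq_2)
  also have "cofactor A 0 0 = a l l"
    unfolding cofactor_def using A by (subst det_single) (auto simp: mat_delete_def A_def)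
  also have "cofactor A 0 1 = - a l k"
    unfolding cofactor_def using A by (subst det_single) (auto simp: mat_delete_def A_def)
  finally show ?thesis by (simp add: list_minor_def A_def numeral_2_eq_2)
qed

lemma quadratic_form_insert:
  fixes a :: "nat \<Rightarrow> nat \<Rightarrow> 'r::field"
  assumes "finite S" "k \<notin> S" "\<And>i. i \<in> S \<Longrightarrow> a i k = a k i"
  shows "quadratic_form (insert k S) a v =
    a k k * (v k)\<^sup>2 + 2 * v k * linear_form S (a k) v + quadratic_form S a v"
proof -
  have "quadratic_form (insert k S) a v =
      (\<Sum>j\<in>insert k S. a k j * v k * v j) + (\<Sum>i\<in>S. \<Sum>j\<in>insert k S. a i j * v i * v j)"
    unfolding quadratic_form_def using assms by simp
  also have "(\<Sum>j\<in>insert k S. a k j * v k * v j) = a k k * (v k)\<^sup>2 + v k * linear_form S (a k) v"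
    using assms by (simp add: linear_form_def power2_eq_square sum_distrib_left mult_ac)
  also have "(\<Sum>i\<in>S. \<Sum>j\<in>insert k S. a i j * v i * v j) =
      (\<Sum>i\<in>S. a i k * v i * v k + (\<Sum>j\<in>S. a i j * v i * v j))"
    using assms by simp
  also have "\<dots> = v k * linear_form S (a k) v + quadratic_form S a v"
    using assms(3) by (simp add: sum.distrib quadratic_form_def linear_form_def sum_distrib_left mult_ac)
  finally show ?thesis by (simp add: algebra_simps)
qed

lemma linear_form_insert:
  "finite S \<Longrightarrow> k \<notin> S \<Longrightarrow> linear_form (insert k S) l v = l k * v k + linear_form S l v"
  by (simp add: linear_form_def)

lemma linear_form_cong:
  "(\<And>i. i \<in> S \<Longrightarrow> l i = l' i) \<Longrightarrow> (\<And>i. i \<in> S \<Longrightarrow> v i = v' i) \<Longrightarrow> linear_form S l v = linear_form S l' v'"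
  by (simp add: linear_form_def)

lemma quadratic_form_rank_one:
  "quadratic_form S (\<lambda>i j. l i * m j) v = linear_form S l v * linear_form S m v"
  by (simp add: quadratic_form_def linear_form_def sum_product mult_ac)

lemma quadratic_form_add:
  "quadratic_form S (\<lambda>i j. a i j + b i j) v = quadratic_form S a v + quadratic_form S b v"
  by (simp add: quadratic_form_def sum.distrib distrib_right)

lemma quadratic_form_diff:
  "quadratic_form S (\<lambda>i j. a i j - b i j) v = quadratic_form S a v - quadratic_form S b v"
  by (simp add: quadratic_form_def sum_subtractf left_diff_distrib)

lemma quadratic_form_scale:
  "quadratic_form S (\<lambda>i j. c * a i j) v = c * quadratic_form S a v"
  by (simp add: quadratic_form_def sum_distrib_left mult_ac)

lemma quadratic_form_cong:
  "(\<And>i j. i \<in> S \<Longrightarrow> j \<in> S \<Longrightarrow> a i j = a' i j) \<Longrightarrow> quadratic_form S a v = quadratic_form S a' v"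
  by (simp add: quadratic_form_def)

lemma linear_form_scale: "linear_form S (\<lambda>i. c * l i) v = c * linear_form S l v"
  by (simp add: linear_form_def sum_distrib_left mult_ac)

definition schur_complement_at :: "(nat \<Rightarrow> nat \<Rightarrow> 'r::field) \<Rightarrow> nat \<Rightarrow> nat \<Rightarrow> nat \<Rightarrow> 'r" where
  "schur_complement_at a k i j = a i j - a i k * (a k j / a k k)"

text \<open>
  Schur complement of the block with rows and columns \<open>k, l\<close> when its diagonal entries vanish.
\<close>

definition schur_complement_at_pair :: "(nat \<Rightarrow> nat \<Rightarrow> 'r::field) \<Rightarrow> nat \<Rightarrow> nat \<Rightarrow> nat \<Rightarrow> nat \<Rightarrow> 'r" where
  "schur_complement_at_pair a k l i j = a i j - (a i k * (a l j / a k l) + a i l * (a k j / a k l))"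

lemma list_minor_schur_complement_at:
  fixes a :: "nat \<Rightarrow> nat \<Rightarrow> 'r::field"
  assumes "a k k \<noteq> 0"
  shows "list_minor a (k # xs) = a k k * list_minor (schur_complement_at a k) xs"
proof -
  have "list_minor a ([k] @ xs) = list_minor a [k] * list_minor
      (\<lambda>i j. a i j - (\<Sum>t<length [k]. a i ([k] ! t) * (\<lambda>t x. a k x / a k k) t j)) xs"
    using assms by (intro list_minor_schur_complement) auto
  moreover have "(\<lambda>i j. a i j - (\<Sum>t<length [k]. a i ([k] ! t) * (\<lambda>t x. a k x / a k k) t j)) = schur_complement_at a k"
    by (simp add: schur_complement_at_def fun_eq_iff)
  ultimately show ?thesis by simp
qed

lemma list_minor_schur_complement_at_pair:
  fixes a :: "nat \<Rightarrow> nat \<Rightarrow> 'r::field"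
  assumes "a k k = 0" "a l l = 0" "a l k = a k l" "a k l \<noteq> 0"
  shows "list_minor a (k # l # xs) = - (a k l)\<^sup>2 * list_minor (schur_complement_at_pair a k l) xs"
proof -
  define b where "b t x = (if t = 0 then a l x / a k l else a k x / a k l)" for t :: nat and x
  have "list_minor a ([k, l] @ xs) = list_minor a [k, l] * list_minor
      (\<lambda>i j. a i j - (\<Sum>t<length [k, l]. a i ([k, l] ! t) * b t j)) xs"
    using assms by (intro list_minor_schur_complement) (auto simp: b_def numeral_2_eq_2)
  moreover have "(\<lambda>i j. a i j - (\<Sum>t<length [k, l]. a i ([k, l] ! t) * b t j)) = schur_complement_at_pair a k l"
    by (simp add: schur_complement_at_pair_def fun_eq_iff b_def numeral_2_eq_2)
  ultimately show ?thesis using assms by (simp add: list_minor_pair power2_eq_square)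
qed

text \<open>
  Completing the square in the variable \<open>k\<close>.
\<close>

lemma diagonalises_schur_complement_at:
  fixes a :: "nat \<Rightarrow> nat \<Rightarrow> 'r::field"
  assumes fin: "finite S" "k \<notin> S" and sym: "\<And>i. i \<in> S \<Longrightarrow> a i k = a k i" and nz: "a k k \<noteq> 0"
    and diag: "diagonalises S (schur_complement_at a k) J c l e" and z: "z \<notin> J"
  shows "\<exists>l' e'. diagonalises (insert k S) a (J \<union> {z}) (\<lambda>j. if j \<in> {z} then a k k else c j) l' e'"
proof (rule diagonalises_extend[OF diag])
  show "quadratic_form (insert k S) a v = quadratic_form S (schur_complement_at a k) v +
    (\<Sum>j\<in>{z}. a k k * (linear_form (insert k S) (\<lambda>i. a k i / a k k) v)\<^sup>2)" for v
  proof -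
    have "quadratic_form S (schur_complement_at a k) v =
        quadratic_form S (\<lambda>i j. a i j - inverse (a k k) * (a k i * a k j)) v"
      using sym by (intro quadratic_form_cong) (simp add: schur_complement_at_def field_simps)
    also have "\<dots> = quadratic_form S a v - inverse (a k k) * (linear_form S (a k) v)\<^sup>2"
      by (simp add: quadratic_form_diff quadratic_form_scale quadratic_form_rank_one power2_eq_square)
    finally have 1: "quadratic_form S (schur_complement_at a k) v =
      quadratic_form S a v - inverse (a k k) * (linear_form S (a k) v)\<^sup>2" .
    have "linear_form (insert k S) (\<lambda>i. a k i / a k k) v = v k + inverse (a k k) * linear_form S (a k) v"
      using fin nz linear_form_scale[of S "inverse (a k k)" "a k" v]
      by (simp add: linear_form_insert divide_inverse mult.commute)
    then have 2: "(\<Sum>j\<in>{z}. a k k * (linear_form (insert k S) (\<lambda>i. a k i / a k k) v)\<^sup>2) =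
        a k k * (v k + inverse (a k k) * linear_form S (a k) v)\<^sup>2"
      by simp
    show ?thesis
      unfolding 1 2 using fin sym nz
      by (subst quadratic_form_insert) (auto simp: field_simps power2_eq_square)
  qed
  show "\<exists>w. (\<forall>i\<in>S. w i = u i) \<and> (\<forall>j\<in>{z}. linear_form (insert k S) (\<lambda>i. a k i / a k k) w = 0)" for u
  proof -
    let ?l = "\<lambda>i. a k i / a k k"
    have "linear_form S ?l (u(k := - linear_form S ?l u)) = linear_form S ?l u"
      using fin by (intro linear_form_cong) auto
    then show ?thesis
      using fin nz by (intro exI[of _ "u(k := - linear_form S ?l u)"]) (auto simp: linear_form_insert)
  qed
  show "linear_form (insert k S) (\<lambda>i. a k i / a k k) ((\<lambda>i. if i = k then 1 else 0)) =
     (if j = j' then 1 else 0)" if "j \<in> {z}" "j' \<in> {z}" for j j'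
  proof -
    have "linear_form S (\<lambda>i. a k i / a k k) (\<lambda>i. if i = k then 1 else 0) = 0"
      using fin by (auto simp: linear_form_def intro!: sum.neutral)
    then show ?thesis using that fin nz by (simp add: linear_form_insert)
  qed
qed (use fin z in auto)

text \<open>
  With both diagonal entries zero, the form is \<open>2 \<alpha> A B\<close> plus the Schur complement, where \<open>\<alpha> = a k l\<close> and
  \<open>A\<close>, \<open>B\<close> are \<open>v\<^sub>k\<close>, \<open>v\<^sub>l\<close> plus linear forms in the other variables. Now
  \<open>2 \<alpha> A B = ((\<alpha> A + B)\<^sup>2 - (\<alpha> A - B)\<^sup>2) / 2\<close>. In this normalisation the two coefficients
  are \<open>1/2\<close> and \<open>-1/2\<close> whatever the sign of \<open>\<alpha>\<close>, which the principal minors do not reveal.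
\<close>

lemma diagonalises_schur_complement_at_pair:
  fixes a :: "nat \<Rightarrow> nat \<Rightarrow> 'r::field_char_0"
  assumes fin: "finite S" "k \<notin> S" "l \<notin> S" "k \<noteq> l"
    and sym: "\<And>i. i \<in> S \<Longrightarrow> a i k = a k i" "\<And>i. i \<in> S \<Longrightarrow> a i l = a l i"
    and zero: "a k k = 0" "a l l = 0" "a l k = a k l" and nz: "a k l \<noteq> 0"
    and diag: "diagonalises S (schur_complement_at_pair a k l) J c f e" and z: "z \<notin> J" "z' \<notin> J" "z \<noteq> z'"
  shows "\<exists>l' e'. diagonalises (insert k (insert l S)) a (J \<union> {z, z'})
    (\<lambda>j. if j \<in> {z, z'} then (if j = z then 1 / 2 else - 1 / 2) else c j) l' e'"
proof -
  let ?\<alpha> = "a k l" and ?T = "insert k (insert l S)"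
  define sg where "sg j = (if j = z then 1 else - 1 :: 'r)" for j
  define L where "L j i = (if i = k then ?\<alpha> else if i = l then sg j else a l i + sg j * (a k i / ?\<alpha>))" for j i
  \<comment> \<open>The linear forms \<open>\<alpha> A \<plusminus> B\<close>, and the points where \<open>\<alpha> A = 1/2\<close> and \<open>B = \<plusminus> 1/2\<close>.\<close>
  define E where "E j i = (if i = k then 1 / (2 * ?\<alpha>) else if i = l then sg j / 2 else 0)" for j i
  have L: "linear_form ?T (L j) v = ?\<alpha> * v k + sg j * v l +
    (linear_form S (a l) v + sg j * (linear_form S (a k) v / ?\<alpha>))" for j v
  proof -
    have "linear_form S (L j) v = linear_form S (\<lambda>i. a l i + sg j * (a k i / ?\<alpha>)) v"
      using fin by (intro linear_form_cong) (auto simp: L_def)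
    also have "\<dots> = linear_form S (a l) v + sg j * (linear_form S (a k) v / ?\<alpha>)"
      by (simp add: linear_form_def sum.distrib sum_distrib_left sum_divide_distrib distrib_right
          mult.assoc)
    finally have *: "linear_form S (L j) v = \<dots>" .
    have "linear_form ?T (L j) v = L j k * v k + (L j l * v l + linear_form S (L j) v)"
      using fin by (simp add: linear_form_insert)
    then show ?thesis using fin by (simp add: *) (simp add: L_def)
  qed
  have sg: "sg z = 1" "sg z' = - 1" using z by (auto simp: sg_def)
  show ?thesis
  proof (rule diagonalises_extend[OF diag, where ?l0.0 = L and ?e0.0 = E])
    show "quadratic_form ?T a v = quadratic_form S (schur_complement_at_pair a k l) v +
      (\<Sum>j\<in>{z, z'}. (if j = z then 1 / 2 else - 1 / 2) * (linear_form ?T (L j) v)\<^sup>2)" for v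
    proof -
      let ?K = "linear_form S (a k) v" and ?L = "linear_form S (a l) v"
      have "quadratic_form S (schur_complement_at_pair a k l) v = quadratic_form S
          (\<lambda>i j. a i j - inverse ?\<alpha> * (a k i * a l j + a l i * a k j)) v"
        using sym by (intro quadratic_form_cong) (simp add: schur_complement_at_pair_def divide_inverse algebra_simps)
      also have "\<dots> = quadratic_form S a v - inverse ?\<alpha> * (?K * ?L + ?L * ?K)"
        by (simp only: quadratic_form_diff quadratic_form_scale quadratic_form_rank_one quadratic_form_add)
      finally have 1: "quadratic_form S (schur_complement_at_pair a k l) v =
        quadratic_form S a v - inverse ?\<alpha> * (?K * ?L + ?L * ?K)" .
      have "quadratic_form ?T a v = 2 * v k * linear_form (insert l S) (a k) v +
          quadratic_form (insert l S) a v"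
        using fin sym zero by (subst quadratic_form_insert) auto
      also have "\<dots> = 2 * v k * (?\<alpha> * v l + ?K) + 2 * v l * ?L + quadratic_form S a v"
        using fin sym zero by (simp add: quadratic_form_insert linear_form_insert)
      finally have 2: "quadratic_form ?T a v =
        2 * v k * (?\<alpha> * v l + ?K) + 2 * v l * ?L + quadratic_form S a v" .
      have "(\<Sum>j\<in>{z, z'}. (if j = z then 1 / 2 else - 1 / 2) * (linear_form ?T (L j) v)\<^sup>2) =
          1 / 2 * ((?\<alpha> * v k + ?L) + (v l + ?K / ?\<alpha>))\<^sup>2 - 1 / 2 * ((?\<alpha> * v k + ?L) - (v l + ?K / ?\<alpha>))\<^sup>2"
        using z by (simp add: L sg algebra_simps)
      also have "\<dots> = 2 * ((?\<alpha> * v k + ?L) * (v l + ?K / ?\<alpha>))"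
        by (simp add: power2_eq_square algebra_simps)
      also have "\<dots> = 2 * (?\<alpha> * v k * v l + v k * ?K + ?L * v l + inverse ?\<alpha> * (?L * ?K))"
        using nz by (simp add: field_simps)
      finally show ?thesis unfolding 1 2 by (simp add: algebra_simps)
    qed
    show "\<exists>w. (\<forall>i\<in>S. w i = u i) \<and> (\<forall>j\<in>{z, z'}. linear_form ?T (L j) w = 0)" for u
    proof -
      let ?w = "u(k := - linear_form S (a l) u / ?\<alpha>, l := - linear_form S (a k) u / ?\<alpha>)"
      have "linear_form S m ?w = linear_form S m u" for m
        using fin by (intro linear_form_cong) auto
      then have "linear_form ?T (L j) ?w = 0" for j
        using fin nz by (simp add: L)
      moreover have "\<forall>i\<in>S. ?w i = u i" using fin by auto
      ultimately show ?thesis by blast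
    qed
    show "linear_form ?T (L j) (E j') = (if j = j' then 1 else 0)" if "j \<in> {z, z'}" "j' \<in> {z, z'}" for j j'
    proof -
      have "linear_form S m (E j') = 0" for m
        using fin by (auto simp: linear_form_def E_def intro!: sum.neutral)
      then have "linear_form ?T (L j) (E j') = 1 / 2 + sg j * sg j' / 2"
        using fin nz by (simp add: L) (simp add: E_def)
      then show ?thesis using that z sg by auto
    qed
    show "E j i = 0" if "i \<in> S" for j i using that fin by (auto simp: E_def)
  qed (use fin z in auto)
qed

text \<open>
  Both matrices are reduced simultaneously. A nonzero diagonal entry is a pivot for both. If there
  is none, but some entry \<open>a k l\<close> is not zero, the minor \<open>- (a k l)\<^sup>2\<close> shows that \<open>b k l\<close> is not zero either, and the
  two by two block is a pivot for both. Minors of a Schur complement are quotients of minors of the matrix, so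
  their signs agree again. If no pivot is left, both matrices vanish.
\<close>

theorem minor_signs_determine_inertia:
  fixes a b :: "nat \<Rightarrow> nat \<Rightarrow> 'r::linordered_field"
  assumes "finite S" and "\<And>i j. i \<in> S \<Longrightarrow> j \<in> S \<Longrightarrow> a i j = a j i"
    and "\<And>i j. i \<in> S \<Longrightarrow> j \<in> S \<Longrightarrow> b i j = b j i"
    and "\<And>xs. distinct xs \<Longrightarrow> set xs \<subseteq> S \<Longrightarrow> sgn (list_minor a xs) = sgn (list_minor b xs)"
  shows "\<exists>J :: nat set. \<exists>c l e c' l' e'. diagonalises S a J c l e \<and> diagonalises S b J c' l' e' \<and>
    (\<forall>j\<in>J. sgn (c j) = sgn (c' j))"
  using assms
proof (induction "card S" arbitrary: S a b rule: less_induct)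
  case less
  note fin = less.prems(1) and syma = less.prems(2) and symb = less.prems(3) and minors = less.prems(4)
  have diag: "sgn (a k k) = sgn (b k k)" if "k \<in> S" for k
    using minors[of "[k]"] that by simp
  consider k where "k \<in> S" "a k k \<noteq> 0"
    | k l where "\<forall>i\<in>S. a i i = 0" "k \<in> S" "l \<in> S" "k \<noteq> l" "a k l \<noteq> 0"
    | "\<forall>i\<in>S. \<forall>j\<in>S. a i j = 0"
    by metis
  then show ?case
  proof cases
    case 1
    let ?S = "S - {k}"
    have bk: "b k k \<noteq> 0" using diag[OF 1(1)] 1(2) by (metis sgn_0 sgn_eq_0_iff)
    have S: "insert k ?S = S" using 1 by auto
    have "\<exists>J :: nat set. \<exists>c l e c' l' e'. diagonalises ?S (schur_complement_at a k) J c l e \<and>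
        diagonalises ?S (schur_complement_at b k) J c' l' e' \<and> (\<forall>j\<in>J. sgn (c j) = sgn (c' j))"
    proof (rule less.hyps)
      show "card ?S < card S" using 1 fin by (meson card_Diff1_less)
      show "schur_complement_at a k i j = schur_complement_at a k j i" if "i \<in> ?S" "j \<in> ?S" for i j
        using that 1 syma[of i j] syma[of i k] syma[of j k] by (simp add: schur_complement_at_def)
      show "schur_complement_at b k i j = schur_complement_at b k j i" if "i \<in> ?S" "j \<in> ?S" for i j
        using that 1 symb[of i j] symb[of i k] symb[of j k] by (simp add: schur_complement_at_def)
      show "sgn (list_minor (schur_complement_at a k) xs) = sgn (list_minor (schur_complement_at b k) xs)"
        if "distinct xs" "set xs \<subseteq> ?S" for xs
      proof -
        have "sgn (list_minor a (k # xs)) = sgn (list_minor b (k # xs))"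
          using that 1 by (intro minors) auto
        then show ?thesis
          using 1 bk diag[OF 1(1)] by (simp add: list_minor_schur_complement_at sgn_mult sgn_eq_0_iff)
      qed
    qed (use fin in auto)
    then obtain J :: "nat set" and c l e c' l' e' where
      J: "diagonalises ?S (schur_complement_at a k) J c l e" "diagonalises ?S (schur_complement_at b k) J c' l' e'"
      "\<forall>j\<in>J. sgn (c j) = sgn (c' j)" by blast
    then have "finite J" by (simp add: diagonalises_def)
    then obtain z where z: "z \<notin> J" using ex_new_if_finite[OF infinite_UNIV_nat, of J] by auto
    have "\<exists>l' e'. diagonalises S a (J \<union> {z}) (\<lambda>j. if j \<in> {z} then a k k else c j) l' e'"
      using diagonalises_schur_complement_at[OF _ _ _ _ J(1) z] 1 fin syma S by auto
    moreover have "\<exists>l' e'. diagonalises S b (J \<union> {z}) (\<lambda>j. if j \<in> {z} then b k k else c' j) l' e'"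
      using diagonalises_schur_complement_at[OF _ _ _ _ J(2) z] 1 bk fin symb S by auto
    moreover have "\<forall>j\<in>J \<union> {z}. sgn (if j \<in> {z} then a k k else c j) = sgn (if j \<in> {z} then b k k else c' j)"
      using J(3) diag[OF 1(1)] by auto
    ultimately show ?thesis by blast
  next
    case 2
    let ?S = "S - {k, l}"
    have zb: "b i i = 0" if "i \<in> S" for i using diag[OF that] 2(1) that by (metis sgn_0 sgn_eq_0_iff)
    have "sgn (list_minor a [k, l]) = sgn (list_minor b [k, l])"
      using 2 by (intro minors) auto
    moreover have "list_minor a [k, l] = - (a k l)\<^sup>2" "list_minor b [k, l] = - (b k l)\<^sup>2"
      using 2 zb syma[of l k] symb[of l k] by (simp_all add: list_minor_pair power2_eq_square)
    ultimately have "sgn (b k l) \<noteq> 0"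
      using 2(5) by (metis neg_equal_0_iff_equal power_zero_numeral sgn_eq_0_iff zero_eq_power2)
    then have "b k l \<noteq> 0" by (simp add: sgn_eq_0_iff)
    have a: "a k k = 0" "a l l = 0" "a l k = a k l" "a k l \<noteq> 0" using 2 syma by auto
    have b: "b k k = 0" "b l l = 0" "b l k = b k l" "b k l \<noteq> 0" using 2 zb symb \<open>b k l \<noteq> 0\<close> by auto
    have S: "insert k (insert l ?S) = S" using 2 by auto
    have "\<exists>J :: nat set. \<exists>c f e c' f' e'. diagonalises ?S (schur_complement_at_pair a k l) J c f e \<and>
        diagonalises ?S (schur_complement_at_pair b k l) J c' f' e' \<and> (\<forall>j\<in>J. sgn (c j) = sgn (c' j))"
    proof (rule less.hyps)
      show "card ?S < card S" using 2 fin by (intro psubset_card_mono) auto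
      show "schur_complement_at_pair a k l i j = schur_complement_at_pair a k l j i" if "i \<in> ?S" "j \<in> ?S" for i j
        using that 2 syma[of i j] syma[of i k] syma[of j k] syma[of i l] syma[of j l]
        by (simp add: schur_complement_at_pair_def algebra_simps)
      show "schur_complement_at_pair b k l i j = schur_complement_at_pair b k l j i" if "i \<in> ?S" "j \<in> ?S" for i j
        using that 2 symb[of i j] symb[of i k] symb[of j k] symb[of i l] symb[of j l]
        by (simp add: schur_complement_at_pair_def algebra_simps)
      show "sgn (list_minor (schur_complement_at_pair a k l) xs) = sgn (list_minor (schur_complement_at_pair b k l) xs)"
        if "distinct xs" "set xs \<subseteq> ?S" for xs
      proof -
        have "sgn (list_minor a (k # l # xs)) = sgn (list_minor b (k # l # xs))"
          using that 2 by (intro minors) auto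
        moreover have "sgn (- (a k l)\<^sup>2) = -1" "sgn (- (b k l)\<^sup>2) = -1"
          using a(4) b(4) by (simp_all only: sgn_neg neg_less_0_iff_less zero_less_power2 simp_thms)
        ultimately show ?thesis
          unfolding list_minor_schur_complement_at_pair[of a, OF a] list_minor_schur_complement_at_pair[of b, OF b] sgn_mult by simp
      qed
    qed (use fin in auto)
    then obtain J :: "nat set" and c f e c' f' e' where
      J: "diagonalises ?S (schur_complement_at_pair a k l) J c f e" "diagonalises ?S (schur_complement_at_pair b k l) J c' f' e'"
      "\<forall>j\<in>J. sgn (c j) = sgn (c' j)" by blast
    then have "finite J" by (simp add: diagonalises_def)
    then obtain z where z: "z \<notin> J" using ex_new_if_finite[OF infinite_UNIV_nat, of J] by auto
    obtain z' where z': "z' \<notin> insert z J"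
      using ex_new_if_finite[OF infinite_UNIV_nat, of "insert z J"] \<open>finite J\<close> by auto
    let ?h = "\<lambda>c j. if j \<in> {z, z'} then (if j = z then 1 / 2 else - 1 / 2) else c j"
    have "\<exists>l' e'. diagonalises (insert k (insert l ?S)) a (J \<union> {z, z'}) (?h c) l' e'"
      by (rule diagonalises_schur_complement_at_pair[OF _ _ _ _ _ _ a J(1)]) (use 2 fin syma z z' in auto)
    moreover have "\<exists>l' e'. diagonalises (insert k (insert l ?S)) b (J \<union> {z, z'}) (?h c') l' e'"
      by (rule diagonalises_schur_complement_at_pair[OF _ _ _ _ _ _ b J(2)]) (use 2 fin symb z z' in auto)
    moreover have "\<forall>j\<in>J \<union> {z, z'}. sgn (?h c j) = sgn (?h c' j)"
      using J(3) by simp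
    ultimately show ?thesis unfolding S by blast
  next
    case 3
    have b0: "b i j = 0" if ij: "i \<in> S" "j \<in> S" for i j
    proof (cases "i = j")
      case True
      then show ?thesis using diag[of i] 3 ij by (simp add: sgn_eq_0_iff)
    next
      case False
      then have "sgn (list_minor a [i, j]) = sgn (list_minor b [i, j])"
        using ij by (intro minors) auto
      moreover have "b i i = 0" using diag[of i] 3 ij by (simp add: sgn_eq_0_iff)
      ultimately have "b i j * b j i = 0"
        using 3 ij by (simp add: list_minor_pair sgn_eq_0_iff)
      then show ?thesis using symb[OF ij] by simp
    qed
    have "diagonalises S a {} (\<lambda>_. 0) (\<lambda>_ _. 0) (\<lambda>_ _. 0)"
      using 3 by (simp add: diagonalises_def quadratic_form_def)
    moreover have "diagonalises S b {} (\<lambda>_. 0) (\<lambda>_ _. 0) (\<lambda>_ _. 0)"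
      using b0 by (simp add: diagonalises_def quadratic_form_def)
    ultimately show ?thesis by blast
  qed
qed


section \<open>Traces of multiplication as sums over roots\<close>

lemma pseudo_mod_monic_unique:
  fixes P F r :: "'a::idom poly"
  assumes "lead_coeff P = 1" and "P dvd F - r" and "r = 0 \<or> degree r < degree P"
  shows "pseudo_mod F P = r"
proof (rule ccontr)
  let ?s = "pseudo_mod F P"
  assume "?s \<noteq> r"
  have "P dvd (F - r) - (F - ?s)"
    using assms(2) pseudo_mod_monic(1)[OF assms(1), of F] by (rule dvd_diff)
  then have dvd: "P dvd ?s - r" by simp
  have "degree P \<le> degree (?s - r)"
    using dvd \<open>?s \<noteq> r\<close> by (intro dvd_imp_degree_le) auto
  moreover have "?s = 0 \<or> degree ?s < degree P" by (rule pseudo_mod_monic(2)[OF assms(1)])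
  ultimately show False
    using assms(3) \<open>?s \<noteq> r\<close> degree_diff_le_max[of ?s r] by auto
qed

lemma map_poly_monic:
  assumes "lead_coeff P = 1" and "h 0 = 0" and "h 1 = (1::'b::comm_ring_1)"
  shows "degree (map_poly h P) = degree P" and "lead_coeff (map_poly h P) = 1"
proof -
  have "degree (map_poly h P) \<le> degree P"
    using assms(2) by (intro degree_le) (auto simp: coeff_map_poly coeff_eq_0)
  moreover have "degree P \<le> degree (map_poly h P)"
    using assms by (intro le_degree) (simp add: coeff_map_poly)
  ultimately show "degree (map_poly h P) = degree P" by simp
  then show "lead_coeff (map_poly h P) = 1" using assms by (simp add: coeff_map_poly)
qed

lemma map_poly_pseudo_mod_monic:
  assumes "idom_hom h" and "lead_coeff P = 1"
  shows "map_poly h (pseudo_mod F P) = pseudo_mod (map_poly h F) (map_poly h P)"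
proof -
  interpret h: idom_hom h by fact
  interpret mp: map_poly_idom_hom h ..
  have "P dvd F - pseudo_mod F P" by (rule pseudo_mod_monic(1)[OF assms(2)])
  then have "map_poly h P dvd map_poly h F - map_poly h (pseudo_mod F P)"
    by (metis mp.hom_dvd mp.hom_minus)
  moreover have "degree (map_poly h (pseudo_mod F P)) \<le> degree (pseudo_mod F P)"
    by (intro degree_le) (auto simp: coeff_map_poly coeff_eq_0)
  then have "map_poly h (pseudo_mod F P) = 0 \<or>
      degree (map_poly h (pseudo_mod F P)) < degree (map_poly h P)"
    using pseudo_mod_monic(2)[OF assms(2), of F] map_poly_monic(1)[of P h, OF assms(2)] by auto
  ultimately show ?thesis
    using map_poly_monic(2)[of P h, OF assms(2)] by (intro pseudo_mod_monic_unique[symmetric]) auto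
qed

text \<open>
  For monic \<open>P\<close> the remainder is characterised by divisibility and degree, and both survive a ring
  homomorphism.
\<close>

lemma hom_mult_trace:
  assumes "idom_hom h" and "lead_coeff P = 1"
  shows "h (mult_trace P F) = mult_trace (map_poly h P) (map_poly h F)"
proof -
  interpret h: idom_hom h by fact
  interpret mp: map_poly_idom_hom h ..
  have deg: "degree (map_poly h P) = degree P"
    by (intro map_poly_monic(1)[OF assms(2)]) auto
  have "h (coeff (pseudo_mod (F * monom 1 k) P) k) =
      coeff (pseudo_mod (map_poly h F * monom 1 k) (map_poly h P)) k" for k
  proof -
    have "map_poly h (F * monom 1 k) = map_poly h F * monom 1 k"
      by (simp add: mp.hom_mult map_poly_monom)
    then show ?thesis
      using map_poly_pseudo_mod_monic[OF assms, of "F * monom 1 k"] by (metis coeff_map_poly h.hom_zero)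
  qed
  then show ?thesis
    by (simp add: mult_trace_def mult_matrix_def deg h.hom_sum)
qed

lemma map_mat_Her:
  assumes "idom_hom h" and "lead_coeff P = 1"
  shows "map_mat h (Her P Q) = Her (map_poly h P) (map_poly h Q)"
proof -
  interpret h: idom_hom h by fact
  interpret mp: map_poly_idom_hom h ..
  have deg: "degree (map_poly h P) = degree P"
    by (intro map_poly_monic(1)[OF assms(2)]) auto
  show ?thesis
    by (rule eq_matI) (auto simp: Her_def deg hom_mult_trace[OF assms] mp.hom_mult map_poly_monom)
qed

lemma poly_shift_cutoff:
  fixes P :: "'a::comm_ring_1 poly"
  shows "P = poly_cutoff n P + monom 1 n * poly_shift n P"
  by (rule poly_eqI) (auto simp: coeff_poly_cutoff coeff_poly_shift coeff_monom_mult)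

lemma mod_poly_sum: "(\<Sum>i\<in>I. f i) mod (P :: 'a::field poly) = (\<Sum>i\<in>I. f i mod P)"
  by (induction I rule: infinite_finite_induct) (auto simp: poly_mod_add_left)

text \<open>
  Up to sign the residue at infinity of \<open>g / P\<close>, for monic \<open>P\<close>, which turns the coefficient extraction in a trace into a
  nondegenerate pairing on the residue ring.
\<close>

definition top_coeff_mod :: "'a::field poly \<Rightarrow> 'a poly \<Rightarrow> 'a" where
  "top_coeff_mod P g = coeff (g mod P) (degree P - 1)"

lemma top_coeff_mod_sum: "top_coeff_mod P (\<Sum>i\<in>I. f i) = (\<Sum>i\<in>I. top_coeff_mod P (f i))"
  by (simp add: top_coeff_mod_def mod_poly_sum coeff_sum)

lemma top_coeff_mod_smult: "top_coeff_mod P (smult c g) = c * top_coeff_mod P g"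
  by (simp add: top_coeff_mod_def mod_smult_left)

lemma top_coeff_mod_less: "degree g < degree P \<Longrightarrow> top_coeff_mod P g = coeff g (degree P - 1)"
  by (simp add: top_coeff_mod_def mod_poly_less)

lemma top_coeff_mod_cong:
  assumes "P dvd g - h"
  shows "top_coeff_mod P g = top_coeff_mod P h"
proof -
  obtain k where "g - h = P * k" using assms by (elim dvdE)
  then have "g = h + P * k" by (simp add: algebra_simps)
  then show ?thesis by (simp add: top_coeff_mod_def)
qed

text \<open>
  Dividing \<open>P\<close> by \<open>X\<^bsup>l + 1\<^esup>\<close> gives the basis dual to \<open>1, X, \<dots>, X\<^bsup>p - 1\<^esup>\<close> (Euler). For \<open>j \<le> l\<close> the product has
  degree at most \<open>p - 1\<close> and its top coefficient can be read off. For \<open>j > l\<close> it is congruent to minus \<open>X\<^bsup>j - l - 1\<^esup>\<close>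
  times the low part of \<open>P\<close>, which has degree less than \<open>p - 1\<close>.
\<close>

lemma top_coeff_mod_dual_basis:
  fixes P :: "'a::field poly"
  assumes monic: "lead_coeff P = 1" and j: "j < degree P" and l: "l < degree P"
  shows "top_coeff_mod P (monom 1 j * poly_shift (Suc l) P) = (if j = l then 1 else 0)"
proof (cases "j \<le> l")
  case True
  let ?g = "monom 1 j * poly_shift (Suc l) P"
  have "degree ?g \<le> degree P - 1"
    using True l by (intro degree_le) (auto simp: coeff_monom_mult coeff_poly_shift intro!: coeff_eq_0)
  then have "top_coeff_mod P ?g = coeff ?g (degree P - 1)"
    using l by (intro top_coeff_mod_less) auto
  also have "\<dots> = coeff P (degree P + (l - j))"
  proof -
    have "degree P - 1 - j + Suc l = degree P + (l - j)" "j \<le> degree P - 1" using j True by auto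
    then show ?thesis by (simp only: coeff_monom_mult coeff_poly_shift if_True mult_1)
  qed
  also have "\<dots> = (if j = l then 1 else 0)"
    using monic True by (auto intro!: coeff_eq_0)
  finally show ?thesis .
next
  case False
  define d where "d = j - Suc l"
  have d: "j = d + Suc l" using False by (simp add: d_def)
  let ?h = "monom 1 d * poly_cutoff (Suc l) P"
  have "monom 1 j * poly_shift (Suc l) P = monom 1 d * (monom 1 (Suc l) * poly_shift (Suc l) P)"
    by (simp add: d mult_monom mult.assoc[symmetric])
  also have "monom 1 (Suc l) * poly_shift (Suc l) P = P - poly_cutoff (Suc l) P"
    using poly_shift_cutoff[of P "Suc l"] by (simp add: algebra_simps)
  also have "monom 1 d * (P - poly_cutoff (Suc l) P) = - ?h + monom 1 d * P"
    by (simp add: algebra_simps)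
  finally have "top_coeff_mod P (monom 1 j * poly_shift (Suc l) P) = top_coeff_mod P (- ?h)"
    by (simp only: top_coeff_mod_cong add_diff_cancel_left' dvd_triv_right)
  also have "degree ?h \<le> degree P - 2"
    using d j by (intro degree_le) (auto simp: coeff_monom_mult coeff_poly_cutoff)
  then have "top_coeff_mod P (- ?h) = coeff (- ?h) (degree P - 1)"
    using l by (intro top_coeff_mod_less) (auto simp: degree_minus)
  also have "\<dots> = 0"
    using d j by (auto simp: coeff_monom_mult coeff_poly_cutoff)
  finally show ?thesis using False by simp
qed

lemma coeff_mod_monic:
  fixes P :: "'a::field poly"
  assumes monic: "lead_coeff P = 1" and l: "l < degree P"
  shows "coeff (g mod P) l = top_coeff_mod P (g * poly_shift (Suc l) P)"
proof -
  let ?r = "g mod P"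
  have "degree ?r < degree P"
    using l degree_mod_less[of P g] by (metis degree_0 gr_zeroI not_less_zero)
  then have r: "?r = (\<Sum>j<degree P. monom (coeff ?r j) j)"
    by (intro poly_eqI) (auto simp: coeff_sum coeff_monom intro: coeff_eq_0)
  have "top_coeff_mod P (g * poly_shift (Suc l) P) = top_coeff_mod P (?r * poly_shift (Suc l) P)"
    by (intro top_coeff_mod_cong) (simp add: left_diff_distrib[symmetric] dvd_minus_mod)
  also have "\<dots> = (\<Sum>j<degree P. top_coeff_mod P (smult (coeff ?r j) (monom 1 j * poly_shift (Suc l) P)))"
    by (subst r) (simp add: sum_distrib_right top_coeff_mod_sum smult_monom_mult[symmetric]
        mult_smult_left[symmetric] smult_monom)
  also have "\<dots> = (\<Sum>j<degree P. if j = l then coeff ?r j else 0)"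
    using l by (intro sum.cong) (auto simp: top_coeff_mod_smult top_coeff_mod_dual_basis[OF monic])
  also have "\<dots> = coeff ?r l" using l by simp
  finally show ?thesis by simp
qed

text \<open>
  Every \<open>k \<le> i\<close> contributes the coefficient of \<open>X\<^bsup>i + 1\<^esup>\<close> in \<open>P\<close> to the coefficient of \<open>X\<^sup>i\<close>.
\<close>

lemma sum_monom_shift_eq_pderiv:
  fixes P :: "'a::field poly"
  shows "(\<Sum>k<degree P. monom 1 k * poly_shift (Suc k) P) = pderiv P"
proof (rule poly_eqI)
  fix i
  have "coeff (\<Sum>k<degree P. monom 1 k * poly_shift (Suc k) P) i =
      (\<Sum>k<degree P. if k \<le> i then coeff P (Suc i) else 0)"
    unfolding coeff_sum by (intro sum.cong) (auto simp: coeff_monom_mult coeff_poly_shift)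
  also have "\<dots> = of_nat (card ({..<degree P} \<inter> {..i})) * coeff P (Suc i)"
    by (simp add: sum.If_cases flip: atMost_def)
  also have "\<dots> = of_nat (Suc i) * coeff P (Suc i)"
  proof (cases "i < degree P")
    case True
    then have "{..<degree P} \<inter> {..i} = {..i}" by auto
    then show ?thesis by simp
  next
    case False
    then show ?thesis by (simp add: coeff_eq_0)
  qed
  finally show "coeff (\<Sum>k<degree P. monom 1 k * poly_shift (Suc k) P) i = coeff (pderiv P) i"
    by (simp add: coeff_pderiv)
qed

text \<open>
  The diagonal entries of the multiplication matrix are pairings with dual basis vectors; multiplied by the basis
  vectors, these add up to \<open>P'\<close>.
\<close>

lemma mult_trace_eq_top_coeff:
  fixes P :: "'a::field poly"
  assumes monic: "lead_coeff P = 1"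
  shows "mult_trace P F = top_coeff_mod P (F * pderiv P)"
proof -
  have mod: "pseudo_mod G P = G mod P" for G
  proof (rule pseudo_mod_monic_unique[OF monic])
    show "P dvd G - G mod P" by (simp add: dvd_minus_mod)
    have "P \<noteq> 0" using monic by auto
    then show "G mod P = 0 \<or> degree (G mod P) < degree P" by (rule degree_mod_less)
  qed
  have "mult_trace P F = (\<Sum>k<degree P. coeff ((F * monom 1 k) mod P) k)"
    by (simp add: mult_trace_def mult_matrix_def mod)
  also have "\<dots> = (\<Sum>k<degree P. top_coeff_mod P (F * (monom 1 k * poly_shift (Suc k) P)))"
    by (intro sum.cong) (simp_all add: coeff_mod_monic[OF monic] mult.assoc)
  also have "\<dots> = top_coeff_mod P (F * pderiv P)"
    by (simp add: top_coeff_mod_sum[symmetric] sum_distrib_left[symmetric] sum_monom_shift_eq_pderiv)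
  finally show ?thesis .
qed

lemma monic_prod_linear:
  fixes x :: "'i \<Rightarrow> 'a::idom"
  assumes "finite I"
  shows "degree (\<Prod>i\<in>I. [:- x i, 1:]) = card I" and "lead_coeff (\<Prod>i\<in>I. [:- x i, 1:]) = 1"
proof -
  show "degree (\<Prod>i\<in>I. [:- x i, 1:]) = card I"
    using degree_prod_eq_sum_degree[of I "\<lambda>i. [:- x i, 1:]"] by simp
  show "lead_coeff (\<Prod>i\<in>I. [:- x i, 1:]) = 1"
    unfolding lead_coeff_prod by simp
qed

text \<open>
  By the product rule \<open>P'\<close> is the sum of the cofactors \<open>P / (X - x\<^sub>i)\<close>. Modulo \<open>P\<close>, multiplying such a cofactor by
  \<open>F\<close> multiplies it by the scalar \<open>F(x\<^sub>i)\<close>, and the cofactor is monic of degree \<open>p - 1\<close>.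
\<close>

theorem mult_trace_root_product:
  fixes x :: "nat \<Rightarrow> 'a::field"
  assumes P: "P = (\<Prod>i<n. [:- x i, 1:])"
  shows "mult_trace P F = (\<Sum>i<n. poly F (x i))"
proof -
  define Q where "Q i = (\<Prod>j\<in>{..<n} - {i}. [:- x j, 1:])" for i
  have monic: "lead_coeff P = 1" and deg: "degree P = n"
    unfolding P using monic_prod_linear[of "{..<n}" x] by auto
  have "mult_trace P F = top_coeff_mod P (F * pderiv P)"
    by (rule mult_trace_eq_top_coeff[OF monic])
  also have "pderiv P = (\<Sum>i<n. Q i)"
    by (simp add: P pderiv_prod Q_def pderiv_pCons)
  also have "top_coeff_mod P (F * (\<Sum>i<n. Q i)) = (\<Sum>i<n. top_coeff_mod P (F * Q i))"
    by (simp add: sum_distrib_left top_coeff_mod_sum)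
  also have "\<dots> = (\<Sum>i<n. poly F (x i))"
  proof (rule sum.cong)
    fix i assume i: "i \<in> {..<n}"
    then have PQ: "P = [:- x i, 1:] * Q i"
      by (simp add: P Q_def prod.remove[of "{..<n}" i])
    have degQ: "degree (Q i) = n - 1" "lead_coeff (Q i) = 1"
      unfolding Q_def using i monic_prod_linear[of "{..<n} - {i}" x] by auto
    have "[:- x i, 1:] dvd F - [:poly F (x i):]"
      by (simp add: poly_eq_0_iff_dvd[symmetric])
    then have "[:- x i, 1:] * Q i dvd (F - [:poly F (x i):]) * Q i"
      by (rule mult_dvd_mono) simp
    then have "P dvd F * Q i - smult (poly F (x i)) (Q i)"
      by (simp add: PQ left_diff_distrib)
    then have "top_coeff_mod P (F * Q i) = top_coeff_mod P (smult (poly F (x i)) (Q i))"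
      by (rule top_coeff_mod_cong)
    also have "\<dots> = poly F (x i) * top_coeff_mod P (Q i)" by (rule top_coeff_mod_smult)
    also have "top_coeff_mod P (Q i) = 1"
      using degQ deg i by (subst top_coeff_mod_less) auto
    finally show "top_coeff_mod P (F * Q i) = poly F (x i)" by simp
  qed simp
  finally show ?thesis .
qed


section \<open>Newton identities over a subfield\<close>

text \<open>
  A subfield: closure under differences, products and quotients, with \<open>x / 0 = 0\<close>.
\<close>

definition field_subset :: "'a::field set \<Rightarrow> bool" where
  "field_subset K \<longleftrightarrow> 1 \<in> K \<and> (\<forall>x\<in>K. \<forall>y\<in>K. x - y \<in> K \<and> x * y \<in> K \<and> x / y \<in> K)"

lemma field_subset_closed:
  assumes "field_subset K"
  shows "0 \<in> K" "1 \<in> K" "x \<in> K \<Longrightarrow> y \<in> K \<Longrightarrow> x + y \<in> K" "x \<in> K \<Longrightarrow> y \<in> K \<Longrightarrow> x - y \<in> K"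
    "x \<in> K \<Longrightarrow> y \<in> K \<Longrightarrow> x * y \<in> K" "x \<in> K \<Longrightarrow> y \<in> K \<Longrightarrow> x / y \<in> K" "x \<in> K \<Longrightarrow> - x \<in> K"
    "x \<in> K \<Longrightarrow> x ^ n \<in> K" "of_nat n \<in> K" "(\<And>i. i \<in> I \<Longrightarrow> f i \<in> K) \<Longrightarrow> sum f I \<in> K"
proof -
  have *: "x - y \<in> K" "x * y \<in> K" "x / y \<in> K" if "x \<in> K" "y \<in> K" for x y
    using assms that by (auto simp: field_subset_def)
  show 1: "1 \<in> K" using assms by (auto simp: field_subset_def)
  show 0: "0 \<in> K" using *(1)[OF 1 1] by simp
  have m: "- x \<in> K" if "x \<in> K" for x using *(1)[OF 0 that] by simp
  have p: "x + y \<in> K" if "x \<in> K" "y \<in> K" for x y using *(1)[OF that(1) m[OF that(2)]] by simp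
  show "of_nat n \<in> K" by (induction n) (auto intro: 0 1 p)
  show "x \<in> K \<Longrightarrow> x ^ n \<in> K" by (induction n) (auto intro: 1 *)
  show "(\<And>i. i \<in> I \<Longrightarrow> f i \<in> K) \<Longrightarrow> sum f I \<in> K"
    by (induction I rule: infinite_finite_induct) (auto intro: 0 p)
qed (use assms in \<open>auto simp: field_subset_def\<close>, (metis assms diff_0 diff_minus_eq_add diff_self field_subset_def)+)

text \<open>
  The generating polynomial of the elementary symmetric functions of the \<open>x\<^sub>i\<close>, up to signs.
\<close>

definition reverse_root_product :: "'i set \<Rightarrow> ('i \<Rightarrow> 'a::field) \<Rightarrow> 'a poly" where
  "reverse_root_product I x = (\<Prod>i\<in>I. [:1, - x i:])"

lemma reverse_root_product_eq: "reverse_root_product I x = reflect_poly (\<Prod>i\<in>I. [:- x i, 1:])"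
proof -
  have "reflect_poly [:- a, 1:] = [:1, - a:]" for a :: 'a
    by (rule poly_eqI) (auto simp: coeff_reflect_poly coeff_pCons split: nat.splits)
  then show ?thesis by (simp add: reverse_root_product_def reflect_poly_prod)
qed

lemma coeff_reverse_root_product_remove:
  assumes "finite I" "i \<in> I"
  shows "coeff (reverse_root_product (I - {i}) x) n =
    (\<Sum>k\<le>n. coeff (reverse_root_product I x) k * x i ^ (n - k))"
proof (induction n)
  have E: "reverse_root_product I x = [:1, - x i:] * reverse_root_product (I - {i}) x"
    unfolding reverse_root_product_def using assms by (simp add: prod.remove)
  case 0
  show ?case by (simp add: E)
next
  have E: "reverse_root_product I x = [:1, - x i:] * reverse_root_product (I - {i}) x"
    unfolding reverse_root_product_def using assms by (simp add: prod.remove)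
  case (Suc n)
  have "(\<Sum>k\<le>Suc n. coeff (reverse_root_product I x) k * x i ^ (Suc n - k)) =
      coeff (reverse_root_product I x) (Suc n) +
      x i * (\<Sum>k\<le>n. coeff (reverse_root_product I x) k * x i ^ (n - k))"
    by (simp add: sum_distrib_left Suc_diff_le mult_ac)
  also have "\<dots> = coeff (reverse_root_product (I - {i}) x) (Suc n)"
    unfolding Suc.IH[symmetric] by (simp add: E)
  finally show ?case by simp
qed

text \<open>
  The logarithmic derivative of \<open>\<Prod> (1 - x\<^sub>i X)\<close>, cleared of denominators: in its derivative each term is the
  product without one factor, whose coefficients are obtained by expanding \<open>1 / (1 - x\<^sub>i X)\<close>.
\<close>

lemma newton_identity:
  fixes x :: "'i \<Rightarrow> 'a::field"
  assumes "finite I"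
  shows "of_nat (Suc n) * coeff (reverse_root_product I x) (Suc n) =
    - (\<Sum>k\<le>n. coeff (reverse_root_product I x) k * (\<Sum>i\<in>I. x i ^ (Suc n - k)))"
proof -
  let ?E = "reverse_root_product I x"
  have "pderiv ?E = (\<Sum>i\<in>I. smult (- x i) (reverse_root_product (I - {i}) x))"
    by (simp add: reverse_root_product_def pderiv_prod pderiv_pCons)
  then have "coeff (pderiv ?E) n = (\<Sum>i\<in>I. - x i * coeff (reverse_root_product (I - {i}) x) n)"
    by (simp add: coeff_sum)
  also have "\<dots> = (\<Sum>i\<in>I. - (\<Sum>k\<le>n. coeff ?E k * x i ^ (Suc n - k)))"
    using assms by (intro sum.cong)
      (auto simp: coeff_reverse_root_product_remove sum_distrib_left Suc_diff_le mult_ac sum_negf)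
  also have "\<dots> = - (\<Sum>k\<le>n. coeff ?E k * (\<Sum>i\<in>I. x i ^ (Suc n - k)))"
    unfolding sum_negf sum_distrib_left by (subst sum.swap) simp
  finally show ?thesis by (simp add: coeff_pderiv)
qed

lemma coeff_reverse_root_product_0: "coeff (reverse_root_product I x) 0 = 1"
  unfolding reverse_root_product_def by (induction I rule: infinite_finite_induct) auto

lemma power_sums_in_subfield:
  fixes x :: "'i \<Rightarrow> 'a::field"
  assumes K: "field_subset K" and fin: "finite I"
    and coeffs: "\<And>n. coeff (reverse_root_product I x) n \<in> K"
  shows "(\<Sum>i\<in>I. x i ^ m) \<in> K"
proof (induction m rule: less_induct)
  case (less m)
  show ?case
  proof (cases m)
    case 0
    then show ?thesis using field_subset_closed(9)[OF K] by simp
  next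
    case (Suc n)
    let ?e = "coeff (reverse_root_product I x)"
    have "of_nat (Suc n) * ?e (Suc n) =
      - ((\<Sum>k\<in>{1..n}. ?e k * (\<Sum>i\<in>I. x i ^ (Suc n - k))) + (\<Sum>i\<in>I. x i ^ Suc n))"
    proof -
      have "{..n} = insert 0 {1..n}" by auto
      then show ?thesis unfolding newton_identity[OF fin]
        by (simp add: coeff_reverse_root_product_0)
    qed
    then have "(\<Sum>i\<in>I. x i ^ m) = - (of_nat (Suc n) * ?e (Suc n)) -
        (\<Sum>k\<in>{1..n}. ?e k * (\<Sum>i\<in>I. x i ^ (Suc n - k)))"
      by (simp only: Suc minus_minus) (simp add: algebra_simps)
    moreover have "?e k * (\<Sum>i\<in>I. x i ^ (Suc n - k)) \<in> K" if "k \<in> {1..n}" for k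
      using that Suc by (intro field_subset_closed(5)[OF K] coeffs less.IH) auto
    ultimately show ?thesis
      using field_subset_closed[OF K] coeffs by (metis (no_types, lifting))
  qed
qed

lemma coeffs_in_subfield:
  fixes x :: "'i \<Rightarrow> 'a::field_char_0"
  assumes K: "field_subset K" and fin: "finite I"
    and power_sums: "\<And>m. (\<Sum>i\<in>I. x i ^ m) \<in> K"
  shows "coeff (reverse_root_product I x) n \<in> K"
proof (induction n rule: less_induct)
  case (less n)
  show ?case
  proof (cases n)
    case 0
    then show ?thesis using field_subset_closed(2)[OF K] by (simp add: coeff_reverse_root_product_0)
  next
    case (Suc m)
    let ?s = "- (\<Sum>k\<le>m. coeff (reverse_root_product I x) k * (\<Sum>i\<in>I. x i ^ (Suc m - k)))"
    have "?s \<in> K"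
      using less Suc by (intro field_subset_closed(7,10,5)[OF K] power_sums) auto
    moreover have "coeff (reverse_root_product I x) n = ?s / of_nat (Suc m)"
      using newton_identity[OF fin, of m x] Suc by (simp add: field_simps del: of_nat_Suc)
    ultimately show ?thesis using field_subset_closed(6,9)[OF K] by metis
  qed
qed

lemma coeffs_reverse_root_product_iff:
  fixes x :: "'i \<Rightarrow> 'a::field"
  assumes "finite I" and "field_subset K"
  shows "(\<forall>n. coeff (reverse_root_product I x) n \<in> K) \<longleftrightarrow> (\<forall>n. coeff (\<Prod>i\<in>I. [:- x i, 1:]) n \<in> K)"
proof -
  let ?P = "\<Prod>i\<in>I. [:- x i, 1:]" and ?E = "reverse_root_product I x"
  have E: "coeff ?E n = (if n > degree ?P then 0 else coeff ?P (degree ?P - n))" for n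
    by (simp add: reverse_root_product_eq coeff_reflect_poly)
  have P: "coeff ?P n = (if n > degree ?P then 0 else coeff ?E (degree ?P - n))" for n
    by (simp add: E coeff_eq_0)
  show ?thesis using E P field_subset_closed(1)[OF assms(2)] by metis
qed

text \<open>
  The power sums of the products \<open>(x\<^sub>i + t) (x\<^sub>j + t)\<close> over pairs \<open>i < j\<close> are polynomials in the power sums of the
  \<open>x\<^sub>i + t\<close>, since the sum over all pairs factors. By the Newton identities power sums and coefficients determine
  each other in characteristic 0. This replaces the fundamental theorem on symmetric polynomials.
\<close>

lemma pair_product_coeffs_in_subfield:
  fixes x :: "nat \<Rightarrow> 'a::field_char_0"
  assumes K: "field_subset K" and t: "t \<in> K"
    and coeffs: "\<And>n. coeff (\<Prod>i<d. [:- x i, 1:]) n \<in> K"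
  shows "coeff (\<Prod>(i, j)\<in>{(i, j). i < j \<and> j < d}. [:- ((x i + t) * (x j + t)), 1:]) n \<in> K"
proof -
  let ?I = "{(i, j). i < j \<and> j < d}"
  define y where "y i = x i + t" for i
  define w where "w = (\<lambda>(i, j). y i * y j)"
  have finI: "finite ?I" by (rule finite_subset[of _ "{..<d} \<times> {..<d}"]) auto
  have "coeff (reverse_root_product {..<d} x) n \<in> K" for n
    using coeffs coeffs_reverse_root_product_iff[of "{..<d}" K x] K by blast
  then have x: "(\<Sum>i<d. x i ^ m) \<in> K" for m
    by (intro power_sums_in_subfield[OF K]) auto
  have y: "(\<Sum>i<d. y i ^ m) \<in> K" for m
  proof -
    have "(\<Sum>i<d. y i ^ m) = (\<Sum>k\<le>m. of_nat (m choose k) * (\<Sum>i<d. x i ^ k) * t ^ (m - k))"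
      unfolding y_def binomial_ring by (subst sum.swap) (simp add: sum_distrib_left sum_distrib_right)
    also have "\<dots> \<in> K" by (intro field_subset_closed(10,5,9,8)[OF K] x t)
    finally show ?thesis .
  qed
  have w: "(\<Sum>p\<in>?I. w p ^ m) \<in> K" for m
  proof -
    let ?f = "\<lambda>p. w p ^ m"
    have "(\<Sum>i<d. y i ^ m)\<^sup>2 = (\<Sum>p\<in>{..<d} \<times> {..<d}. ?f p)"
      by (simp add: power2_eq_square sum_product sum.cartesian_product w_def power_mult_distrib case_prod_unfold)
    also have "{..<d} \<times> {..<d} = (?I \<union> prod.swap ` ?I) \<union> (\<lambda>i. (i, i)) ` {..<d}" by force
    also have "sum ?f \<dots> = sum ?f (?I \<union> prod.swap ` ?I) + sum ?f ((\<lambda>i. (i, i)) ` {..<d})"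
      using finI by (intro sum.union_disjoint) auto
    also have "sum ?f (?I \<union> prod.swap ` ?I) = sum ?f ?I + sum ?f (prod.swap ` ?I)"
      using finI by (intro sum.union_disjoint) auto
    also have "sum ?f (prod.swap ` ?I) = sum ?f ?I"
      by (subst sum.reindex) (auto simp: inj_on_def w_def mult.commute intro!: sum.cong)
    also have "sum ?f ((\<lambda>i. (i, i)) ` {..<d}) = (\<Sum>i<d. y i ^ (2 * m))"
      by (subst sum.reindex) (auto simp: inj_on_def w_def power_mult power2_eq_square intro!: sum.cong)
    finally have "sum ?f ?I = ((\<Sum>i<d. y i ^ m)\<^sup>2 - (\<Sum>i<d. y i ^ (2 * m))) / of_nat 2"
      by (simp add: field_simps)
    also have "\<dots> \<in> K" by (intro field_subset_closed(6,4,8,9)[OF K] y)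
    finally show ?thesis .
  qed
  have "coeff (reverse_root_product ?I w) n \<in> K" for n
    by (rule coeffs_in_subfield[OF K finI w])
  then have "coeff (\<Prod>p\<in>?I. [:- w p, 1:]) n \<in> K"
    using coeffs_reverse_root_product_iff[of ?I K w] K finI by blast
  moreover have "(\<Prod>p\<in>?I. [:- w p, 1:]) = (\<Prod>(i, j)\<in>?I. [:- ((x i + t) * (x j + t)), 1:])"
    by (intro prod.cong) (auto simp: w_def y_def)
  ultimately show ?thesis by simp
qed


section \<open>The field \<open>R[i]\<close> is algebraically closed\<close>

lemma real_part_of_base [simp]: "real_part (of_base a) = a"
  and imag_part_of_base [simp]: "imag_part (of_base a) = 0"
  by (simp_all add: of_base_def)

lemma idom_hom_of_base: "idom_hom of_base"
  by unfold_locales (simp_all add: adjoin_i_eq_iff)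

lemma of_base_eq_iff [simp]: "of_base a = of_base b \<longleftrightarrow> a = b"
  by (simp add: adjoin_i_eq_iff)

instance adjoin_i :: (linordered_field) field_char_0
proof
  have "(of_nat n :: 'a adjoin_i) = of_base (of_nat n)" for n
    by (induction n) (simp_all add: adjoin_i_eq_iff)
  then show "inj (of_nat :: nat \<Rightarrow> 'a adjoin_i)" by (auto intro: injI)
qed

definition conj_i :: "'r::linordered_field adjoin_i \<Rightarrow> 'r adjoin_i" where
  "conj_i z = Adjoin_i (real_part z) (- imag_part z)"

lemma real_part_conj_i [simp]: "real_part (conj_i z) = real_part z"
  and imag_part_conj_i [simp]: "imag_part (conj_i z) = - imag_part z"
  by (simp_all add: conj_i_def)

lemma idom_hom_conj_i: "idom_hom conj_i"
  by unfold_locales (simp_all add: adjoin_i_eq_iff)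

lemma conj_i_conj_i [simp]: "conj_i (conj_i z) = z"
  by (simp add: adjoin_i_eq_iff)

lemma conj_i_of_base [simp]: "conj_i (of_base a) = of_base a"
  by (simp add: adjoin_i_eq_iff)

lemma conj_i_eq_iff: "conj_i z = z \<longleftrightarrow> z \<in> range of_base"
proof
  assume "conj_i z = z"
  then have "imag_part z = 0" by (simp add: adjoin_i_eq_iff)
  then have "z = of_base (real_part z)" by (simp add: adjoin_i_eq_iff)
  then show "z \<in> range of_base" by blast
qed auto

lemma poly_map_poly_hom:
  assumes "idom_hom h"
  shows "poly (map_poly h p) (h z) = h (poly p z)"
proof -
  interpret idom_hom h by fact
  show ?thesis by (induction p) (simp_all add: map_poly_pCons hom_distribs)
qed

text \<open>
  For \<open>z = a + b i\<close> and \<open>r = |z|\<close>, the root is \<open>u + v i\<close> with \<open>u\<^sup>2 = (r + a) / 2\<close> and \<open>v\<^sup>2 = (r - a) / 2\<close>; the sign of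
  \<open>v\<close> is chosen to match that of \<open>b\<close>.
\<close>

lemma sqrt_in_adjoin_i:
  fixes z :: "'r::real_closed_field adjoin_i"
  shows "\<exists>w. w\<^sup>2 = z"
proof -
  define a b where "a = real_part z" and "b = imag_part z"
  have "0 \<le> a\<^sup>2 + b\<^sup>2" by simp
  then obtain s where s: "a\<^sup>2 + b\<^sup>2 = s\<^sup>2" using nonneg_is_square by blast
  define r where "r = \<bar>s\<bar>"
  have r: "r\<^sup>2 = a\<^sup>2 + b\<^sup>2" by (simp add: r_def s)
  have "\<bar>a\<bar> \<le> r"
    unfolding r_def using s by (metis abs_le_square_iff le_add_same_cancel1 zero_le_power2)
  then have "0 \<le> (r + a) / 2" "0 \<le> (r - a) / 2" by auto
  then obtain u v where u: "(r + a) / 2 = u\<^sup>2" and v: "(r - a) / 2 = v\<^sup>2"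
    using nonneg_is_square by metis
  have "(2 * u * v)\<^sup>2 = 4 * (u\<^sup>2 * v\<^sup>2)" by (simp add: power2_eq_square)
  also have "\<dots> = r\<^sup>2 - a\<^sup>2" unfolding u[symmetric] v[symmetric] by (simp add: power2_eq_square field_simps)
  also have "\<dots> = b\<^sup>2" using r by simp
  finally have "2 * u * v = b \<or> 2 * u * v = - b" by (simp add: power2_eq_iff)
  then obtain v' where v': "2 * u * v' = b" "v'\<^sup>2 = v\<^sup>2" by (metis mult_minus_right power2_minus minus_minus)
  have "u\<^sup>2 - v'\<^sup>2 = a" unfolding v'(2) u[symmetric] v[symmetric] by (simp add: field_simps)
  then have "(Adjoin_i u v')\<^sup>2 = z"
    using v'(1) by (simp add: adjoin_i_eq_iff power2_eq_square a_def b_def)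
  then show ?thesis by blast
qed

definition base_to_closure :: "'r::linordered_field \<Rightarrow> 'r adjoin_i alg_closure" where
  "base_to_closure a = to_ac (of_base a)"

lemma idom_hom_to_ac: "idom_hom to_ac"
  by unfold_locales simp_all

lemma idom_hom_base_to_closure: "idom_hom base_to_closure"
proof -
  interpret idom_hom of_base by (rule idom_hom_of_base)
  show ?thesis by unfold_locales (simp_all add: base_to_closure_def hom_distribs)
qed

lemma field_subset_range:
  assumes "h 1 = 1" and "\<And>a b. h (a - b) = h a - h b"
    and "\<And>a b. h (a * b) = h a * h b" and "\<And>a b. h (a / b) = h a / h b"
  shows "field_subset (range h)"
proof -
  have "1 \<in> range h" by (simp only: assms(1)[symmetric] rangeI)
  moreover have "h a - h b \<in> range h" "h a * h b \<in> range h" "h a / h b \<in> range h" for a b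
    by (simp_all only: assms[symmetric] rangeI)
  ultimately show ?thesis unfolding field_subset_def by blast
qed

lemma of_base_divide: "of_base (a / b) = of_base a / of_base b"
proof (cases "b = 0")
  case False
  then have "of_base (a / b) * of_base b = of_base a" "of_base b \<noteq> 0"
    by (simp_all add: adjoin_i_eq_iff)
  then show ?thesis by (simp add: nonzero_eq_divide_eq)
qed (simp add: adjoin_i_eq_iff divide_adjoin_i_def)

lemma field_subset_range_base_to_closure: "field_subset (range base_to_closure)"
proof -
  interpret idom_hom base_to_closure by (rule idom_hom_base_to_closure)
  show ?thesis
    by (rule field_subset_range) (simp_all add: hom_distribs, simp add: base_to_closure_def of_base_divide)
qed

lemma field_subset_range_to_ac: "field_subset (range to_ac)"
  by (rule field_subset_range) simp_all

lemma map_poly_preimage: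
  assumes "\<And>n. coeff P n \<in> range h" and "h 0 = 0" and "inj h"
  shows "\<exists>Q. P = map_poly h Q"
proof -
  have "inv_into UNIV h 0 = 0" using assms(2,3) by (intro inv_into_f_eq) auto
  then have "P = map_poly h (map_poly (inv_into UNIV h) P)"
    using assms by (intro poly_eqI) (simp add: coeff_map_poly f_inv_into_f)
  then show ?thesis by blast
qed

text \<open>
  The difference \<open>x - y\<close> is a square root of the discriminant, hence lies in \<open>C\<close> as well.
\<close>

lemma roots_in_range_to_ac:
  fixes x y :: "'r::real_closed_field adjoin_i alg_closure"
  assumes "x + y \<in> range to_ac" and "x * y \<in> range to_ac"
  shows "x \<in> range to_ac"
proof -
  obtain s q where s: "x + y = to_ac s" and q: "x * y = to_ac q" using assms by blast
  obtain d where d: "d\<^sup>2 = s\<^sup>2 - 4 * q" using sqrt_in_adjoin_i by blast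
  have "(x - y)\<^sup>2 = (x + y)\<^sup>2 - 4 * (x * y)" by (simp add: power2_eq_square algebra_simps)
  also have "\<dots> = (to_ac d)\<^sup>2" using arg_cong[OF d, of to_ac] by (simp add: s q)
  finally have "x - y = to_ac d \<or> x - y = - to_ac d" by (simp add: power2_eq_iff)
  moreover have "2 * x = (x + y) + (x - y)" by simp
  ultimately have "2 * x = to_ac (s + d) \<or> 2 * x = to_ac (s - d)"
    unfolding s by auto
  moreover have "x = to_ac (c / 2)" if "2 * x = to_ac c" for c
  proof -
    have "to_ac (c / 2) = 2 * x / 2" by (simp add: that)
    then show ?thesis by simp
  qed
  ultimately show ?thesis by blast
qed

lemma alg_closed_splits:
  fixes P :: "'a::alg_closed_field poly"
  assumes "lead_coeff P = 1"
  shows "\<exists>x. P = (\<Prod>i<degree P. [:- x i, 1:])"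
proof -
  have "P \<noteq> 0" using assms by auto
  then obtain A where A: "size A = degree P" "P = smult (lead_coeff P) (\<Prod>x\<in>#A. [:- x, 1:])"
    using alg_closed_imp_factorization by blast
  obtain xs where xs: "mset xs = A" using ex_mset by blast
  have "(\<Prod>i<length xs. [:- (xs ! i), 1:]) = (\<Prod>x\<leftarrow>xs. [:- x, 1:])"
    by (simp add: prod.list_conv_set_nth atLeast0LessThan)
  also have "\<dots> = (\<Prod>x\<in>#A. [:- x, 1:])"
    unfolding xs[symmetric] by (simp add: prod_mset_prod_list flip: mset_map)
  also have "\<dots> = P" using A(2) assms by simp
  finally have "P = (\<Prod>i<degree P. [:- (xs ! i), 1:])"
    using A(1) xs by (metis size_mset)
  then show ?thesis by blast
qed

lemma card_strict_pairs: "2 * card {(i, j). i < j \<and> j < (d::nat)} = d * (d - 1)"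
proof (induction d)
  case (Suc d)
  have "{(i, j). i < j \<and> j < Suc d} = {(i, j). i < j \<and> j < d} \<union> (\<lambda>i. (i, d)) ` {..<d}"
    by (auto simp: less_Suc_eq)
  moreover have "finite {(i, j). i < j \<and> j < d}"
    by (rule finite_subset[of _ "{..<d} \<times> {..<d}"]) auto
  moreover have "{(i, j). i < j \<and> j < d} \<inter> (\<lambda>i. (i, d)) ` {..<d} = {}" by auto
  moreover have "card ((\<lambda>i. (i, d)) ` {..<d}) = d" by (simp add: card_image inj_on_def)
  ultimately have "card {(i, j). i < j \<and> j < Suc d} = card {(i, j). i < j \<and> j < d} + d"
    using card_Un_disjoint[of "{(i, j). i < j \<and> j < d}" "(\<lambda>i. (i, d)) ` {..<d}"] by simp
  moreover have "d * (d - 1) + 2 * d = Suc d * (Suc d - 1)" by (cases d) simp_all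
  ultimately show ?case using Suc.IH by linarith
qed simp

text \<open>
  Laplace's proof, by induction on the exponent of 2 in the degree \<open>d\<close>. Let \<open>x\<^sub>1, \<dots>, x\<^sub>d\<close> be the roots in an
  algebraic closure of \<open>C\<close>. For every \<open>t\<close> in \<open>R\<close> the polynomial with roots \<open>(x\<^sub>i + t) (x\<^sub>j + t)\<close>, \<open>i < j\<close>, has
  coefficients in \<open>R\<close>, and its degree \<open>d (d - 1) / 2\<close> contains one factor 2 less; so one of its roots lies in \<open>C\<close>.
  There are infinitely many \<open>t\<close> and finitely many pairs, hence the same pair serves two values of \<open>t\<close>. Then
  \<open>x\<^sub>i + x\<^sub>j\<close> and \<open>x\<^sub>i x\<^sub>j\<close> lie in \<open>C\<close>, which contains square roots, and so does \<open>x\<^sub>i\<close>.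
\<close>

lemma real_closed_poly_has_root:
  fixes P :: "'r::real_closed_field poly"
  assumes "lead_coeff P = 1" and "degree P = 2 ^ k * m" and "odd m"
  shows "\<exists>z. poly (map_poly of_base P) z = 0"
  using assms
proof (induction k arbitrary: P m)
  case 0
  have "\<exists>x. (\<Sum>k\<le>degree P. coeff P k * x ^ k) = 0"
    using 0 by (intro odd_degree_has_root) auto
  then obtain x where "poly P x = 0" by (auto simp: poly_altdef)
  then have "poly (map_poly of_base P) (of_base x) = 0"
    by (simp add: poly_map_poly_hom[OF idom_hom_of_base] adjoin_i_eq_iff)
  then show ?case by blast
next
  case (Suc k)
  let ?\<iota> = "base_to_closure :: 'r \<Rightarrow> _" and ?d = "degree P"
  let ?I = "{(i, j). i < j \<and> j < ?d}"
  interpret \<iota>: idom_hom ?\<iota> by (rule idom_hom_base_to_closure)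
  interpret ac: idom_hom "to_ac :: 'r adjoin_i \<Rightarrow> _" by (rule idom_hom_to_ac)
  have split: "poly (map_poly ?\<iota> G) (to_ac z) = to_ac (poly (map_poly of_base G) z)" for G z
  proof -
    have "map_poly ?\<iota> G = map_poly to_ac (map_poly of_base G)"
      by (rule poly_eqI) (simp add: coeff_map_poly base_to_closure_def adjoin_i_eq_iff)
    then show ?thesis by (simp add: poly_map_poly_hom[OF idom_hom_to_ac])
  qed
  have inj: "inj ?\<iota>" by (auto intro!: injI simp: base_to_closure_def)
  have "degree (map_poly ?\<iota> P) = ?d" "lead_coeff (map_poly ?\<iota> P) = 1"
    using map_poly_monic[OF Suc.prems(1), of ?\<iota>] by auto
  then obtain x where x: "map_poly ?\<iota> P = (\<Prod>i<?d. [:- x i, 1:])"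
    using alg_closed_splits[of "map_poly ?\<iota> P"] by auto
  have coeffs: "coeff (\<Prod>i<?d. [:- x i, 1:]) n \<in> range ?\<iota>" for n
    unfolding x[symmetric] by (simp add: coeff_map_poly)
  have finI: "finite ?I" by (rule finite_subset[of _ "{..<?d} \<times> {..<?d}"]) auto
  have "2 * card ?I = ?d * (?d - 1)" by (rule card_strict_pairs)
  also have "\<dots> = 2 * (2 ^ k * (m * (?d - 1)))"
    by (simp add: Suc.prems(2))
  finally have cardI: "card ?I = 2 ^ k * (m * (?d - 1))" by (simp only: mult_cancel_left) simp
  have "even ?d" "0 < ?d" using Suc.prems(2,3) by (auto intro: odd_pos)
  then have "odd (?d - 1)" by simp
  then have odd: "odd (m * (?d - 1))" using Suc.prems(3) by simp
  have "\<exists>p\<in>?I. (x (fst p) + ?\<iota> t) * (x (snd p) + ?\<iota> t) \<in> range to_ac" for t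
  proof -
    define w where "w = (\<lambda>p. (x (fst p) + ?\<iota> t) * (x (snd p) + ?\<iota> t))"
    have prod: "(\<Prod>(i, j)\<in>?I. [:- ((x i + ?\<iota> t) * (x j + ?\<iota> t)), 1:]) = (\<Prod>p\<in>?I. [:- w p, 1:])"
      by (intro prod.cong) (auto simp: w_def)
    have "coeff (\<Prod>p\<in>?I. [:- w p, 1:]) n \<in> range ?\<iota>" for n
      unfolding prod[symmetric]
      by (rule pair_product_coeffs_in_subfield[OF field_subset_range_base_to_closure _ coeffs]) simp
    then obtain G where G: "(\<Prod>p\<in>?I. [:- w p, 1:]) = map_poly ?\<iota> G"
      using map_poly_preimage[OF _ \<iota>.hom_zero inj] by blast
    have degG: "degree G = card ?I"
      using monic_prod_linear(1)[OF finI, of w] inj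
      unfolding G by (subst (asm) degree_map_poly) (auto simp: base_to_closure_def adjoin_i_eq_iff)
    have "?\<iota> (lead_coeff G) = 1"
      using monic_prod_linear(2)[OF finI, of w] monic_prod_linear(1)[OF finI, of w]
      unfolding G by (simp add: coeff_map_poly degG)
    then have "lead_coeff G = 1" using inj \<iota>.hom_one by (metis injD)
    then obtain z where z: "poly (map_poly of_base G) z = 0"
      using Suc.IH[of G "m * (?d - 1)"] degG cardI odd by auto
    then have "poly (\<Prod>p\<in>?I. [:- w p, 1:]) (to_ac z) = 0" unfolding G split by simp
    then have "\<exists>p\<in>?I. to_ac z = w p"
      using finI by (simp add: poly_prod)
    then obtain p where p: "p \<in> ?I" "to_ac z = w p" by (elim bexE)
    have "w p \<in> range to_ac" by (simp only: p(2)[symmetric] rangeI)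
    then show ?thesis using p(1) by (intro bexI[of _ p]) (simp_all only: w_def)
  qed
  then have "\<forall>t. \<exists>p. p \<in> ?I \<and> (x (fst p) + ?\<iota> t) * (x (snd p) + ?\<iota> t) \<in> range to_ac"
    by (simp only: Bex_def) blast
  from choice[OF this] obtain f where f': "\<forall>t. f t \<in> ?I \<and>
      (x (fst (f t)) + ?\<iota> t) * (x (snd (f t)) + ?\<iota> t) \<in> range to_ac" by (elim exE)
  then have f: "f t \<in> ?I" "(x (fst (f t)) + ?\<iota> t) * (x (snd (f t)) + ?\<iota> t) \<in> range to_ac" for t
    by (simp_all only: simp_thms)
  have "\<not> inj f"
  proof
    assume "inj f"
    then have "finite (UNIV :: 'r set)"
      using f(1) finI by (intro inj_on_finite[of f UNIV ?I]) (auto simp only: image_subset_iff)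
    then show False using infinite_UNIV_char_0 by blast
  qed
  then obtain t u where tu: "t \<noteq> u" "f t = f u" by (auto simp: inj_def)
  define a b where "a = x (fst (f t))" and "b = x (snd (f t))"
  note K = field_subset_range_to_ac
  have \<iota>: "?\<iota> r \<in> range to_ac" for r by (simp add: base_to_closure_def)
  have "(a + ?\<iota> t) * (b + ?\<iota> t) \<in> range to_ac" "(a + ?\<iota> u) * (b + ?\<iota> u) \<in> range to_ac"
    using f(2)[of t] f(2)[of u] tu by (simp_all add: a_def b_def)
  then have ab: "a * b + ?\<iota> t * (a + b) \<in> range to_ac" "a * b + ?\<iota> u * (a + b) \<in> range to_ac"
    using field_subset_closed(4)[OF K _ field_subset_closed(5)[OF K \<iota> \<iota>], of "(a + ?\<iota> t) * (b + ?\<iota> t)" t t]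
      field_subset_closed(4)[OF K _ field_subset_closed(5)[OF K \<iota> \<iota>], of "(a + ?\<iota> u) * (b + ?\<iota> u)" u u]
    by (simp_all add: algebra_simps)
  have ne: "?\<iota> t - ?\<iota> u \<noteq> 0" using tu inj by (auto dest: injD)
  have "a + b = ((a * b + ?\<iota> t * (a + b)) - (a * b + ?\<iota> u * (a + b))) / (?\<iota> t - ?\<iota> u)"
    using ne by (simp add: field_simps)
  then have sum: "a + b \<in> range to_ac"
    using field_subset_closed(6)[OF K field_subset_closed(4)[OF K ab] field_subset_closed(4)[OF K \<iota> \<iota>], of t u]
    by simp
  have "a * b = (a * b + ?\<iota> t * (a + b)) - ?\<iota> t * (a + b)" by simp
  then have "a * b \<in> range to_ac"
    using field_subset_closed(4)[OF K ab(1) field_subset_closed(5)[OF K \<iota> sum]] by metis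
  then obtain z where z: "a = to_ac z"
    using roots_in_range_to_ac[OF sum] by blast
  have "fst (f t) < ?d" using f(1)[of t] by auto
  then have "poly (map_poly ?\<iota> P) a = 0"
    unfolding x by (auto simp: poly_prod a_def)
  then have "poly (map_poly of_base P) z = 0" unfolding z split by simp
  then show ?case by blast
qed

lemma power_two_odd_decomposition:
  assumes "0 < (n::nat)"
  shows "\<exists>k m. n = 2 ^ k * m \<and> odd m"
  using assms
proof (induction n rule: less_induct)
  case (less n)
  show ?case
  proof (cases "odd n")
    case True
    then show ?thesis by (intro exI[of _ 0] exI[of _ n]) simp
  next
    case False
    then have "even n" by simp
    then obtain n' where n': "n = 2 * n'" by (rule evenE)
    then obtain k m where "n' = 2 ^ k * m" "odd m" using less.IH[of n'] less.prems by auto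
    then show ?thesis unfolding n' by (intro exI[of _ "Suc k"] exI[of _ m]) (simp add: \<open>n' = 2 ^ k * m\<close> \<open>odd m\<close>)
  qed
qed

instance adjoin_i :: (real_closed_field) alg_closed_field
proof
  fix p :: "'a adjoin_i poly"
  assume deg: "degree p > 0" and monic: "lead_coeff p = 1"
  interpret c: idom_hom "conj_i :: 'a adjoin_i \<Rightarrow> _" by (rule idom_hom_conj_i)
  interpret mc: map_poly_idom_hom "conj_i :: 'a adjoin_i \<Rightarrow> _" ..
  \<comment> \<open>The product with the conjugate polynomial has coefficients in \<open>R\<close>.\<close>
  define q where "q = p * map_poly conj_i p"
  have "map_poly conj_i (map_poly conj_i p) = p"
    by (rule poly_eqI) (simp add: coeff_map_poly)
  then have "map_poly conj_i q = q" by (simp add: q_def mc.hom_mult mult.commute)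
  then have "coeff q n \<in> range of_base" for n
    using conj_i_eq_iff by (metis coeff_map_poly c.hom_zero)
  then obtain Q where Q: "q = map_poly of_base Q"
    using map_poly_preimage[of q of_base] by (auto simp: inj_def adjoin_i_eq_iff)
  have conj: "degree (map_poly conj_i p) = degree p" "lead_coeff (map_poly conj_i p) = 1"
    using map_poly_monic[of p conj_i, OF monic] by auto
  then have "p \<noteq> 0" "map_poly conj_i p \<noteq> 0" using deg by (metis degree_0 less_numeral_extra(3))+
  then have "degree q = 2 * degree p" unfolding q_def by (simp add: degree_mult_eq conj(1))
  moreover have "lead_coeff q = 1" unfolding q_def by (simp only: lead_coeff_mult monic conj(2) mult_1)
  moreover have "degree Q = degree q" unfolding Q by (intro degree_map_poly[symmetric]) (simp add: adjoin_i_eq_iff)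
  ultimately have degQ: "degree Q = 2 * degree p" and "of_base (lead_coeff Q) = 1"
    unfolding Q by (simp_all add: coeff_map_poly adjoin_i_eq_iff)
  then have lcQ: "lead_coeff Q = 1" by (simp add: adjoin_i_eq_iff)
  have "\<exists>k m. degree Q = 2 ^ k * m \<and> odd m"
    using degQ deg by (intro power_two_odd_decomposition) simp
  then obtain z where "poly q z = 0"
    using real_closed_poly_has_root[OF lcQ] unfolding Q by blast
  then have "poly p z = 0 \<or> poly (map_poly conj_i p) z = 0" by (simp add: q_def)
  moreover have "poly p (conj_i z) = 0" if "poly (map_poly conj_i p) z = 0"
    using poly_map_poly_hom[OF idom_hom_conj_i, of p "conj_i z"] that by (metis conj_i_conj_i c.hom_zero)
  ultimately show "\<exists>x. poly p x = 0" by blast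
qed


section \<open>Diagonalisation of the Hermite form\<close>

lemma interpolation:
  fixes h :: "'a::field \<Rightarrow> 'a"
  assumes "finite Z"
  shows "\<exists>L. (\<forall>n\<ge>card Z. coeff L n = 0) \<and> (\<forall>z\<in>Z. poly L z = h z)"
  using assms
proof (induction Z rule: finite_induct)
  case empty
  show ?case by (intro exI[of _ 0]) simp
next
  case (insert w Z)
  then obtain L where L: "\<forall>n\<ge>card Z. coeff L n = 0" "\<forall>z\<in>Z. poly L z = h z" by blast
  define N where "N = (\<Prod>z\<in>Z. [:- z, 1:])"
  have "degree N = card Z" unfolding N_def by (rule monic_prod_linear[OF insert.hyps(1)])
  moreover have "poly N w \<noteq> 0" "\<forall>z\<in>Z. poly N z = 0"
    using insert.hyps by (auto simp: N_def poly_prod)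
  ultimately show ?case
    using L insert.hyps
    by (intro exI[of _ "L + smult ((h w - poly L w) / poly N w) N"]) (auto simp: coeff_eq_0)
qed

definition real_poly_at :: "nat \<Rightarrow> (nat \<Rightarrow> 'r::linordered_field) \<Rightarrow> 'r adjoin_i \<Rightarrow> 'r adjoin_i" where
  "real_poly_at p v z = (\<Sum>i<p. of_base (v i) * z ^ i)"

text \<open>
  If the prescribed values are compatible with conjugation, averaging an interpolating polynomial with its
  conjugate gives one with real coefficients.
\<close>

lemma real_interpolation:
  fixes h :: "'r::linordered_field adjoin_i \<Rightarrow> 'r adjoin_i"
  assumes "finite Z" and "card Z \<le> p" and conj: "\<And>z. z \<in> Z \<Longrightarrow> conj_i z \<in> Z"
    and h: "\<And>z. z \<in> Z \<Longrightarrow> h (conj_i z) = conj_i (h z)"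
  shows "\<exists>v. \<forall>z\<in>Z. real_poly_at p v z = h z"
proof -
  interpret idom_hom "conj_i :: 'r adjoin_i \<Rightarrow> _" by (rule idom_hom_conj_i)
  obtain L where L: "\<forall>n\<ge>card Z. coeff L n = 0" "\<forall>z\<in>Z. poly L z = h z"
    using interpolation[OF assms(1), of h] by blast
  have polyL: "poly L z = (\<Sum>i<p. coeff L i * z ^ i)" for z
  proof -
    have "(\<Sum>i\<le>degree L. coeff L i * z ^ i) = (\<Sum>i\<in>{..degree L} \<union> {..<p}. coeff L i * z ^ i)"
      by (intro sum.mono_neutral_left) (auto simp: coeff_eq_0)
    also have "\<dots> = (\<Sum>i<p. coeff L i * z ^ i)"
      using L(1) assms(2) by (intro sum.mono_neutral_right) auto
    finally show ?thesis by (simp add: poly_altdef)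
  qed
  have re: "2 * of_base (real_part c) = c + conj_i c" for c :: "'r adjoin_i"
    unfolding mult_2 adjoin_i_eq_iff plus_adjoin_i.sel by simp
  define v where "v i = real_part (coeff L i)" for i
  have "real_poly_at p v z = h z" if z: "z \<in> Z" for z
  proof -
    have "2 * real_poly_at p v z = (\<Sum>i<p. (coeff L i + conj_i (coeff L i)) * z ^ i)"
      unfolding real_poly_at_def v_def sum_distrib_left re[symmetric] by (simp add: mult.assoc)
    also have "\<dots> = poly L z + conj_i (poly L (conj_i z))"
      unfolding polyL by (simp add: hom_sum hom_mult hom_power sum.distrib distrib_right)
    also have "\<dots> = 2 * h z" using L(2) conj[OF z] h[OF z] z by simp
    finally show ?thesis by simp
  qed
  then show ?thesis by blast
qed

lemma real_poly_at_conj_i: "real_poly_at p v (conj_i z) = conj_i (real_poly_at p v z)"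
proof -
  interpret idom_hom "conj_i :: 'a adjoin_i \<Rightarrow> _" by (rule idom_hom_conj_i)
  show ?thesis by (simp add: real_poly_at_def hom_sum hom_mult hom_power)
qed

lemma real_part_sum: "real_part (sum f A) = (\<Sum>x\<in>A. real_part (f x))"
  and imag_part_sum: "imag_part (sum f A) = (\<Sum>x\<in>A. imag_part (f x))"
  by (induction A rule: infinite_finite_induct) simp_all

lemma poly_adjoin_i_of_base: "poly_adjoin_i Q (of_base x) = of_base (poly Q x)"
  unfolding poly_adjoin_i_def by (rule poly_map_poly_hom[OF idom_hom_of_base])

lemma poly_adjoin_i_conj_i: "poly_adjoin_i Q (conj_i z) = conj_i (poly_adjoin_i Q z)"
proof -
  have "map_poly conj_i (map_poly of_base Q) = map_poly of_base Q"
    by (rule poly_eqI) (simp add: coeff_map_poly adjoin_i_eq_iff)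
  then show ?thesis
    unfolding poly_adjoin_i_def using poly_map_poly_hom[OF idom_hom_conj_i, of "map_poly of_base Q" z] by simp
qed

lemma poly_adjoin_i_hom:
  "poly_adjoin_i (P * Q) z = poly_adjoin_i P z * poly_adjoin_i Q z"
  "poly_adjoin_i (monom 1 n) z = z ^ n"
  "poly_adjoin_i (prod f I) z = (\<Prod>i\<in>I. poly_adjoin_i (f i) z)"
  "poly_adjoin_i (P ^ n) z = poly_adjoin_i P z ^ n"
proof -
  interpret b: idom_hom of_base by (rule idom_hom_of_base)
  interpret mb: map_poly_idom_hom of_base ..
  show "poly_adjoin_i (P * Q) z = poly_adjoin_i P z * poly_adjoin_i Q z"
    "poly_adjoin_i (monom 1 n) z = z ^ n"
    "poly_adjoin_i (prod f I) z = (\<Prod>i\<in>I. poly_adjoin_i (f i) z)"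
    "poly_adjoin_i (P ^ n) z = poly_adjoin_i P z ^ n"
    by (simp_all add: poly_adjoin_i_def mb.hom_mult mb.hom_prod mb.hom_power poly_prod map_poly_monom poly_monom)
qed

definition upper_part :: "'r::linordered_field adjoin_i set \<Rightarrow> 'r adjoin_i set" where
  "upper_part Z = {z\<in>Z. imag_part z > 0}"

text \<open>
  A set closed under conjugation consists of its real points and of pairs of conjugate points, each represented
  by the one in the upper half plane.
\<close>

lemma sum_real_part_conj_closed:
  fixes f :: "'r::linordered_field adjoin_i \<Rightarrow> 'r"
  assumes "finite Z" and conj: "\<And>z. z \<in> Z \<Longrightarrow> conj_i z \<in> Z"
  shows "(\<Sum>z\<in>Z. f z) = (\<Sum>x\<in>base_part Z. f (of_base x)) + (\<Sum>z\<in>upper_part Z. f z + f (conj_i z))"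
proof -
  have "z \<in> conj_i ` upper_part Z" if "z \<in> Z" "imag_part z < 0" for z
    using that conj by (intro image_eqI[of _ _ "conj_i z"]) (auto simp: upper_part_def)
  moreover have "z \<in> of_base ` base_part Z" if "z \<in> Z" "imag_part z = 0" for z
  proof -
    have "z = of_base (real_part z)" using that by (simp add: adjoin_i_eq_iff)
    then show ?thesis using that by (metis base_part_def imageI mem_Collect_eq)
  qed
  ultimately have Z: "Z = of_base ` base_part Z \<union> (upper_part Z \<union> conj_i ` upper_part Z)"
    using conj by (auto simp: base_part_def upper_part_def) (metis linorder_neqE)
  have fin: "finite (base_part Z)" "finite (upper_part Z)"
    using assms(1) by (auto simp: upper_part_def base_part_def intro!: finite_vimageI[unfolded vimage_def] injI)
  have "sum f Z = sum f (of_base ` base_part Z \<union> (upper_part Z \<union> conj_i ` upper_part Z))"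
    using Z by simp
  also have "\<dots> = sum f (of_base ` base_part Z) + sum f (upper_part Z \<union> conj_i ` upper_part Z)"
    using fin by (intro sum.union_disjoint) (auto simp: upper_part_def adjoin_i_eq_iff)
  also have "sum f (upper_part Z \<union> conj_i ` upper_part Z) = sum f (upper_part Z) + sum f (conj_i ` upper_part Z)"
    using fin by (intro sum.union_disjoint) (auto simp: upper_part_def)
  also have "sum f (conj_i ` upper_part Z) = (\<Sum>z\<in>upper_part Z. f (conj_i z))"
    by (subst sum.reindex) (auto simp: inj_on_def adjoin_i_eq_iff)
  also have "sum f (of_base ` base_part Z) = (\<Sum>x\<in>base_part Z. f (of_base x))"
    by (subst sum.reindex) (auto simp: inj_on_def)
  finally show ?thesis by (simp add: sum.distrib)
qed

text \<open>
  The entries of \<open>Her P Q\<close>, without the bounds of the matrix.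
\<close>

definition hermite_entry :: "'r::linordered_field poly \<Rightarrow> 'r poly \<Rightarrow> nat \<Rightarrow> nat \<Rightarrow> 'r" where
  "hermite_entry P Q i j = mult_trace P (Q * monom 1 (i + j))"

lemma hermite_form_eq:
  fixes P Q :: "'r::linordered_field poly"
  assumes monic: "lead_coeff P = 1" and x: "map_poly of_base P = (\<Prod>i<p. [:- x i, 1:])"
  shows "of_base (quadratic_form {..<p} (hermite_entry P Q) v) =
    (\<Sum>k<p. poly_adjoin_i Q (x k) * (real_poly_at p v (x k))\<^sup>2)"
proof -
  interpret b: idom_hom "of_base :: 'r \<Rightarrow> _" by (rule idom_hom_of_base)
  have entry: "of_base (hermite_entry P Q i j) = (\<Sum>k<p. poly_adjoin_i Q (x k) * (x k ^ i * x k ^ j))" for i j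
  proof -
    have "of_base (hermite_entry P Q i j) = (\<Sum>k<p. poly (map_poly of_base (Q * monom 1 (i + j))) (x k))"
      unfolding hermite_entry_def hom_mult_trace[OF idom_hom_of_base monic]
      by (rule mult_trace_root_product[OF x])
    also have "\<dots> = (\<Sum>k<p. poly_adjoin_i (Q * monom 1 (i + j)) (x k))"
      by (simp add: poly_adjoin_i_def)
    finally show ?thesis by (simp add: poly_adjoin_i_hom power_add)
  qed
  have "of_base (quadratic_form {..<p} (hermite_entry P Q) v) =
      (\<Sum>i<p. \<Sum>j<p. \<Sum>k<p. poly_adjoin_i Q (x k) * ((of_base (v i) * x k ^ i) * (of_base (v j) * x k ^ j)))"
    by (simp add: quadratic_form_def b.hom_sum b.hom_mult entry sum_distrib_right sum_distrib_left mult_ac)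
  also have "\<dots> = (\<Sum>i<p. \<Sum>k<p. \<Sum>j<p. poly_adjoin_i Q (x k) * ((of_base (v i) * x k ^ i) * (of_base (v j) * x k ^ j)))"
    by (intro sum.cong refl sum.swap)
  also have "\<dots> = (\<Sum>k<p. \<Sum>i<p. \<Sum>j<p. poly_adjoin_i Q (x k) * ((of_base (v i) * x k ^ i) * (of_base (v j) * x k ^ j)))"
    by (rule sum.swap)
  also have "\<dots> = (\<Sum>k<p. poly_adjoin_i Q (x k) * (real_poly_at p v (x k))\<^sup>2)"
    unfolding real_poly_at_def power2_eq_square sum_product unfolding sum_distrib_left ..
  finally show ?thesis .
qed

text \<open>
  Let \<open>V\<close> be the polynomial with coefficient vector \<open>v\<close>. The Hermite form is the sum of
  \<open>\<mu>(z) Re (Q(z) V(z)\<^sup>2)\<close> over the distinct roots \<open>z\<close>. Real roots give the squares of the evaluations \<open>V(x)\<close>.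
  Conjugate roots have the same real part in their terms; together they give \<open>Re ((g V(z))\<^sup>2)\<close>, where \<open>g\<close> is a
  square root of a positive multiple of \<open>Q(z)\<close>, and this is the difference of the squares of the
  real and the imaginary part of \<open>g V(z)\<close>. These linear forms are independent because the values of a real
  polynomial of degree less than \<open>p\<close> can be prescribed at all roots, compatibly with conjugation.
\<close>

theorem hermite_form_diagonalises:
  fixes P Q :: "'r::real_closed_field poly"
  assumes monic: "lead_coeff P = 1"
  defines "Z \<equiv> zero_set P"
  shows "finite Z" and "card Z \<le> degree P" and "\<And>z. z \<in> Z \<Longrightarrow> conj_i z \<in> Z"
    and "\<exists>(J :: ('r + 'r adjoin_i \<times> bool) set) c l e.
      diagonalises {..<degree P} (hermite_entry P Q) J c l e \<and>
      card {j\<in>J. c j > 0} = card {x\<in>base_part Z. poly Q x > 0} + card {z\<in>upper_part Z. poly_adjoin_i Q z \<noteq> 0} \<and>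
      card {j\<in>J. c j < 0} = card {x\<in>base_part Z. poly Q x < 0} + card {z\<in>upper_part Z. poly_adjoin_i Q z \<noteq> 0}"
proof -
  interpret b: idom_hom "of_base :: 'r \<Rightarrow> _" by (rule idom_hom_of_base)
  interpret cj: idom_hom "conj_i :: 'r adjoin_i \<Rightarrow> _" by (rule idom_hom_conj_i)
  let ?p = "degree P"
  obtain x where x: "map_poly of_base P = (\<Prod>i<?p. [:- x i, 1:])"
    using alg_closed_splits[of "map_poly of_base P"] map_poly_monic[OF monic, of of_base] by auto
  have Zx: "Z = x ` {..<?p}"
    by (auto simp: Z_def zero_set_def poly_adjoin_i_def x poly_prod)
  show finZ: "finite Z" by (simp add: Zx)
  show cardZ: "card Z \<le> ?p" using card_image_le[of "{..<?p}" x] by (simp add: Zx)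
  show conjZ: "conj_i z \<in> Z" if "z \<in> Z" for z
    using that by (simp add: Z_def zero_set_def poly_adjoin_i_conj_i)
  have fin: "finite (base_part Z)" "finite (upper_part Z)"
    using finZ by (auto simp: upper_part_def base_part_def intro!: finite_vimageI[unfolded vimage_def] injI)

  define \<mu> where "\<mu> z = card {i\<in>{..<?p}. x i = z}" for z
  have \<mu>: "\<mu> z > 0" if "z \<in> Z" for z
    using that by (auto simp: \<mu>_def Zx card_gt_0_iff)
  \<comment> \<open>The terms of \<open>z\<close> and of its conjugate are collected, so their multiplicities add up.\<close>
  define M where "M z = (of_nat (\<mu> z + \<mu> (conj_i z)) :: 'r)" for z
  have M: "M z > 0" if "z \<in> Z" for z using \<mu>[OF that] unfolding M_def by (simp only: of_nat_0_less_iff)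
  define g where "g z = (SOME w. w\<^sup>2 = of_base (M z) * poly_adjoin_i Q z)" for z
  have g: "(g z)\<^sup>2 = of_base (M z) * poly_adjoin_i Q z" for z
    unfolding g_def by (rule someI_ex) (rule sqrt_in_adjoin_i)
  have g0: "g z \<noteq> 0" if "z \<in> Z" "poly_adjoin_i Q z \<noteq> 0" for z
  proof
    assume "g z = 0"
    then have "of_base (M z) = 0" using g[of z] that(2) by simp
    then show False using M[OF that(1)] by (simp add: adjoin_i_eq_iff)
  qed

  define A where "A = {x\<in>base_part Z. poly Q x \<noteq> 0}"
  define B where "B = {z\<in>upper_part Z. poly_adjoin_i Q z \<noteq> 0}"
  have finAB: "finite A" "finite B" using fin by (simp_all add: A_def B_def)
  define J :: "('r + 'r adjoin_i \<times> bool) set" where "J = Inl ` A \<union> Inr ` (B \<times> UNIV)"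
  define c :: "'r + 'r adjoin_i \<times> bool \<Rightarrow> 'r" where "c = case_sum (\<lambda>x. of_nat (\<mu> (of_base x)) * poly Q x) (\<lambda>(z, s). if s then 1 else - 1 :: 'r)"
  define l where "l = case_sum (\<lambda>x i. x ^ i)
    (\<lambda>(z, s) i. if s then real_part (g z * z ^ i) else imag_part (g z * z ^ i))"
  have l_base: "linear_form {..<?p} (l (Inl x)) v = real_part (real_poly_at ?p v (of_base x))" for x v
    by (simp add: linear_form_def l_def real_poly_at_def real_part_sum b.hom_power[symmetric] mult.commute)
  have l_upper: "linear_form {..<?p} (l (Inr (z, s))) v =
      (if s then real_part (g z * real_poly_at ?p v z) else imag_part (g z * real_poly_at ?p v z))" for z s v
    by (simp add: linear_form_def l_def real_poly_at_def real_part_sum imag_part_sum sum_distrib_left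
        algebra_simps)
  have real_at: "real_poly_at ?p v (of_base x) = of_base (real_part (real_poly_at ?p v (of_base x)))" for v x
    using real_poly_at_conj_i[of ?p v "of_base x"] by (simp add: adjoin_i_eq_iff)

  have form: "quadratic_form {..<?p} (hermite_entry P Q) v = (\<Sum>j\<in>J. c j * (linear_form {..<?p} (l j) v)\<^sup>2)" for v
  proof -
    define f where "f z = real_part (poly_adjoin_i Q z * (real_poly_at ?p v z)\<^sup>2)" for z
    have fconj: "f (conj_i z) = f z" for z
    proof -
      have "poly_adjoin_i Q (conj_i z) * (real_poly_at ?p v (conj_i z))\<^sup>2 =
          conj_i (poly_adjoin_i Q z * (real_poly_at ?p v z)\<^sup>2)"
        by (simp add: poly_adjoin_i_conj_i real_poly_at_conj_i cj.hom_mult cj.hom_power)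
      then show ?thesis by (simp add: f_def)
    qed
    have "quadratic_form {..<?p} (hermite_entry P Q) v = (\<Sum>k<?p. f (x k))"
      using arg_cong[OF hermite_form_eq[OF monic x, of Q v], of real_part]
      by (simp add: f_def real_part_sum)
    also have "\<dots> = (\<Sum>z\<in>Z. \<Sum>k\<in>{k\<in>{..<?p}. x k = z}. f (x k))"
      unfolding Zx by (rule sum.image_gen) simp
    also have "\<dots> = (\<Sum>z\<in>Z. of_nat (\<mu> z) * f z)"
      by (intro sum.cong) (auto simp: \<mu>_def)
    also have "\<dots> = (\<Sum>x\<in>base_part Z. of_nat (\<mu> (of_base x)) * f (of_base x)) + (\<Sum>z\<in>upper_part Z. M z * f z)"
      by (subst sum_real_part_conj_closed[OF finZ conjZ]) (auto simp: M_def fconj distrib_right)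
    also have "(\<Sum>x\<in>base_part Z. of_nat (\<mu> (of_base x)) * f (of_base x)) =
        (\<Sum>x\<in>A. c (Inl x) * (linear_form {..<?p} (l (Inl x)) v)\<^sup>2)"
    proof (rule sum.mono_neutral_cong_right[OF fin(1)])
      have f: "f (of_base x) = poly Q x * (real_part (real_poly_at ?p v (of_base x)))\<^sup>2" for x
        unfolding f_def by (subst real_at) (simp add: poly_adjoin_i_of_base b.hom_mult[symmetric] b.hom_power[symmetric])
      show "\<forall>x\<in>base_part Z - A. of_nat (\<mu> (of_base x)) * f (of_base x) = 0"
        by (simp add: A_def f)
      show "of_nat (\<mu> (of_base x)) * f (of_base x) = c (Inl x) * (linear_form {..<?p} (l (Inl x)) v)\<^sup>2" for x
        by (simp add: f l_base c_def)
    qed (simp add: A_def)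
    also have "(\<Sum>z\<in>upper_part Z. M z * f z) =
        (\<Sum>z\<in>B. \<Sum>s\<in>UNIV. c (Inr (z, s)) * (linear_form {..<?p} (l (Inr (z, s))) v)\<^sup>2)"
    proof (rule sum.mono_neutral_cong_right[OF fin(2)])
      show "\<forall>z\<in>upper_part Z - B. M z * f z = 0" by (simp add: B_def f_def)
      show "M z * f z = (\<Sum>s\<in>UNIV. c (Inr (z, s)) * (linear_form {..<?p} (l (Inr (z, s))) v)\<^sup>2)" for z
      proof -
        have "M z * f z = real_part ((g z * real_poly_at ?p v z)\<^sup>2)"
          unfolding power_mult_distrib g f_def by (simp add: mult.assoc)
        then show ?thesis
          by (simp add: UNIV_bool c_def l_upper power2_eq_square)
      qed
    qed (simp add: B_def)
    also have "(\<Sum>x\<in>A. c (Inl x) * (linear_form {..<?p} (l (Inl x)) v)\<^sup>2) +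
        (\<Sum>z\<in>B. \<Sum>s\<in>UNIV. c (Inr (z, s)) * (linear_form {..<?p} (l (Inr (z, s))) v)\<^sup>2) =
        (\<Sum>j\<in>J. c j * (linear_form {..<?p} (l j) v)\<^sup>2)"
      unfolding J_def using finAB
      by (subst sum.union_disjoint) (auto simp: sum.reindex sum.cartesian_product case_prod_unfold)
    finally show ?thesis .
  qed

  have "\<exists>v. \<forall>j\<in>J. linear_form {..<?p} (l j) v = (if j = k then 1 else 0)" if k: "k \<in> J" for k
  proof -
    \<comment> \<open>The dual vector takes the value \<open>\<beta>\<close> at \<open>w\<close>, the conjugate value at the conjugate of \<open>w\<close>, and 0 at all other
      roots. For \<open>g \<beta> = 1\<close> the real part of \<open>g V(w)\<close> is 1 and the imaginary part 0; for \<open>g \<beta> = i\<close> it is the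
      other way round.\<close>
    obtain w \<beta> where w: "w \<in> Z" and \<beta>: "conj_i w = w \<longrightarrow> conj_i \<beta> = \<beta>"
      and k_base: "\<And>y. k = Inl y \<Longrightarrow> w = of_base y \<and> \<beta> = 1"
      and k_upper: "\<And>z s. k = Inr (z, s) \<Longrightarrow> w = z \<and> g z * \<beta> = (if s then 1 else Adjoin_i 0 1)"
    proof (cases k)
      case (Inl y)
      then have "of_base y \<in> Z" using k by (auto simp: J_def A_def base_part_def)
      then show ?thesis by (rule that[of "of_base y" 1]) (simp_all add: Inl)
    next
      case (Inr q)
      obtain z s where q: "q = (z, s)" by force
      have "z \<in> upper_part Z" "poly_adjoin_i Q z \<noteq> 0" using k Inr q by (auto simp: J_def B_def)
      then have z: "z \<in> Z" "imag_part z > 0" "g z \<noteq> 0" using g0[of z] by (auto simp: upper_part_def)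
      then have "conj_i z \<noteq> z" by (simp add: adjoin_i_eq_iff)
      with z(1,3) show ?thesis
        by (intro that[of z "(if s then 1 else Adjoin_i 0 1) / g z"]) (simp_all add: Inr q)
    qed
    define h where "h z = (if z = w then \<beta> else if z = conj_i w then conj_i \<beta> else 0)" for z
    have h: "h (conj_i z) = conj_i (h z)" for z
    proof -
      have "conj_i z = w \<longleftrightarrow> z = conj_i w" "conj_i z = conj_i w \<longleftrightarrow> z = w"
        by (metis conj_i_conj_i)+
      then show ?thesis using \<beta> unfolding h_def by auto
    qed
    have "\<exists>v. \<forall>z\<in>Z. real_poly_at ?p v z = h z"
      by (rule real_interpolation[OF finZ cardZ]) (simp_all add: conjZ h)
    then obtain v where v: "\<forall>z\<in>Z. real_poly_at ?p v z = h z" by (elim exE)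
    have "linear_form {..<?p} (l j) v = (if j = k then 1 else 0)" if j: "j \<in> J" for j
    proof (cases j)
      case (Inl y)
      then have "of_base y \<in> Z" using j by (auto simp: J_def A_def base_part_def)
      then have lj: "linear_form {..<?p} (l j) v = real_part (h (of_base y))"
        using v by (simp add: Inl l_base)
      show ?thesis
      proof (cases k)
        case k: (Inl y')
        then show ?thesis using k_base[OF k] Inl lj by (auto simp: h_def)
      next
        case k: (Inr q)
        obtain z s where q: "q = (z, s)" by force
        have "imag_part z > 0" using \<open>k \<in> J\<close> k q by (auto simp: J_def B_def upper_part_def)
        then have "of_base y \<noteq> w" "of_base y \<noteq> conj_i w"
          using k_upper[of z s] k q by (auto simp: adjoin_i_eq_iff)
        then show ?thesis using Inl k lj by (simp add: h_def)
      qed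
    next
      case (Inr q)
      obtain z s where q: "q = (z, s)" by force
      have z: "z \<in> Z" "imag_part z > 0" using j Inr q by (auto simp: J_def B_def upper_part_def)
      then have lj: "linear_form {..<?p} (l j) v =
          (if s then real_part (g z * h z) else imag_part (g z * h z))"
        using v by (simp add: Inr q l_upper)
      show ?thesis
      proof (cases k)
        case k: (Inl y')
        then have "z \<noteq> w" "z \<noteq> conj_i w" using k_base[OF k] z by (auto simp: adjoin_i_eq_iff)
        then show ?thesis using Inr k lj by (simp add: h_def)
      next
        case k: (Inr q')
        obtain z' s' where q': "q' = (z', s')" by force
        have z': "imag_part z' > 0" using \<open>k \<in> J\<close> k q' by (auto simp: J_def B_def upper_part_def)
        have w: "w = z'" "g z' * \<beta> = (if s' then 1 else Adjoin_i 0 1)" using k_upper[of z' s'] k q' by auto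
        have "z \<noteq> conj_i w" using w z' z by (auto simp: adjoin_i_eq_iff)
        then have gh: "g z * h z = (if z = z' then (if s' then 1 else Adjoin_i 0 1) else 0)"
          using w by (auto simp: h_def)
        show ?thesis unfolding lj gh by (auto simp: Inr k q q')
      qed
    qed
    then show ?thesis by blast
  qed
  then have "\<forall>k. \<exists>v. k \<in> J \<longrightarrow> (\<forall>j\<in>J. linear_form {..<?p} (l j) v = (if j = k then 1 else 0))" by blast
  from choice[OF this] obtain e where
    e: "\<forall>k. k \<in> J \<longrightarrow> (\<forall>j\<in>J. linear_form {..<?p} (l j) (e k) = (if j = k then 1 else 0))" by blast
  have "finite J" using finAB by (simp add: J_def)
  then have diag: "diagonalises {..<?p} (hermite_entry P Q) J c l e"
    using form e by (simp add: diagonalises_def)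

  have c_base: "c (Inl x) > 0 \<longleftrightarrow> poly Q x > 0" "c (Inl x) < 0 \<longleftrightarrow> poly Q x < 0"
    if "x \<in> base_part Z" for x
    using \<mu>[of "of_base x"] that
    by (simp_all add: c_def base_part_def zero_less_mult_iff mult_less_0_iff)
  have c_upper: "c (Inr (z, s)) = (if s then 1 else - 1)" for z s by (simp add: c_def)
  have card_sum: "card (Inl ` S \<union> Inr ` (B \<times> {s})) = card S + card B"
    if "finite S" for S :: "'r set" and s :: bool
    using that finAB by (subst card_Un_disjoint) (auto simp: card_image card_cartesian_product)
  have "{j\<in>J. c j > 0} = Inl ` {x\<in>base_part Z. poly Q x > 0} \<union> Inr ` (B \<times> {True})"
  proof (rule Set.set_eqI)
    fix j show "j \<in> {j\<in>J. c j > 0} \<longleftrightarrow>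
      j \<in> Inl ` {x\<in>base_part Z. poly Q x > 0} \<union> Inr ` (B \<times> {True})"
      by (cases j) (auto simp: J_def A_def c_base c_upper split: if_splits)
  qed
  then have pos: "card {j\<in>J. c j > 0} = card {x\<in>base_part Z. poly Q x > 0} + card B"
    using fin by (simp add: card_sum)
  have "{j\<in>J. c j < 0} = Inl ` {x\<in>base_part Z. poly Q x < 0} \<union> Inr ` (B \<times> {False})"
  proof (rule Set.set_eqI)
    fix j show "j \<in> {j\<in>J. c j < 0} \<longleftrightarrow>
      j \<in> Inl ` {x\<in>base_part Z. poly Q x < 0} \<union> Inr ` (B \<times> {False})"
      by (cases j) (auto simp: J_def A_def c_base c_upper split: if_splits)
  qed
  then have neg: "card {j\<in>J. c j < 0} = card {x\<in>base_part Z. poly Q x < 0} + card B"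
    using fin by (simp add: card_sum)
  show "\<exists>(J :: ('r + 'r adjoin_i \<times> bool) set) c l e.
      diagonalises {..<degree P} (hermite_entry P Q) J c l e \<and>
      card {j\<in>J. c j > 0} = card {x\<in>base_part Z. poly Q x > 0} + card {z\<in>upper_part Z. poly_adjoin_i Q z \<noteq> 0} \<and>
      card {j\<in>J. c j < 0} = card {x\<in>base_part Z. poly Q x < 0} + card {z\<in>upper_part Z. poly_adjoin_i Q z \<noteq> 0}"
    using diag pos neg unfolding B_def by (intro exI conjI)
qed


section \<open>Counting roots by Hermite minors\<close>

lemma sum_sgn:
  fixes f :: "'a \<Rightarrow> 'r::linordered_field"
  assumes "finite A"
  shows "(\<Sum>x\<in>A. sgn (f x)) = of_nat (card {x\<in>A. f x > 0}) - of_nat (card {x\<in>A. f x < 0})"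
proof -
  have "sgn t = (if t > 0 then 1 else 0) - (if t < 0 then 1 else 0)" for t :: 'r
    by (simp add: sgn_if)
  then have "(\<Sum>x\<in>A. sgn (f x)) = (\<Sum>x\<in>A. if f x > 0 then 1 else 0) - (\<Sum>x\<in>A. if f x < 0 then 1 else 0)"
    by (simp add: sum_subtractf)
  then show ?thesis using assms by (simp add: sum.If_cases Int_def)
qed

text \<open>
  A real polynomial vanishes at both points of a conjugate pair or at none.
\<close>

lemma sum_invertibility_nonbase_part:
  fixes Q :: "'r::linordered_field poly"
  assumes fin: "finite Z" and conj: "\<And>z. z \<in> Z \<Longrightarrow> conj_i z \<in> Z"
  shows "(\<Sum>z\<in>nonbase_part Z. of_nat (invertibility (poly_adjoin_i Q z))) =
    (2 * of_nat (card {z\<in>upper_part Z. poly_adjoin_i Q z \<noteq> 0}) :: 'r)"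
proof -
  define f :: "'r adjoin_i \<Rightarrow> 'r" where
    "f z = (if z \<in> range of_base then 0 else of_nat (invertibility (poly_adjoin_i Q z)))" for z
  have "(\<Sum>z\<in>nonbase_part Z. of_nat (invertibility (poly_adjoin_i Q z))) = (\<Sum>z\<in>Z. f z)"
    using fin by (intro sum.mono_neutral_cong_left) (auto simp: nonbase_part_def f_def)
  also have "\<dots> = (\<Sum>x\<in>base_part Z. f (of_base x)) + (\<Sum>z\<in>upper_part Z. f z + f (conj_i z))"
    by (rule sum_real_part_conj_closed[OF fin conj])
  also have "\<dots> = (\<Sum>z\<in>upper_part Z. if poly_adjoin_i Q z \<noteq> 0 then 2 else 0)"
  proof -
    have "f z + f (conj_i z) = (if poly_adjoin_i Q z \<noteq> 0 then 2 else 0)" if "z \<in> upper_part Z" for z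
    proof -
      have "z \<notin> range of_base" "conj_i z \<notin> range of_base"
        using that by (auto simp: upper_part_def adjoin_i_eq_iff)
      moreover have "conj_i w = 0 \<longleftrightarrow> w = 0" for w :: "'r adjoin_i"
        by (simp add: adjoin_i_eq_iff)
      ultimately show ?thesis by (simp add: f_def poly_adjoin_i_conj_i invertibility_def)
    qed
    then show ?thesis by (simp add: f_def)
  qed
  also have "\<dots> = 2 * of_nat (card {z\<in>upper_part Z. poly_adjoin_i Q z \<noteq> 0})"
    using fin by (simp add: sum.If_cases upper_part_def Int_def)
  finally show ?thesis .
qed

text \<open>
  The diagonalisation over the roots and the one found by elimination have the same inertia.
\<close>

lemma hermite_minor_signs_determine_counts:
  fixes P P' Q Q' :: "'r::real_closed_field poly"
  assumes monic: "lead_coeff P = 1" "lead_coeff P' = 1" and deg: "degree P' = degree P"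
    and minors: "\<And>xs. distinct xs \<Longrightarrow> set xs \<subseteq> {..<degree P} \<Longrightarrow>
      sgn (list_minor (hermite_entry P Q) xs) = sgn (list_minor (hermite_entry P' Q') xs)"
  defines "Z \<equiv> zero_set P" and "Z' \<equiv> zero_set P'"
  shows "card {x\<in>base_part Z. poly Q x > 0} + card {z\<in>upper_part Z. poly_adjoin_i Q z \<noteq> 0} =
      card {x\<in>base_part Z'. poly Q' x > 0} + card {z\<in>upper_part Z'. poly_adjoin_i Q' z \<noteq> 0}" (is ?pos)
    and "card {x\<in>base_part Z. poly Q x < 0} + card {z\<in>upper_part Z. poly_adjoin_i Q z \<noteq> 0} =
      card {x\<in>base_part Z'. poly Q' x < 0} + card {z\<in>upper_part Z'. poly_adjoin_i Q' z \<noteq> 0}" (is ?neg)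
proof -
  have sym: "hermite_entry P Q i j = hermite_entry P Q j i" for P Q :: "'r poly" and i j
    by (simp add: hermite_entry_def add.commute)
  obtain J :: "nat set" and c l e c' l' e' where
    d: "diagonalises {..<degree P} (hermite_entry P Q) J c l e"
    and d': "diagonalises {..<degree P} (hermite_entry P' Q') J c' l' e'"
    and sgn: "\<forall>j\<in>J. sgn (c j) = sgn (c' j)"
    using minor_signs_determine_inertia[of "{..<degree P}" "hermite_entry P Q" "hermite_entry P' Q'",
        OF _ sym sym minors] by auto
  have "{j\<in>J. c j > 0} = {j\<in>J. c' j > 0}" "{j\<in>J. c j < 0} = {j\<in>J. c' j < 0}"
    using sgn by (metis sgn_greater sgn_less)+
  moreover obtain K :: "('r + 'r adjoin_i \<times> bool) set" and k m f where
    h: "diagonalises {..<degree P} (hermite_entry P Q) K k m f"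
      "card {j\<in>K. k j > 0} = card {x\<in>base_part Z. poly Q x > 0} + card {z\<in>upper_part Z. poly_adjoin_i Q z \<noteq> 0}"
      "card {j\<in>K. k j < 0} = card {x\<in>base_part Z. poly Q x < 0} + card {z\<in>upper_part Z. poly_adjoin_i Q z \<noteq> 0}"
    using hermite_form_diagonalises(4)[OF monic(1), of Q] unfolding Z_def by (elim exE conjE)
  moreover obtain K' :: "('r + 'r adjoin_i \<times> bool) set" and k' m' f' where
    h': "diagonalises {..<degree P} (hermite_entry P' Q') K' k' m' f'"
      "card {j\<in>K'. k' j > 0} = card {x\<in>base_part Z'. poly Q' x > 0} + card {z\<in>upper_part Z'. poly_adjoin_i Q' z \<noteq> 0}"
      "card {j\<in>K'. k' j < 0} = card {x\<in>base_part Z'. poly Q' x < 0} + card {z\<in>upper_part Z'. poly_adjoin_i Q' z \<noteq> 0}"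
    using hermite_form_diagonalises(4)[OF monic(2), of Q'] unfolding Z'_def deg by (elim exE conjE)
  ultimately show ?pos ?neg
    using inertia_unique[OF d h(1)] inertia_unique[OF d' h'(1)] by simp_all
qed

lemma poly_prod_power: "poly (\<Prod>j<s. f j ^ \<alpha> j) x = (\<Prod>j<s. poly (f j) x ^ \<alpha> j)"
  by (simp add: poly_prod)

lemma sgn_prod_power:
  fixes f :: "nat \<Rightarrow> 'r::linordered_field"
  shows "sgn (\<Prod>j<s. f j ^ \<alpha> j) = (\<Prod>j<s. sgn (f j) ^ \<alpha> j)"
proof -
  have "sgn (a ^ n) = sgn a ^ n" for a :: 'r and n by (induction n) (simp_all add: sgn_mult)
  then show ?thesis by (induction s) (simp_all add: sgn_mult)
qed

lemma invertibility_prod_power: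
  fixes f :: "nat \<Rightarrow> 'a::field"
  shows "of_nat (invertibility (\<Prod>j<s. f j ^ \<alpha> j)) = (\<Prod>j<s. of_nat (invertibility (f j)) ^ \<alpha> j :: 'r::linordered_field)"
proof -
  have "of_nat (invertibility (a ^ n)) = (of_nat (invertibility a) ^ n :: 'r)" for a :: 'a and n
    by (simp add: invertibility_def)
  moreover have "invertibility (a * b) = invertibility a * invertibility b" for a b :: 'a
    by (simp add: invertibility_def)
  moreover have "invertibility (1 :: 'a) = 1" by (simp add: invertibility_def)
  ultimately show ?thesis by (induction s) simp_all
qed

text \<open>
  The difference of the two equations of
  \<open>hermite_minor_signs_determine_counts\<close> gives the sums of the signs over the real roots. For the nonreal
  roots, exponents are replaced by even ones, which changes neither the number of nonzero exponents nor the zeros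
  of the product; it is then nonnegative on \<open>R\<close>, and only conjugate pairs are left in the equation for the
  negative squares.
\<close>

theorem hermite_minor_signs_determine_all_counts:
  fixes P P' :: "'r::real_closed_field poly" and Qs Qs' :: "'r poly list"
  assumes monic: "lead_coeff P = 1" "lead_coeff P' = 1" and deg: "degree P' = degree P"
    and len: "length Qs' = length Qs"
    and minors: "\<And>\<alpha> xs. \<forall>j. \<alpha> j \<in> {0, 1, 2} \<Longrightarrow>
      card {j. j < length Qs \<and> \<alpha> j \<noteq> 0} \<le> floorlog 2 (degree P) \<Longrightarrow>
      distinct xs \<Longrightarrow> set xs \<subseteq> {..<degree P} \<Longrightarrow>
      sgn (list_minor (hermite_entry P (\<Prod>j<length Qs. (Qs ! j) ^ \<alpha> j)) xs) =
      sgn (list_minor (hermite_entry P' (\<Prod>j<length Qs. (Qs' ! j) ^ \<alpha> j)) xs)"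
  defines "Z \<equiv> zero_set P" and "Z' \<equiv> zero_set P'"
  shows "count_sign Qs (base_part Z) = count_sign Qs' (base_part Z')"
    and "count_inv Qs (nonbase_part Z) = count_inv Qs' (nonbase_part Z')"
proof -
  let ?s = "length Qs" and ?p = "degree P"
  have Z: "finite Z" "card Z \<le> ?p" "\<And>z. z \<in> Z \<Longrightarrow> conj_i z \<in> Z"
    unfolding Z_def by (rule hermite_form_diagonalises(1-3)[OF monic(1)]; assumption?)+
  have Z': "finite Z'" "card Z' \<le> ?p" "\<And>z. z \<in> Z' \<Longrightarrow> conj_i z \<in> Z'"
    unfolding Z'_def deg[symmetric] by (rule hermite_form_diagonalises(1-3)[OF monic(2)]; assumption?)+
  have base: "finite (base_part W)" "card (base_part W) \<le> ?p" if "finite W" "card W \<le> ?p" for W :: "'r adjoin_i set"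
  proof -
    have "of_base ` base_part W \<subseteq> W" by (auto simp: base_part_def)
    moreover have inj: "inj_on of_base (base_part W)" by (simp add: inj_on_def)
    ultimately show "finite (base_part W)" using that(1) by (metis finite_imageD finite_subset)
    have "card (base_part W) \<le> card W"
      by (rule card_inj_on_le[OF inj]) (use that in \<open>auto simp: base_part_def\<close>)
    then show "card (base_part W) \<le> ?p" using that(2) by simp
  qed
  have nonbase: "finite (nonbase_part W)" "card (nonbase_part W) \<le> ?p"
    if "finite W" "card W \<le> ?p" for W :: "'r adjoin_i set"
    using that card_mono[of W "nonbase_part W"] by (auto simp: nonbase_part_def)
  define F where "F \<alpha> = (\<Prod>j<?s. (Qs ! j) ^ \<alpha> j)" for \<alpha>
  define F' where "F' \<alpha> = (\<Prod>j<?s. (Qs' ! j) ^ \<alpha> j)" for \<alpha>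
  show "count_sign Qs (base_part Z) = count_sign Qs' (base_part Z')"
  proof
    fix \<rho> :: "nat \<Rightarrow> 'r"
    have "card {x\<in>base_part Z. \<forall>j<?s. sgn (poly (Qs ! j) x) = \<rho> j} =
        card {x\<in>base_part Z'. \<forall>j<?s. sgn (poly (Qs' ! j) x) = \<rho> j}"
    proof (rule sparse_monomials_determine_sign_counts[OF base(1)[OF Z(1,2)] base(1)[OF Z'(1,2)]
          base(2)[OF Z(1,2)] base(2)[OF Z'(1,2)]])
      fix \<alpha> :: "nat \<Rightarrow> nat"
      assume \<alpha>: "\<forall>j. \<alpha> j \<in> {0, 1, 2}" "card {j. j < ?s \<and> \<alpha> j \<noteq> 0} \<le> floorlog 2 ?p"
      have eq: "card {x\<in>base_part Z. poly (F \<alpha>) x > 0} + card {z\<in>upper_part Z. poly_adjoin_i (F \<alpha>) z \<noteq> 0} =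
          card {x\<in>base_part Z'. poly (F' \<alpha>) x > 0} + card {z\<in>upper_part Z'. poly_adjoin_i (F' \<alpha>) z \<noteq> 0}"
        "card {x\<in>base_part Z. poly (F \<alpha>) x < 0} + card {z\<in>upper_part Z. poly_adjoin_i (F \<alpha>) z \<noteq> 0} =
          card {x\<in>base_part Z'. poly (F' \<alpha>) x < 0} + card {z\<in>upper_part Z'. poly_adjoin_i (F' \<alpha>) z \<noteq> 0}"
        unfolding Z_def Z'_def F_def F'_def
        by (rule hermite_minor_signs_determine_counts[OF monic deg minors[OF \<alpha>]]; assumption)+
      have "(\<Sum>x\<in>base_part Z. sgn (poly (F \<alpha>) x)) = (\<Sum>x\<in>base_part Z'. sgn (poly (F' \<alpha>) x))"
        unfolding sum_sgn[OF base(1)[OF Z(1,2)]] sum_sgn[OF base(1)[OF Z'(1,2)]]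
        using arg_cong[OF eq(1), of "of_nat :: nat \<Rightarrow> 'r"] arg_cong[OF eq(2), of "of_nat :: nat \<Rightarrow> 'r"]
        by simp
      then show "(\<Sum>x\<in>base_part Z. \<Prod>j<?s. sgn (poly (Qs ! j) x) ^ \<alpha> j) =
          (\<Sum>x\<in>base_part Z'. \<Prod>j<?s. sgn (poly (Qs' ! j) x) ^ \<alpha> j)"
        by (simp add: F_def F'_def poly_prod_power sgn_prod_power)
    qed (auto simp: sgn_if)
    then show "count_sign Qs (base_part Z) \<rho> = count_sign Qs' (base_part Z') \<rho>"
      by (simp add: count_sign_def len)
  qed
  show "count_inv Qs (nonbase_part Z) = count_inv Qs' (nonbase_part Z')"
  proof
    fix \<sigma> :: "nat \<Rightarrow> nat"
    let ?v = "\<lambda>Qs z j. of_nat (invertibility (poly_adjoin_i (Qs ! j) z)) :: 'r"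
    have "card {z\<in>nonbase_part Z. \<forall>j<?s. ?v Qs z j = of_nat (\<sigma> j)} =
        card {z\<in>nonbase_part Z'. \<forall>j<?s. ?v Qs' z j = of_nat (\<sigma> j)}"
    proof (rule sparse_monomials_determine_sign_counts[OF nonbase(1)[OF Z(1,2)] nonbase(1)[OF Z'(1,2)]
          nonbase(2)[OF Z(1,2)] nonbase(2)[OF Z'(1,2)]])
      fix \<alpha> :: "nat \<Rightarrow> nat"
      assume \<alpha>: "\<forall>j. \<alpha> j \<in> {0, 1, 2}" "card {j. j < ?s \<and> \<alpha> j \<noteq> 0} \<le> floorlog 2 ?p"
      \<comment> \<open>Even exponents with the same support.\<close>
      define \<beta> where "\<beta> j = (if \<alpha> j = 0 then 0 else 2 :: nat)" for j
      have \<beta>: "\<forall>j. \<beta> j \<in> {0, 1, 2}" "card {j. j < ?s \<and> \<beta> j \<noteq> 0} \<le> floorlog 2 ?p"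
      proof -
        have "\<beta> j \<noteq> 0 \<longleftrightarrow> \<alpha> j \<noteq> 0" for j by (simp add: \<beta>_def)
        then show "card {j. j < ?s \<and> \<beta> j \<noteq> 0} \<le> floorlog 2 ?p" using \<alpha>(2) by (simp only:)
      qed (simp add: \<beta>_def)
      have "card {x\<in>base_part Z. poly (F \<beta>) x < 0} + card {z\<in>upper_part Z. poly_adjoin_i (F \<beta>) z \<noteq> 0} =
          card {x\<in>base_part Z'. poly (F' \<beta>) x < 0} + card {z\<in>upper_part Z'. poly_adjoin_i (F' \<beta>) z \<noteq> 0}"
        unfolding Z_def Z'_def F_def F'_def
        by (rule hermite_minor_signs_determine_counts(2)[OF monic deg minors[OF \<beta>]])
      moreover have nonneg: "\<not> poly (\<Prod>j<?s. f j ^ \<beta> j) x < 0" for f :: "nat \<Rightarrow> 'r poly" and x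
        unfolding poly_prod_power not_less by (intro prod_nonneg) (simp add: \<beta>_def)
      ultimately have "card {z\<in>upper_part Z. poly_adjoin_i (F \<beta>) z \<noteq> 0} =
          card {z\<in>upper_part Z'. poly_adjoin_i (F' \<beta>) z \<noteq> 0}"
        by (simp add: F_def F'_def)
      then have sums: "(\<Sum>z\<in>nonbase_part Z. of_nat (invertibility (poly_adjoin_i (F \<beta>) z))) =
          (\<Sum>z\<in>nonbase_part Z'. of_nat (invertibility (poly_adjoin_i (F' \<beta>) z)) :: 'r)"
        by (simp add: sum_invertibility_nonbase_part Z Z')
      have power: "?v Qs z j ^ \<beta> j = ?v Qs z j ^ \<alpha> j" for Qs :: "'r poly list" and z j
        by (simp add: \<beta>_def invertibility_def)
      show "(\<Sum>z\<in>nonbase_part Z. \<Prod>j<?s. ?v Qs z j ^ \<alpha> j) =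
          (\<Sum>z\<in>nonbase_part Z'. \<Prod>j<?s. ?v Qs' z j ^ \<alpha> j)"
        using sums by (simp add: F_def F'_def poly_adjoin_i_hom invertibility_prod_power power)
    qed (auto simp: invertibility_def)
    then show "count_inv Qs (nonbase_part Z) \<sigma> = count_inv Qs' (nonbase_part Z') \<sigma>"
      by (simp add: count_inv_def len)
  qed
qed


section \<open>Specialization of the parameters\<close>

definition monomial_eval :: "(nat \<Rightarrow> 'r::comm_ring_1) \<Rightarrow> (nat \<Rightarrow>\<^sub>0 nat) \<Rightarrow> 'r" where
  "monomial_eval y e = (\<Prod>v\<in>Poly_Mapping.keys e. y v ^ Poly_Mapping.lookup e v)"

lemma monomial_eval_superset:
  assumes "finite V" and "Poly_Mapping.keys e \<subseteq> V"
  shows "monomial_eval y e = (\<Prod>v\<in>V. y v ^ Poly_Mapping.lookup e v)"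
  unfolding monomial_eval_def using assms by (intro prod.mono_neutral_left) (auto simp: in_keys_iff)

lemma monomial_eval_add: "monomial_eval y (e + f) = monomial_eval y e * monomial_eval y f"
proof -
  let ?V = "Poly_Mapping.keys e \<union> Poly_Mapping.keys f"
  have "Poly_Mapping.keys (e + f) \<subseteq> ?V" by (rule keys_add)
  then show ?thesis
    by (simp add: monomial_eval_superset[of ?V] lookup_add power_add prod.distrib)
qed

lemma mpoly_eval_superset:
  assumes "\<phi> 0 = 0" and "finite E" and "Poly_Mapping.keys F \<subseteq> E"
  shows "mpoly_eval \<phi> y F = (\<Sum>e\<in>E. \<phi> (Poly_Mapping.lookup F e) * monomial_eval y e)"
  unfolding mpoly_eval_def monomial_eval_def[symmetric] using assms
  by (intro sum.mono_neutral_left) (auto simp: in_keys_iff)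

lemma poly_mapping_eq_sum_single:
  "(\<Sum>e\<in>Poly_Mapping.keys F. Poly_Mapping.single e (Poly_Mapping.lookup F e)) = F"
  by (rule poly_mapping_eqI) (auto simp: lookup_sum lookup_single when_def in_keys_iff)

text \<open>
  Both sides of the multiplicativity are sums over pairs of monomials once the factors are written as sums of
  single terms.
\<close>

lemma idom_hom_mpoly_eval:
  fixes \<phi> :: "'k::linordered_field \<Rightarrow> 'r::linordered_field"
  assumes "field_hom \<phi>"
  shows "idom_hom (mpoly_eval \<phi> y)"
proof -
  interpret field_hom \<phi> by fact
  note sup = mpoly_eval_superset[of \<phi>, OF hom_zero]
  have add: "mpoly_eval \<phi> y (F + G) = mpoly_eval \<phi> y F + mpoly_eval \<phi> y G" for F G
  proof -
    let ?E = "Poly_Mapping.keys F \<union> Poly_Mapping.keys G"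
    have "Poly_Mapping.keys (F + G) \<subseteq> ?E" by (rule keys_add)
    then show ?thesis
      by (simp add: sup[of ?E] lookup_add hom_add distrib_right sum.distrib)
  qed
  have zero: "mpoly_eval \<phi> y 0 = 0" by (simp add: mpoly_eval_def)
  have sum: "mpoly_eval \<phi> y (sum f I) = (\<Sum>i\<in>I. mpoly_eval \<phi> y (f i))" for f :: "'a \<Rightarrow> 'k mpoly" and I
    by (induction I rule: infinite_finite_induct) (simp_all add: zero add)
  have single: "mpoly_eval \<phi> y (Poly_Mapping.single e c) = \<phi> c * monomial_eval y e" for e c
    by (subst sup[of "{e}"]) auto
  have mult: "mpoly_eval \<phi> y (F * G) = mpoly_eval \<phi> y F * mpoly_eval \<phi> y G" for F G
  proof -
    let ?s = "\<lambda>F e. Poly_Mapping.single e (Poly_Mapping.lookup F e)"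
    have "F * G = (\<Sum>e\<in>Poly_Mapping.keys F. \<Sum>f\<in>Poly_Mapping.keys G. ?s F e * ?s G f)"
      by (simp add: sum_product[symmetric] poly_mapping_eq_sum_single)
    then have "mpoly_eval \<phi> y (F * G) = (\<Sum>e\<in>Poly_Mapping.keys F. \<Sum>f\<in>Poly_Mapping.keys G.
        (\<phi> (Poly_Mapping.lookup F e) * monomial_eval y e) * (\<phi> (Poly_Mapping.lookup G f) * monomial_eval y f))"
      by (simp add: sum mult_single single hom_mult monomial_eval_add mult_ac)
    also have "\<dots> = mpoly_eval \<phi> y F * mpoly_eval \<phi> y G"
      by (simp add: sum_product[symmetric] mpoly_eval_def monomial_eval_def)
    finally show ?thesis .
  qed
  have one: "mpoly_eval \<phi> y 1 = 1"
    by (simp add: mpoly_eval_def)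
  show ?thesis by unfold_locales (simp_all add: zero one add mult)
qed

text \<open>
  A submatrix lists its indices in increasing order, an arrangement of the given list.
\<close>

lemma list_minor_eq_det_submatrix:
  assumes "A \<in> carrier_mat n n" and "distinct xs" and "set xs \<subseteq> {..<n}"
  shows "list_minor (\<lambda>i j. A $$ (i, j)) xs = det (submatrix A (set xs) (set xs))"
proof -
  let ?I = "set xs"
  define ys where "ys = map (pick ?I) [0..<card ?I]"
  have "inj_on (pick ?I) {0..<card ?I}"
    by (rule inj_onI) (metis atLeastLessThan_iff nat_neq_iff pick_mono_le)
  then have dist: "distinct ys" by (simp add: ys_def distinct_map)
  have "set ys \<subseteq> ?I" by (auto simp: ys_def pick_in_set_le)
  moreover have "card (set ys) = card ?I" using distinct_card[OF dist] by (simp add: ys_def)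
  ultimately have "set ys = ?I" by (intro card_subset_eq) auto
  then have "mset xs = mset ys" using assms(2) dist set_eq_iff_mset_eq_distinct by metis
  then have "list_minor (\<lambda>i j. A $$ (i, j)) xs = list_minor (\<lambda>i j. A $$ (i, j)) ys"
    by (rule list_minor_permute)
  also have "\<dots> = det (submatrix A ?I ?I)"
  proof -
    have "{i. i < n \<and> i \<in> ?I} = ?I" using assms(3) by auto
    then have "submatrix A ?I ?I = mat (card ?I) (card ?I) (\<lambda>(i, j). A $$ (pick ?I i, pick ?I j))"
      using assms(1) by (simp add: submatrix_def)
    moreover have "\<dots> = mat (length ys) (length ys) (\<lambda>(i, j). A $$ (ys ! i, ys ! j))"
      by (rule eq_matI) (auto simp: ys_def)
    ultimately show ?thesis by (simp add: list_minor_def)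
  qed
  finally show ?thesis .
qed

lemma map_mat_submatrix:
  assumes "A \<in> carrier_mat n n" and "I \<subseteq> {..<n}"
  shows "map_mat h (submatrix A I I) = submatrix (map_mat h A) I I"
proof (rule eq_matI)
  have I: "{i. i < n \<and> i \<in> I} = I" using assms(2) by auto
  have "pick I i < n" if "i < card I" for i using pick_in_set_le[OF that] assms(2) by auto
  then show "map_mat h (submatrix A I I) $$ (i, j) = submatrix (map_mat h A) I I $$ (i, j)"
    if "i < dim_row (submatrix (map_mat h A) I I)" "j < dim_col (submatrix (map_mat h A) I I)" for i j
    using that assms(1) I by (simp add: submatrix_def)
qed (use assms(1) in \<open>simp_all add: submatrix_def\<close>)

lemma list_minor_cong:
  assumes "\<And>i j. i \<in> set xs \<Longrightarrow> j \<in> set xs \<Longrightarrow> a i j = b i j"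
  shows "list_minor a xs = list_minor b xs"
  unfolding list_minor_def by (intro arg_cong[of _ _ det] eq_matI) (auto intro: assms)

text \<open>
  Determinants, submatrices and the traces in the Hermite matrix all commute with the homomorphism, because a
  monic polynomial keeps its degree.
\<close>

lemma hom_hermite_minor:
  fixes h :: "'a::idom \<Rightarrow> 'r::linordered_field"
  assumes h: "idom_hom h" and monic: "lead_coeff P = 1"
    and xs: "distinct xs" "set xs \<subseteq> {..<degree P}"
  shows "list_minor (hermite_entry (map_poly h P) (map_poly h Q)) xs =
    h (det (submatrix (Her P Q) (set xs) (set xs)))"
proof -
  interpret h: idom_hom h by fact
  let ?I = "set xs"
  have deg: "degree (map_poly h P) = degree P" by (rule map_poly_monic(1)[OF monic]) simp_all
  have carr: "Her P Q \<in> carrier_mat (degree P) (degree P)" by (simp add: Her_def)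
  have "h (det (submatrix (Her P Q) ?I ?I)) = det (map_mat h (submatrix (Her P Q) ?I ?I))"
    by (rule h.hom_det[symmetric])
  also have "\<dots> = det (submatrix (Her (map_poly h P) (map_poly h Q)) ?I ?I)"
    by (simp add: map_mat_submatrix[OF carr xs(2)] map_mat_Her[OF h monic])
  also have "\<dots> = list_minor (\<lambda>i j. Her (map_poly h P) (map_poly h Q) $$ (i, j)) xs"
    by (rule list_minor_eq_det_submatrix[symmetric, of _ "degree P"])
       (use xs deg in \<open>simp_all add: Her_def\<close>)
  also have "\<dots> = list_minor (hermite_entry (map_poly h P) (map_poly h Q)) xs"
    using xs(2) deg by (intro list_minor_cong) (simp add: Her_def hermite_entry_def subset_iff)
  finally show ?thesis by simp
qed

theorem theorem27:
  fixes \<phi> :: "'k::linordered_field \<Rightarrow> 'r::real_closed_field"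
    and m p :: nat
    and P :: "'k mpoly poly"
    and Ps :: "'k mpoly poly list"
    and \<tau> :: "'k mpoly \<Rightarrow> 'r"
    and ord_sign :: "((nat \<Rightarrow> 'r) \<times> (nat \<Rightarrow> 'r)) set"
    and ord_inv :: "((nat \<Rightarrow> nat) \<times> (nat \<Rightarrow> nat)) set"
  assumes "field_hom \<phi>" and "mono \<phi>"
    and "P \<in> poly_over (mpoly_ring m)" and "lead_coeff P = 1" and "degree P = p"
    and "set Ps \<subseteq> poly_over (mpoly_ring m)"
    and "linear_order_on (sign_conditions (length Ps)) ord_sign"
    and "linear_order_on (inv_conditions (length Ps)) ord_inv"
    and "\<tau> \<in> HElim P Ps \<rightarrow>\<^sub>E {0, 1, -1}"
  shows "\<exists>feas_sign c_sign' feas_inv c_inv'.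
    \<forall>y \<in> Reali_sign \<phi> m (HElim P Ps) \<tau>.
      (let Qs = map (specialize \<phi> y) Ps; Z = zero_set (specialize \<phi> y P) in
        Feas_sign ord_sign Qs (base_part Z) = feas_sign \<and>
        Feas_inv ord_inv Qs (nonbase_part Z) = feas_inv \<and>
        c_sign ord_sign Qs (base_part Z) = c_sign' \<and>
        c_inv ord_inv Qs (nonbase_part Z) = c_inv')"
proof -
  let ?Reali = "Reali_sign \<phi> m (HElim P Ps) \<tau>"
  let ?Qs = "\<lambda>y. map (specialize \<phi> y) Ps" and ?Z = "\<lambda>y. zero_set (specialize \<phi> y P)"
  have counts: "count_sign (?Qs y) (base_part (?Z y)) = count_sign (?Qs y') (base_part (?Z y'))"
    "count_inv (?Qs y) (nonbase_part (?Z y)) = count_inv (?Qs y') (nonbase_part (?Z y'))"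
    if y: "y \<in> ?Reali" and y': "y' \<in> ?Reali" for y y'
  proof -
    have hom: "idom_hom (mpoly_eval \<phi> y)" for y by (rule idom_hom_mpoly_eval[OF assms(1)])
    have spec: "lead_coeff (specialize \<phi> y P) = 1" "degree (specialize \<phi> y P) = degree P" for y
    proof -
      interpret h: idom_hom "mpoly_eval \<phi> y" by (rule hom)
      show "lead_coeff (specialize \<phi> y P) = 1" "degree (specialize \<phi> y P) = degree P"
        unfolding specialize_def by (rule map_poly_monic[OF assms(4)]; simp)+
    qed
    have minors: "sgn (list_minor (hermite_entry (specialize \<phi> y P)
          (\<Prod>j<length (?Qs y). (?Qs y ! j) ^ \<alpha> j)) xs) =
        sgn (list_minor (hermite_entry (specialize \<phi> y' P)
          (\<Prod>j<length (?Qs y). (?Qs y' ! j) ^ \<alpha> j)) xs)"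
      if \<alpha>: "\<forall>j. \<alpha> j \<in> {0, 1, 2}"
        "card {j. j < length (?Qs y) \<and> \<alpha> j \<noteq> 0} \<le> floorlog 2 (degree (specialize \<phi> y P))"
        and xs: "distinct xs" "set xs \<subseteq> {..<degree (specialize \<phi> y P)}" for \<alpha> xs
    proof (cases "xs = []")
      case True
      then show ?thesis by (simp add: list_minor_def)
    next
      case False
      define Q where "Q = (\<Prod>j<length Ps. (Ps ! j) ^ \<alpha> j)"
      have "Q \<in> Prod_family (floorlog 2 (degree P)) Ps"
        unfolding Prod_family_def mem_Collect_eq
      proof (intro exI[of _ "restrict \<alpha> {..<length Ps}"] conjI)
        show "Q = (\<Prod>i<length Ps. (Ps ! i) ^ restrict \<alpha> {..<length Ps} i)"
          by (simp add: Q_def)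
        show "restrict \<alpha> {..<length Ps} \<in> {..<length Ps} \<rightarrow>\<^sub>E {0, 1, 2}" using \<alpha>(1) by auto
        have "{i. i < length Ps \<and> restrict \<alpha> {..<length Ps} i \<noteq> 0} = {j. j < length Ps \<and> \<alpha> j \<noteq> 0}"
          by auto
        then show "card {i. i < length Ps \<and> restrict \<alpha> {..<length Ps} i \<noteq> 0} \<le> floorlog 2 (degree P)"
          using \<alpha>(2) by (simp add: spec)
      qed
      moreover have "det (submatrix (Her P Q) (set xs) (set xs)) \<in> HMin P Q"
        using xs(2) False by (auto simp: HMin_def spec)
      ultimately have "det (submatrix (Her P Q) (set xs) (set xs)) \<in> HElim P Ps"
        unfolding HElim_def by blast
      then have "sgn (mpoly_eval \<phi> y (det (submatrix (Her P Q) (set xs) (set xs)))) =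
          sgn (mpoly_eval \<phi> y' (det (submatrix (Her P Q) (set xs) (set xs))))"
        using y y' by (simp add: Reali_sign_def)
      moreover have "list_minor (hermite_entry (specialize \<phi> z P)
          (\<Prod>j<length (?Qs y). (?Qs z ! j) ^ \<alpha> j)) xs =
          mpoly_eval \<phi> z (det (submatrix (Her P Q) (set xs) (set xs)))" for z
      proof -
        interpret h: idom_hom "mpoly_eval \<phi> z" by (rule hom)
        interpret mh: map_poly_idom_hom "mpoly_eval \<phi> z" ..
        have "(\<Prod>j<length (?Qs y). (?Qs z ! j) ^ \<alpha> j) = map_poly (mpoly_eval \<phi> z) Q"
          by (simp add: Q_def specialize_def mh.hom_prod mh.hom_power)
        moreover have "set xs \<subseteq> {..<degree P}" using xs(2) by (simp only: spec)
        ultimately show ?thesis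
          using hom_hermite_minor[OF hom assms(4) xs(1), of z Q] by (simp add: specialize_def)
      qed
      ultimately show ?thesis by simp
    qed
    show "count_sign (?Qs y) (base_part (?Z y)) = count_sign (?Qs y') (base_part (?Z y'))"
      "count_inv (?Qs y) (nonbase_part (?Z y)) = count_inv (?Qs y') (nonbase_part (?Z y'))"
      by (rule hermite_minor_signs_determine_all_counts[OF spec(1) spec(1) _ _ minors];
          simp add: spec)+
  qed
  show ?thesis
  proof (cases "?Reali = {}")
    case False
    then obtain y0 where y0: "y0 \<in> ?Reali" by blast
    show ?thesis
    proof (intro exI ballI)
      fix y assume "y \<in> ?Reali"
      note eq = counts[OF this y0]
      show "let Qs = ?Qs y; Z = ?Z y in
        Feas_sign ord_sign Qs (base_part Z) = Feas_sign ord_sign (?Qs y0) (base_part (?Z y0)) \<and>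
        Feas_inv ord_inv Qs (nonbase_part Z) = Feas_inv ord_inv (?Qs y0) (nonbase_part (?Z y0)) \<and>
        c_sign ord_sign Qs (base_part Z) = c_sign ord_sign (?Qs y0) (base_part (?Z y0)) \<and>
        c_inv ord_inv Qs (nonbase_part Z) = c_inv ord_inv (?Qs y0) (nonbase_part (?Z y0))"
        by (simp only: Let_def Feas_sign_def Feas_inv_def c_sign_def c_inv_def eq length_map simp_thms)
    qed
  qed simp
qed

end
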